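(* If $z\subseteq\omega$ is $ITRM$-computable from each of two mutually $ITRM$-random reals $x,y\subseteq\omega$, then $z$ is $ITRM$-computable.
   Context: An infinite time register machine ($ITRM$) has finitely many registers, each holding a natural number, and runs a program of the same kind as a classical unlimited register machine (with an additional instruction querying membership of a number in an oracle), but in transfinite ordinal time: successor steps are as for register machines; at limit times the active program line is the limit inferior of earlier program lines and each register holds the limit inferior of its earlier contents, reset to $0$ if that limit inferior is infinite. $z$ is $ITRM$-computable from $y$ iff there is a program $P$ which, with oracle $y$, halts on every input $i\in\omega$ and outputs $1$ iff $i\in z$ and $0$ otherwise; $z$ is $ITRM$-computable iff it is computable from $\emptyset$. For a fixed pairing of reals $a\oplus b$ (the join of $a$ and $b$), a set $X\subseteq\mathfrak{P}(\omega)$ is $ITRM$-decidable in the oracle $y$ iff there is a program $P$ such that for all $x$, $P$ with oracle $x\oplus y$ halts with output $1$ if $x\in X$ and $0$ if $x\notin X$. $x$ is $ITRM$-random relative to $y$ iff there is no meager set $X\ni x$ that is $ITRM$-decidable in the oracle $y$. $x$ and $y$ are mutually $ITRM$-random iff $x$ is $ITRM$-random relative to $y$ and $y$ is $ITRM$-random relative to $x$. *)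

theory Defs
  imports "HOL-Analysis.Analysis" "HOL-Library.Extended_Nat"
begin

section \<open>Infinite time register machines\<close>

datatype instr =
    Zero nat
  | Succ nat
  | Oracle nat
  | Transfer nat nat  \<comment> \<open>source, target\<close>
  | Jump nat nat nat  \<comment> \<open>jump to the third argument if the registers have equal contents\<close>

type_synonym program = "instr list"

text \<open>The active line and the register contents. A program mentions only finitely many
  registers; all the others keep their initial content throughout a computation.\<close>

type_synonym config = "nat \<times> (nat \<Rightarrow> nat)"

fun exec :: "nat set \<Rightarrow> instr \<Rightarrow> config \<Rightarrow> config" where
  "exec A (Zero n) (l, R) = (Suc l, R(n := 0))"
| "exec A (Succ n) (l, R) = (Suc l, R(n := Suc (R n)))"
| "exec A (Oracle n) (l, R) = (Suc l, R(n := (if R n \<in> A then 1 else 0)))"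
| "exec A (Transfer m n) (l, R) = (Suc l, R(n := R m))"
| "exec A (Jump m n q) (l, R) = (if R m = R n then q else Suc l, R)"

text \<open>Ordinal time is represented by well-orders \<open>r\<close>; the elements of \<^term>\<open>Field r\<close> are the
  points in time.\<close>

definition liminf_before :: "'t rel \<Rightarrow> 't \<Rightarrow> ('t \<Rightarrow> nat) \<Rightarrow> enat" where
  "liminf_before r t f =
     (SUP s \<in> underS r t. INF u \<in> {u \<in> underS r t. (s, u) \<in> r}. enat (f u))"

definition limit_value :: "'t rel \<Rightarrow> 't \<Rightarrow> ('t \<Rightarrow> nat) \<Rightarrow> nat" where
  "limit_value r t f =
     (if liminf_before r t f = \<infinity> then 0 else the_enat (liminf_before r t f))"

definition is_start :: "'t rel \<Rightarrow> 't \<Rightarrow> bool" where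
  "is_start r t \<longleftrightarrow> t \<in> Field r \<and> underS r t = {}"

definition is_next :: "'t rel \<Rightarrow> 't \<Rightarrow> 't \<Rightarrow> bool" where
  "is_next r s t \<longleftrightarrow> s \<in> Field r \<and> t \<in> Field r \<and> underS r t = under r s"

definition is_limit :: "'t rel \<Rightarrow> 't \<Rightarrow> bool" where
  "is_limit r t \<longleftrightarrow> t \<in> Field r \<and> \<not> is_start r t \<and> (\<nexists>s. is_next r s t)"

definition itrm_run ::
  "'t rel \<Rightarrow> program \<Rightarrow> nat set \<Rightarrow> (nat \<Rightarrow> nat) \<Rightarrow> ('t \<Rightarrow> config) \<Rightarrow> bool" where
  "itrm_run r P A R\<^sub>0 c \<longleftrightarrow>
     Well_order r \<and>
     (\<forall>t. is_start r t \<longrightarrow> c t = (0, R\<^sub>0)) \<and>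
     (\<forall>s t. is_next r s t \<longrightarrow> fst (c s) < length P \<and> c t = exec A (P ! fst (c s)) (c s)) \<and>
     (\<forall>t. is_limit r t \<longrightarrow>
        c t = (limit_value r t (\<lambda>u. fst (c u)), \<lambda>k. limit_value r t (\<lambda>u. snd (c u) k)))"

definition itrm_halting_run ::
  "'t rel \<Rightarrow> program \<Rightarrow> nat set \<Rightarrow> (nat \<Rightarrow> nat) \<Rightarrow> nat \<Rightarrow> bool" where
  "itrm_halting_run r P A R\<^sub>0 n \<longleftrightarrow>
     (\<exists>c t. itrm_run r P A R\<^sub>0 c \<and> t \<in> Field r \<and> under r t = Field r \<and>
            length P \<le> fst (c t) \<and> snd (c t) 0 = n)"

text \<open>\<open>P\<close> with oracle \<open>A\<close> and initial register contents \<open>R\<^sub>0\<close> halts with output \<open>n\<close> (in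
  register 0). The type of \<open>r\<close> only provides the countable ordinals as times, but no halting
  computation is lost: see \<open>itrm_halting_run_imp_outputs\<close> below, where the well-order
  is on an arbitrary type.\<close>

definition itrm_outputs :: "program \<Rightarrow> nat set \<Rightarrow> (nat \<Rightarrow> nat) \<Rightarrow> nat \<Rightarrow> bool" where
  "itrm_outputs P A R\<^sub>0 n \<longleftrightarrow> (\<exists>r :: nat rel. itrm_halting_run r P A R\<^sub>0 n)"

lemma itrm_run_transport:
  fixes r :: "'a rel" and e :: "'a \<Rightarrow> 'b"
  assumes run: "itrm_halting_run r P A R\<^sub>0 n" and inj: "inj_on e (Field r)"
  shows "itrm_halting_run (dir_image r e) P A R\<^sub>0 n"
proof -
  obtain c t where c: "itrm_run r P A R\<^sub>0 c" and t: "t \<in> Field r" "under r t = Field r"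
    and h: "length P \<le> fst (c t)" "snd (c t) 0 = n"
    using run unfolding itrm_halting_run_def by blast
  let ?r = "dir_image r e"
  define d where "d = c \<circ> inv_into (Field r) e"
  have de: "d (e a) = c a" if "a \<in> Field r" for a
    using that inj by (simp add: d_def)
  have F: "Field ?r = e ` Field r" by (rule dir_image_Field)
  have mem: "(e a, e b) \<in> ?r \<longleftrightarrow> (a, b) \<in> r" if "a \<in> Field r" "b \<in> Field r" for a b
    using that inj unfolding dir_image_def
    by (auto dest!: inj_onD[OF inj] intro: FieldI1 FieldI2)
  have un: "under ?r (e a) = e ` under r a" if a: "a \<in> Field r" for a
  proof -
    have "under ?r (e a) = {x \<in> e ` Field r. (x, e a) \<in> ?r}"
      unfolding under_def F[symmetric] by (auto intro: FieldI1)
    also have "\<dots> = e ` {b \<in> Field r. (b, a) \<in> r}" using mem a by auto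
    also have "{b \<in> Field r. (b, a) \<in> r} = under r a" by (auto simp: under_def intro: FieldI1)
    finally show ?thesis .
  qed
  have unS: "underS ?r (e a) = e ` underS r a" if a: "a \<in> Field r" for a
  proof -
    have "underS ?r (e a) = under ?r (e a) - e ` {a}" by (auto simp: underS_def under_def)
    also have "\<dots> = e ` (under r a - {a})"
      unfolding un[OF a] using inj_on_image_set_diff[OF inj, of "under r a" "{a}"] a
      by (simp add: Order_Relation.under_Field Diff_subset[THEN subset_trans])
    also have "under r a - {a} = underS r a" by (auto simp: underS_def under_def)
    finally show ?thesis .
  qed
  have inj2: "e ` X = e ` Y \<longleftrightarrow> X = Y" if "X \<subseteq> Field r" "Y \<subseteq> Field r" for X Y
    using inj that by (rule inj_on_image_eq_iff)
  have st: "is_start ?r (e a) \<longleftrightarrow> is_start r a" if "a \<in> Field r" for a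
    using that by (simp add: is_start_def F unS)
  have nx: "is_next ?r (e a) (e b) \<longleftrightarrow> is_next r a b" if "a \<in> Field r" "b \<in> Field r" for a b
    using that by (simp add: is_next_def F un unS inj2 Order_Relation.under_Field Order_Relation.underS_Field)
  have lm: "is_limit ?r (e a) \<longleftrightarrow> is_limit r a" if a: "a \<in> Field r" for a
  proof -
    have "(\<exists>s. is_next ?r s (e a)) \<longleftrightarrow> (\<exists>s. is_next r s a)"
      using nx[OF _ a] unfolding is_next_def F by blast
    then show ?thesis using a by (simp add: is_limit_def F st)
  qed
  have lv: "limit_value ?r (e a) (\<lambda>u. g (d u)) = limit_value r a (\<lambda>u. g (c u))"
    if a: "a \<in> Field r" for a and g :: "config \<Rightarrow> nat"
  proof -
    have "(INF u \<in> {u \<in> e ` underS r a. (e s, u) \<in> ?r}. enat (g (d u)))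
        = (INF u \<in> {u \<in> underS r a. (s, u) \<in> r}. enat (g (c u)))" if s: "s \<in> underS r a" for s
    proof -
      have "{u \<in> e ` underS r a. (e s, u) \<in> ?r} = e ` {u \<in> underS r a. (s, u) \<in> r}"
        using s mem Order_Relation.underS_Field[where r = r] by blast
      moreover have "g (d (e u)) = g (c u)" if "u \<in> underS r a" for u
        using de[of u] subsetD[OF Order_Relation.underS_Field that] by simp
      ultimately show ?thesis by (simp add: image_image)
    qed
    then have "liminf_before ?r (e a) (\<lambda>u. g (d u)) = liminf_before r a (\<lambda>u. g (c u))"
      unfolding liminf_before_def unS[OF a] image_image by (rule SUP_cong[OF refl])
    then show ?thesis by (simp add: limit_value_def)
  qed
  have wo: "Well_order ?r"
    using c inj by (auto simp: itrm_run_def intro: Well_order_dir_image)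
  have "itrm_run ?r P A R\<^sub>0 d"
    unfolding itrm_run_def
  proof (intro conjI allI impI)
    show "Well_order ?r" by (fact wo)
  next
    fix x assume x: "is_start ?r x"
    then obtain a where "x = e a" "a \<in> Field r" unfolding is_start_def F by blast
    then show "d x = (0, R\<^sub>0)" using x c st de by (simp add: itrm_run_def)
  next
    fix x y assume xy: "is_next ?r x y"
    then obtain a b where ab: "x = e a" "a \<in> Field r" "y = e b" "b \<in> Field r"
      unfolding is_next_def F by blast
    then have "is_next r a b" using xy nx by simp
    then show "fst (d x) < length P" "d y = exec A (P ! fst (d x)) (d x)"
      using c ab de by (simp_all add: itrm_run_def)
  next
    fix x assume x: "is_limit ?r x"
    then obtain a where a: "x = e a" "a \<in> Field r" unfolding is_limit_def F by blast
    then have "is_limit r a" using x lm by simp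
    then show "d x = (limit_value ?r x (\<lambda>u. fst (d u)), \<lambda>k. limit_value ?r x (\<lambda>u. snd (d u) k))"
      using c a de lv[of a fst] lv[of a "\<lambda>q. snd q k" for k] by (simp add: itrm_run_def)
  qed
  moreover have "e t \<in> Field ?r" "under ?r (e t) = Field ?r"
    using t by (simp_all add: F un)
  ultimately show ?thesis
    unfolding itrm_halting_run_def using h de[OF t(1)] by metis
qed

lemma itrm_halting_run_countable:
  fixes r :: "'a rel"
  assumes run: "itrm_halting_run r P A R\<^sub>0 n"
  shows "\<exists>H. countable H \<and> H \<subseteq> Field r \<and> itrm_halting_run (Restr r H) P A R\<^sub>0 n"
proof -
  obtain c t\<^sub>0 where c: "itrm_run r P A R\<^sub>0 c" and t0: "t\<^sub>0 \<in> Field r" "under r t\<^sub>0 = Field r"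
    and h: "length P \<le> fst (c t\<^sub>0)" "snd (c t\<^sub>0) 0 = n"
    using run unfolding itrm_halting_run_def by blast
  have wo: "Well_order r" using c by (simp add: itrm_run_def)
  then have wr: "wo_rel r" by (simp add: wo_rel_def)
  note REFL = wo_rel.REFL[OF wr] and TRANS = wo_rel.TRANS[OF wr]
    and ANTISYM = wo_rel.ANTISYM[OF wr] and TOTALS = wo_rel.TOTALS[OF wr]
  define f where "f j = (\<lambda>u. case j of 0 \<Rightarrow> fst (c u) | Suc k \<Rightarrow> snd (c u) k)" for j
  define bound where "bound t j m s \<longleftrightarrow>
    s \<in> underS r t \<and> (\<forall>u\<in>underS r t. (s, u) \<in> r \<longrightarrow> m \<le> f j u)" for t j m s
  define mini where "mini t j s u \<longleftrightarrow> u \<in> underS r t \<and> (s, u) \<in> r \<and>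
    (\<forall>v\<in>underS r t. (s, v) \<in> r \<longrightarrow> f j u \<le> f j v)" for t j s u
  define G where "G X = X
    \<union> (\<Union>t\<in>X. {SOME s. is_next r s t}) \<union> (\<Union>t\<in>X. {SOME s. is_next r t s})
    \<union> (\<Union>t\<in>X. \<Union>j. \<Union>m. {SOME s. bound t j m s})
    \<union> (\<Union>t\<in>X. \<Union>j. \<Union>s\<in>X. {SOME u. mini t j s u})" for X
  define K where "K i = (G ^^ i) {t\<^sub>0}" for i
  have K0: "K 0 = {t\<^sub>0}" and KS: "K (Suc i) = G (K i)" for i by (simp_all add: K_def)
  have cntK: "countable (K i)" for i
    by (induction i) (auto simp: K0 KS G_def)
  have "K i \<subseteq> K (Suc i)" for i unfolding KS G_def by blast
  then have mono: "K i \<subseteq> K k" if "i \<le> k" for i k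
    using that by (rule lift_Suc_mono_le)
  define H where "H = (\<Union>i. K i) \<inter> Field r"
  have HF: "H \<subseteq> Field r" by (simp add: H_def)
  have t0H: "t\<^sub>0 \<in> H" using K0 t0 by (auto simp: H_def)
  have cntH: "countable H" using cntK by (simp add: H_def countable_Int1)
  have in1: "x \<in> H" if "x \<in> G (K i)" "x \<in> Field r" for x i
    using that KS[of i] unfolding H_def by blast
  have next_fun: "s = s'" if "is_next r s t" "is_next r s' t" for s s' t
    using that REFL ANTISYM unfolding is_next_def under_def refl_on_def antisym_def by blast
  have next_inj: "t = t'" if "is_next r s t" "is_next r s t'" for s t t'
  proof -
    have "underS r t = underS r t'" "t \<in> Field r" "t' \<in> Field r"
      using that by (auto simp: is_next_def)
    then show ?thesis using TOTALS unfolding underS_def by blast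
  qed
  have Hpred: "s \<in> H" if h: "t \<in> H" "is_next r s t" for s t
  proof -
    have "(SOME s. is_next r s t) = s" using that next_fun by blast
    moreover obtain i where "t \<in> K i" using h H_def by blast
    ultimately have "s \<in> G (K i)" unfolding G_def by blast
    then show ?thesis using in1 that by (simp add: is_next_def)
  qed
  have Hsucc: "t \<in> H" if h: "s \<in> H" "is_next r s t" for s t
  proof -
    have "(SOME t. is_next r s t) = t" using that next_inj by blast
    moreover obtain i where "s \<in> K i" using h H_def by blast
    ultimately have "t \<in> G (K i)" unfolding G_def by blast
    then show ?thesis using in1 that by (simp add: is_next_def)
  qed
  have Hbound: "\<exists>s\<in>H. bound t j m s" if h: "t \<in> H" "\<exists>s. bound t j m s" for t j m
  proof -
    let ?s = "SOME s. bound t j m s"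
    have b: "bound t j m ?s" using that(2) by (rule someI_ex)
    obtain i where "t \<in> K i" using h H_def by blast
    then have "?s \<in> G (K i)" unfolding G_def by blast
    then have "?s \<in> H" using in1 b Order_Relation.underS_Field[where r = r] by (auto simp: bound_def)
    then show ?thesis using b by blast
  qed
  have Hmini: "\<exists>u\<in>H. mini t j s u" if t: "t \<in> H" and s: "s \<in> H" "s \<in> underS r t" for t j s
  proof -
    let ?u = "SOME u. mini t j s u"
    have "s \<in> underS r t \<and> (s, s) \<in> r"
      using s HF REFL by (auto simp: refl_on_def)
    then have "\<exists>u. mini t j s u"
      using ex_has_least_nat[of "\<lambda>u. u \<in> underS r t \<and> (s, u) \<in> r" s "f j"]
      unfolding mini_def by blast
    then have b: "mini t j s ?u" by (rule someI_ex)
    obtain i k where "t \<in> K i" "s \<in> K k" using t s H_def by blast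
    then have "t \<in> K (max i k)" "s \<in> K (max i k)" using mono by (meson max.cobounded1 max.cobounded2 subsetD)+
    then have "?u \<in> G (K (max i k))" unfolding G_def by (intro UnI2) auto
    then have "?u \<in> H" using in1 b Order_Relation.underS_Field[where r = r] by (auto simp: mini_def)
    then show ?thesis using b by blast
  qed
  let ?r = "Restr r H"
  have wo': "Well_order ?r" using wo by (rule Well_order_Restr)
  have F: "Field ?r = H" using REFL HF by (rule Refl_Field_Restr2)
  have un: "under ?r a = under r a \<inter> H" if "a \<in> H" for a using that by (auto simp: under_def)
  have unS: "underS ?r a = underS r a \<inter> H" if "a \<in> H" for a using that by (auto simp: underS_def)
  have st: "is_start r t" if t: "is_start ?r t" for t
  proof (rule ccontr)
    assume ns: "\<not> is_start r t"
    have tH: "t \<in> H" using t F by (simp add: is_start_def)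
    then have "underS r t \<noteq> {}" using ns HF by (auto simp: is_start_def)
    then have "\<exists>s. bound t 0 0 s" by (auto simp: bound_def)
    then obtain s where "s \<in> H" "bound t 0 0 s" using Hbound[OF tH] by blast
    then have "s \<in> H" "s \<in> underS r t" by (simp_all add: bound_def)
    then show False using t tH unS by (auto simp: is_start_def)
  qed
  have ex_next: "\<exists>s'. is_next r s s' \<and> (s', t) \<in> r" if "s \<in> underS r t" for s t
  proof -
    have ne: "AboveS r {s} \<noteq> {}"
      using that by (auto simp: AboveS_def underS_def Field_def)
    have sF: "{s} \<subseteq> Field r" using that Order_Relation.underS_Field[where r = r] by auto
    have "is_next r s (wo_rel.suc r {s})"
      unfolding is_next_def
    proof (intro conjI)
      show "s \<in> Field r" "wo_rel.suc r {s} \<in> Field r" using sF wo_rel.suc_inField[OF wr sF ne] by auto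
      have 1: "s \<noteq> wo_rel.suc r {s}" "(s, wo_rel.suc r {s}) \<in> r" using wo_rel.suc_greater[OF wr sF ne] by auto
      show "underS r (wo_rel.suc r {s}) = under r s"
      proof
        show "under r s \<subseteq> underS r (wo_rel.suc r {s})"
          using 1 TRANS ANTISYM unfolding under_def underS_def trans_def antisym_def by blast
        show "underS r (wo_rel.suc r {s}) \<subseteq> under r s"
        proof
          fix x assume x: "x \<in> underS r (wo_rel.suc r {s})"
          then have xF: "x \<in> Field r" using Order_Relation.underS_Field[where r = r] by blast
          show "x \<in> under r s"
          proof (rule ccontr)
            assume "x \<notin> under r s"
            then have "(s, x) \<in> r" "s \<noteq> x" using xF sF TOTALS REFL unfolding under_def refl_on_def by blast+
            then have "x \<in> AboveS r {s}" using xF by (auto simp: AboveS_def)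
            then have "(wo_rel.suc r {s}, x) \<in> r" by (rule wo_rel.suc_least_AboveS[OF wr])
            then show False using x ANTISYM unfolding underS_def antisym_def by blast
          qed
        qed
      qed
    qed
    moreover have "(wo_rel.suc r {s}, t) \<in> r"
      by (rule wo_rel.suc_least_AboveS[OF wr]) (use that in \<open>auto simp: AboveS_def underS_def Field_def\<close>)
    ultimately show ?thesis by blast
  qed
  have nx: "is_next r s t" if st: "is_next ?r s t" for s t
  proof -
    have sH: "s \<in> H" and tH: "t \<in> H" and eq: "underS r t \<inter> H = under r s \<inter> H"
      using st F un unS by (auto simp: is_next_def)
    have "s \<in> underS r t" using sH HF REFL eq by (auto simp: under_def refl_on_def)
    then obtain s' where s': "is_next r s s'" "(s', t) \<in> r" using ex_next by blast
    have "s' \<in> H" using Hsucc sH s' by blast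
    moreover have "s' \<notin> under r s"
      using s'(1) by (metis is_next_def underS_notIn)
    ultimately have "s' \<notin> underS r t" using eq by blast
    then have "s' = t" using s'(2) by (auto simp: underS_def)
    then show ?thesis using s' by simp
  qed
  have lm: "is_limit r t" if t: "is_limit ?r t" for t
  proof -
    have tH: "t \<in> H" using t F by (simp add: is_limit_def)
    have "\<not> is_start r t" using t tH F unS by (auto simp: is_limit_def is_start_def)
    moreover have False if s: "is_next r s t" for s
    proof -
      have "s \<in> H" using Hpred tH s by blast
      then have "is_next ?r s t" using s tH F un unS by (simp add: is_next_def)
      then show False using t by (auto simp: is_limit_def)
    qed
    ultimately show ?thesis using tH HF by (auto simp: is_limit_def)
  qed
  have lv: "limit_value ?r t (f j) = limit_value r t (f j)" if tH: "t \<in> H" for t j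
  proof -
    define I where "I s = (INF u \<in> {u \<in> underS r t. (s, u) \<in> r}. enat (f j u))" for s
    have I': "(INF u \<in> {u \<in> underS ?r t. (s, u) \<in> ?r}. enat (f j u)) = I s"
      if s: "s \<in> underS ?r t" for s
    proof (rule antisym)
      have sH: "s \<in> H" "s \<in> underS r t" using s unS[OF tH] by auto
      obtain u where u: "u \<in> H" "mini t j s u" using Hmini[OF tH sH] by blast
      have "(INF u \<in> {u \<in> underS ?r t. (s, u) \<in> ?r}. enat (f j u)) \<le> enat (f j u)"
        by (rule INF_lower) (use u sH unS[OF tH] in \<open>auto simp: mini_def\<close>)
      also have "\<dots> \<le> I s"
        unfolding I_def by (rule INF_greatest) (use u in \<open>auto simp: mini_def\<close>)
      finally show "(INF u \<in> {u \<in> underS ?r t. (s, u) \<in> ?r}. enat (f j u)) \<le> I s" .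
      show "I s \<le> (INF u \<in> {u \<in> underS ?r t. (s, u) \<in> ?r}. enat (f j u))"
        unfolding I_def by (rule INF_superset_mono) (auto simp: unS[OF tH])
    qed
    have le: "I s \<le> (SUP s \<in> underS ?r t. I s)" if s: "s \<in> underS r t" for s
    proof -
      have "enat m \<le> (SUP s \<in> underS ?r t. I s)" if m: "enat m \<le> I s" for m
      proof -
        have "bound t j m s"
          unfolding bound_def
        proof (intro conjI ballI impI s)
          fix u assume "u \<in> underS r t" "(s, u) \<in> r"
          then have "I s \<le> enat (f j u)" unfolding I_def by (intro INF_lower) auto
          then show "m \<le> f j u" using m by (metis enat_ord_simps(1) order_trans)
        qed
        then obtain s' where s': "s' \<in> H" "bound t j m s'" using Hbound[OF tH] by blast
        have "enat m \<le> I s'"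
          unfolding I_def by (rule INF_greatest) (use s' in \<open>auto simp: bound_def\<close>)
        also have "\<dots> \<le> (SUP s \<in> underS ?r t. I s)"
          by (rule SUP_upper) (use s' unS[OF tH] in \<open>auto simp: bound_def\<close>)
        finally show ?thesis .
      qed
      then have key: "\<And>m. enat m \<le> I s \<Longrightarrow> enat m \<le> (SUP s \<in> underS ?r t. I s)" .
      show ?thesis
      proof (cases "I s")
        case (enat m)
        then show ?thesis using key by simp
      next
        case infinity
        then have "enat m \<le> (SUP s \<in> underS ?r t. I s)" for m using key by simp
        then have "(SUP s \<in> underS ?r t. I s) = \<infinity>"
          by (metis enat_ord_simps(1) not_infinity_eq not_less_eq_eq order_refl)
        then show ?thesis by simp
      qed
    qed
    have "liminf_before ?r t (f j) = (SUP s \<in> underS ?r t. I s)"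
      unfolding liminf_before_def using I' by (rule SUP_cong[OF refl])
    also have "\<dots> = (SUP s \<in> underS r t. I s)"
      by (intro antisym SUP_least le SUP_subset_mono) (auto simp: unS[OF tH])
    also have "\<dots> = liminf_before r t (f j)" by (simp add: liminf_before_def I_def)
    finally show ?thesis by (simp add: limit_value_def)
  qed
  have "itrm_run ?r P A R\<^sub>0 c"
    unfolding itrm_run_def
  proof (intro conjI allI impI)
    show "Well_order ?r" by (fact wo')
  next
    fix t assume "is_start ?r t"
    then show "c t = (0, R\<^sub>0)" using st c by (simp add: itrm_run_def)
  next
    fix s t assume "is_next ?r s t"
    then have "is_next r s t" by (rule nx)
    then show "fst (c s) < length P" "c t = exec A (P ! fst (c s)) (c s)"
      using c by (simp_all add: itrm_run_def)
  next
    fix t assume t: "is_limit ?r t"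
    then have tH: "t \<in> H" using F by (simp add: is_limit_def)
    have "c t = (limit_value r t (\<lambda>u. fst (c u)), \<lambda>k. limit_value r t (\<lambda>u. snd (c u) k))"
      using lm[OF t] c by (simp add: itrm_run_def)
    then show "c t = (limit_value ?r t (\<lambda>u. fst (c u)), \<lambda>k. limit_value ?r t (\<lambda>u. snd (c u) k))"
      using lv[OF tH, of 0] lv[OF tH, of "Suc k" for k] by (simp add: f_def)
  qed
  moreover have "t\<^sub>0 \<in> Field ?r" "under ?r t\<^sub>0 = Field ?r"
    using t0H t0 HF by (auto simp: F un)
  ultimately have "itrm_halting_run ?r P A R\<^sub>0 n"
    unfolding itrm_halting_run_def using h by blast
  then show ?thesis using cntH HF by blast
qed

theorem itrm_halting_run_imp_outputs:
  fixes r :: "'a rel"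
  assumes "itrm_halting_run r P A R\<^sub>0 n"
  shows "itrm_outputs P A R\<^sub>0 n"
proof -
  obtain H where H: "countable H" "itrm_halting_run (Restr r H) P A R\<^sub>0 n"
    using itrm_halting_run_countable[OF assms] by blast
  have "inj_on (to_nat_on H) (Field (Restr r H))"
    using inj_on_to_nat_on[OF H(1)] Field_Restr_subset[of r H] by (rule inj_on_subset)
  then show ?thesis
    unfolding itrm_outputs_def using itrm_run_transport[OF H(2)] by blast
qed

section \<open>Computability, decidability and randomness\<close>

definition itrm_computable_from :: "nat set \<Rightarrow> nat set \<Rightarrow> bool" where
  "itrm_computable_from z y \<longleftrightarrow>
     (\<exists>P. \<forall>i. itrm_outputs P y ((\<lambda>_. 0)(0 := i)) (if i \<in> z then 1 else 0))"

definition itrm_computable :: "nat set \<Rightarrow> bool" where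
  "itrm_computable z \<longleftrightarrow> itrm_computable_from z {}"

definition join :: "nat set \<Rightarrow> nat set \<Rightarrow> nat set" where
  "join a b = (\<lambda>i. 2 * i) ` a \<union> (\<lambda>i. 2 * i + 1) ` b"

definition itrm_decidable_in :: "nat set set \<Rightarrow> nat set \<Rightarrow> bool" where
  "itrm_decidable_in X y \<longleftrightarrow>
     (\<exists>P. \<forall>x. itrm_outputs P (join x y) (\<lambda>_. 0) (if x \<in> X then 1 else 0))"

definition cantor_space :: "nat set topology" where
  "cantor_space =
     pullback_topology UNIV (\<lambda>x i. i \<in> x) (product_topology (\<lambda>_. discrete_topology UNIV) UNIV)"

definition nowhere_dense_in :: "'a topology \<Rightarrow> 'a set \<Rightarrow> bool" where
  "nowhere_dense_in T S \<longleftrightarrow> S \<subseteq> topspace T \<and> T interior_of (T closure_of S) = {}"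

definition meager_in :: "'a topology \<Rightarrow> 'a set \<Rightarrow> bool" where
  "meager_in T S \<longleftrightarrow> (\<exists>N. countable N \<and> (\<forall>B\<in>N. nowhere_dense_in T B) \<and> S = \<Union>N)"

definition itrm_random_relative :: "nat set \<Rightarrow> nat set \<Rightarrow> bool" where
  "itrm_random_relative x y \<longleftrightarrow>
     \<not> (\<exists>X. meager_in cantor_space X \<and> x \<in> X \<and> itrm_decidable_in X y)"

definition mutually_itrm_random :: "nat set \<Rightarrow> nat set \<Rightarrow> bool" where
  "mutually_itrm_random x y \<longleftrightarrow> itrm_random_relative x y \<and> itrm_random_relative y x"

end

theory Submission
  imports Defs "HOL-Library.Countable_Set_Type" "HOL-Library.Nat_Bijection"
begin

text \<open>Let \<open>P\<close> compute \<open>z\<close> from \<open>x\<close>.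
  The relations decided by infinite time register machines contain the recursive ones and are
  closed under Boolean combinations and under passing from a relation to its accessible part: a
  depth-first search detects an infinite branch by the overflow of its stack register. The
  relation ``\<open>P\<close> with oracle \<open>x\<close> and input \<open>i\<close> halts with output \<open>n\<close>'' is obtained from these
  closure properties by induction on the set of registers that may overflow, and so is, for each
  relation obtained from them, the relation ``the finite condition \<open>s\<close> forces it'', where a
  condition forces a set of reals if the set is comeager in the corresponding cylinder.

  The set of all \<open>x'\<close> from which \<open>P\<close> computes \<open>z\<close> is thus decidable in \<open>y\<close>. It contains \<open>x\<close>, so
  it is not meager, and by the Baire property some condition \<open>s\<close> forces it. Now \<open>i \<in> z\<close> iff \<open>s\<close>
  forces that \<open>P\<close> outputs 1 on input \<open>i\<close>, which a machine without oracle decides.\<close>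

section \<open>Transfinite runs\<close>

text \<open>The obstacle is the limit rule: it refers to an infinite sequence of runs, which an
  inductive definition over numbers cannot have as a premise. If no register overflows at the limit,
  the sequence can be regrouped so that all segments have the same minimum; by determinism such a
  sequence exists as soon as finite chains of every length do, and these are countably many premises
  about numbers. If exactly the registers in \<open>T\<close> overflow, then from some point on they
  are positive, and as an overflow resets a register to 0, none of them overflows within the later
  segments. These segments are runs with fewer overflowing registers, already treated, and the
  sequence is an infinite path of a relation on numbers, that is, a failure of accessibility.
  Inductive definitions with infinitely many premises reduce to accessible parts as well
  (\<open>gm_iff_accp\<close>), and forcing an accessible part is again such a definition, over
  pairs of a condition and a point.\<close>

type_synonym vec = "nat \<Rightarrow> nat"

definition diverges :: "(nat \<Rightarrow> nat) \<Rightarrow> bool" where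
  "diverges f \<longleftrightarrow> (\<nexists>b. \<exists>\<^sub>\<infinity>i. f i \<le> b)"

definition limn :: "(nat \<Rightarrow> nat) \<Rightarrow> nat" where
  "limn f = (if diverges f then 0 else LEAST b. \<exists>\<^sub>\<infinity>i. f i \<le> b)"

text \<open>In \<open>tcl S B c d M\<close> the vector \<open>M\<close> is the coordinatewise minimum along the run from \<open>c\<close> to \<open>d\<close>,
  including \<open>c\<close> but excluding \<open>d\<close>; at limits, only coordinates in \<open>S\<close> may overflow. As halting
  times are countable, limits of \<open>\<omega>\<close>-sequences of runs suffice.\<close>

inductive tcl :: "nat set \<Rightarrow> (vec \<Rightarrow> vec \<Rightarrow> vec \<Rightarrow> bool) \<Rightarrow> vec \<Rightarrow> vec \<Rightarrow> vec \<Rightarrow> bool" for S B where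
  base: "B c d M \<Longrightarrow> tcl S B c d M"
| trans: "tcl S B c d M \<Longrightarrow> tcl S B d e N \<Longrightarrow> tcl S B c e (\<lambda>j. min (M j) (N j))"
| lim: "(\<And>i. tcl S B (g i) (g (Suc i)) (Ms i)) \<Longrightarrow> {j. diverges (\<lambda>i. Ms i j)} \<subseteq> S \<Longrightarrow>
    tcl S B (g 0) (\<lambda>j. limn (\<lambda>i. Ms i j)) (\<lambda>j. Inf (range (\<lambda>i. Ms i j)))"

definition cof :: "'t rel \<Rightarrow> 't \<Rightarrow> ('t \<Rightarrow> nat) \<Rightarrow> nat \<Rightarrow> bool" where
  "cof r t f b \<longleftrightarrow> (\<forall>s\<in>underS r t. \<exists>u\<in>underS r t. (s, u) \<in> r \<and> f u \<le> b)"

text \<open>Over the natural numbers a limit inferior is at most \<open>b\<close> iff values at most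
  \<open>b\<close> occur cofinally often. Hence minima over segments suffice to compute limits,
  which is why runs record them.\<close>

lemma limit_value_eq:
  "limit_value r t f = (if \<exists>b. cof r t f b then LEAST b. cof r t f b else 0)"
proof -
  have le: "liminf_before r t f \<le> enat b \<longleftrightarrow> cof r t f b" for b
  proof -
    have 1: "x \<le> enat b \<longleftrightarrow> x < enat (Suc b)" for x by (cases x) auto
    show ?thesis
      unfolding liminf_before_def SUP_le_iff cof_def
      by (intro ball_cong refl, unfold 1, unfold INF_less_iff) (auto simp: less_Suc_eq_le)
  qed
  show ?thesis
  proof (cases "liminf_before r t f")
    case (enat m)
    then have "cof r t f b \<longleftrightarrow> m \<le> b" for b using le[of b] by simp
    then have "(LEAST b. cof r t f b) = m" "cof r t f m" by (auto intro: Least_equality)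
    then show ?thesis using enat by (auto simp: limit_value_def)
  next
    case infinity
    then have "\<not> cof r t f b" for b using le[of b] by simp
    then show ?thesis using infinity by (simp add: limit_value_def)
  qed
qed

definition iv :: "'t rel \<Rightarrow> 't \<Rightarrow> 't \<Rightarrow> 't set" where
  "iv r s t = {u \<in> underS r t. (s, u) \<in> r}"

definition seg_min :: "'t rel \<Rightarrow> ('t \<Rightarrow> vec) \<Rightarrow> 't \<Rightarrow> 't \<Rightarrow> vec" where
  "seg_min r c s t j = Inf ((\<lambda>u. c u j) ` iv r s t)"

lemma Inf_nat_image_le_iff:
  fixes f :: "'a \<Rightarrow> nat"
  assumes "X \<noteq> {}"
  shows "Inf (f ` X) \<le> b \<longleftrightarrow> (\<exists>x\<in>X. f x \<le> b)"
proof
  assume "Inf (f ` X) \<le> b"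
  moreover have "Inf (f ` X) \<in> f ` X" using assms by (intro Inf_nat_def1) auto
  ultimately show "\<exists>x\<in>X. f x \<le> b" by auto
next
  assume "\<exists>x\<in>X. f x \<le> b"
  then show "Inf (f ` X) \<le> b" by (meson bdd_below_bot cINF_lower2)
qed

lemma dependent_choice_from:
  assumes "P 0 a" and step: "\<And>n x. P n x \<Longrightarrow> \<exists>y. P (Suc n) y \<and> Q n x y"
  obtains f where "f 0 = a" "\<And>n. P n (f n)" "\<And>n. Q n (f n) (f (Suc n))"
proof -
  have "\<exists>f. \<forall>n. (P n (f n) \<and> (n = 0 \<longrightarrow> f n = a)) \<and> Q n (f n) (f (Suc n))"
    by (rule dependent_nat_choice) (use assms in auto)
  then show ?thesis using that by blast
qed

lemma nat_eq_by_le: "(\<And>b. (m::nat) \<le> b \<longleftrightarrow> n \<le> b) \<Longrightarrow> m = n"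
  by (metis order_refl order_antisym)

section \<open>Segments of well-ordered time and fundamental sequences\<close>

locale wtime =
  fixes r :: "'a rel"
  assumes WELL: "Well_order r"
begin

lemma wr: "wo_rel r" using WELL by (simp add: wo_rel_def)

lemmas TRANS = wo_rel.TRANS[OF wr] and ANTISYM = wo_rel.ANTISYM[OF wr]
  and REFL = wo_rel.REFL[OF wr] and TOTALS = wo_rel.TOTALS[OF wr]

lemma lt_trans: "(a,b) \<in> r \<Longrightarrow> (b,c) \<in> r \<Longrightarrow> (a,c) \<in> r"
  using TRANS unfolding trans_def by blast

lemma lt_antisym: "(a,b) \<in> r \<Longrightarrow> (b,a) \<in> r \<Longrightarrow> a = b"
  using ANTISYM unfolding antisym_def by blast

lemma lt_refl: "a \<in> Field r \<Longrightarrow> (a,a) \<in> r"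
  using REFL unfolding refl_on_def by blast

lemma lt_total: "a \<in> Field r \<Longrightarrow> b \<in> Field r \<Longrightarrow> (a,b) \<in> r \<or> (b,a) \<in> r"
  using TOTALS by blast

lemma iv_split:
  assumes "s \<in> underS r t" "t \<in> underS r u"
  shows "iv r s u = iv r s t \<union> iv r t u" "iv r s t \<noteq> {}" "iv r t u \<noteq> {}"
proof -
  have F: "s \<in> Field r" "t \<in> Field r" "u \<in> Field r"
    using assms unfolding underS_def Field_def by auto
  show "iv r s u = iv r s t \<union> iv r t u"
  proof (intro set_eqI iffI)
    fix x assume x: "x \<in> iv r s u"
    then have "x \<in> Field r" by (auto simp: iv_def Field_def)
    then show "x \<in> iv r s t \<union> iv r t u"
      using x F lt_total[of x t] lt_refl by (auto simp: iv_def underS_def)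
  next
    fix x assume "x \<in> iv r s t \<union> iv r t u"
    then show "x \<in> iv r s u"
      using assms lt_trans lt_antisym unfolding iv_def underS_def by blast
  qed
  show "iv r s t \<noteq> {}" "iv r t u \<noteq> {}"
    using assms lt_refl F by (auto simp: iv_def)
qed

lemma seg_min_trans:
  assumes "s \<in> underS r t" "t \<in> underS r u"
  shows "seg_min r c s u = (\<lambda>j. min (seg_min r c s t j) (seg_min r c t u j))"
proof
  fix j
  have ne: "iv r s t \<union> iv r t u \<noteq> {}" using iv_split[OF assms] by auto
  show "seg_min r c s u j = min (seg_min r c s t j) (seg_min r c t u j)"
    unfolding seg_min_def iv_split(1)[OF assms]
    by (rule nat_eq_by_le)
       (auto simp: min_le_iff_disj Inf_nat_image_le_iff[OF ne] Inf_nat_image_le_iff[OF iv_split(2)[OF assms]]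
         Inf_nat_image_le_iff[OF iv_split(3)[OF assms]])
qed

text \<open>A fundamental sequence of the limit time \<open>t\<close>; it turns the limit inferior
  over all earlier times into one over the natural numbers.\<close>

definition tseq :: "'a \<Rightarrow> (nat \<Rightarrow> 'a) \<Rightarrow> bool" where
  "tseq t h \<longleftrightarrow> (\<forall>i. h i \<in> underS r t \<and> h i \<in> underS r (h (Suc i))) \<and>
     (\<forall>s\<in>underS r t. \<exists>i. (s, h i) \<in> r)"

lemma tseq_mono: "tseq t h \<Longrightarrow> i \<le> k \<Longrightarrow> (h i, h k) \<in> r"
proof (induction k)
  case 0
  then show ?case using lt_refl Order_Relation.underS_Field[of r t] by (auto simp: tseq_def)
next
  case (Suc k)
  show ?case
  proof (cases "i = Suc k")
    case True
    then show ?thesis using Suc lt_refl Order_Relation.underS_Field[of r t] by (auto simp: tseq_def)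
  next
    case False
    then have "(h i, h k) \<in> r" using Suc by auto
    moreover have "(h k, h (Suc k)) \<in> r" using Suc(2) by (auto simp: tseq_def underS_def)
    ultimately show ?thesis by (rule lt_trans)
  qed
qed

lemma tseq_locate:
  assumes "tseq t h" "u \<in> underS r t" "(h i, u) \<in> r"
  shows "\<exists>k\<ge>i. u \<in> iv r (h k) (h (Suc k))"
proof -
  obtain m where m: "(u, h m) \<in> r" using assms by (auto simp: tseq_def)
  let ?P = "\<lambda>m. u \<in> underS r (h m)"
  have um: "?P (Suc m)" using m assms(1) lt_trans lt_antisym unfolding tseq_def underS_def by blast
  \<comment> \<open>The first term beyond \<open>u\<close> has a predecessor, whose index is the one
    sought.\<close>
  define k where "k = (LEAST m. ?P m)"
  have k: "?P k" unfolding k_def using um by (rule LeastI)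
  have "\<not> k \<le> i"
  proof
    assume "k \<le> i"
    then have "(h k, h i) \<in> r" by (rule tseq_mono[OF assms(1)])
    then have "(h k, u) \<in> r" using assms(3) lt_trans by blast
    then show False using k lt_antisym by (auto simp: underS_def)
  qed
  then obtain k' where k': "k = Suc k'" "i \<le> k'" by (cases k) auto
  have "\<not> ?P k'" using k' not_less_Least[of k' ?P] unfolding k_def by auto
  moreover have "u \<in> Field r" "h k' \<in> Field r" using assms Order_Relation.underS_Field[of r t] by (auto simp: tseq_def)
  ultimately have "(h k', u) \<in> r" using lt_total[of u "h k'"] lt_refl by (auto simp: underS_def)
  then show ?thesis using k k' by (auto simp: iv_def)
qed

lemma tseq_iv_ne: "tseq t h \<Longrightarrow> iv r (h i) (h (Suc i)) \<noteq> {}"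
  using lt_refl Order_Relation.underS_Field[of r t] by (fastforce simp: tseq_def iv_def)

lemma tseq_iv_sub: "tseq t h \<Longrightarrow> iv r (h i) (h k) \<subseteq> underS r t"
  unfolding iv_def underS_def tseq_def using lt_trans lt_antisym by blast

text \<open>A small value occurs cofinally often below \<open>t\<close> iff infinitely many segments
  of the fundamental sequence contain one. So the segment minima determine the limit configuration
  and the registers that overflow.\<close>

lemma tseq_cof:
  assumes h: "tseq t h"
  shows "cof r t (\<lambda>u. c u j) b \<longleftrightarrow> (\<exists>\<^sub>\<infinity>i. seg_min r c (h i) (h (Suc i)) j \<le> b)"
  unfolding seg_min_def Inf_nat_image_le_iff[OF tseq_iv_ne[OF h]] INFM_nat_le
proof
  assume L: "cof r t (\<lambda>u. c u j) b"
  show "\<forall>m. \<exists>n\<ge>m. \<exists>x\<in>iv r (h n) (h (Suc n)). c x j \<le> b"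
  proof
    fix m
    have "h m \<in> underS r t" using h by (auto simp: tseq_def)
    then obtain u where "u \<in> underS r t" "(h m, u) \<in> r" "c u j \<le> b" using L by (auto simp: cof_def)
    then show "\<exists>n\<ge>m. \<exists>x\<in>iv r (h n) (h (Suc n)). c x j \<le> b" using tseq_locate[OF h] by blast
  qed
next
  assume R: "\<forall>m. \<exists>n\<ge>m. \<exists>x\<in>iv r (h n) (h (Suc n)). c x j \<le> b"
  show "cof r t (\<lambda>u. c u j) b"
    unfolding cof_def
  proof
    fix s assume "s \<in> underS r t"
    then obtain i where i: "(s, h i) \<in> r" using h by (auto simp: tseq_def)
    obtain n x where n: "n \<ge> i" "x \<in> iv r (h n) (h (Suc n))" "c x j \<le> b" using R by blast
    have "(h i, h n) \<in> r" using tseq_mono[OF h n(1)] .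
    then have "(s, x) \<in> r" using i n(2) lt_trans unfolding iv_def by blast
    then show "\<exists>u\<in>underS r t. (s,u) \<in> r \<and> c u j \<le> b" using n tseq_iv_sub[OF h] by blast
  qed
qed

lemma tseq_limit_value:
  assumes h: "tseq t h"
  shows "limit_value r t (\<lambda>u. c u j) = limn (\<lambda>i. seg_min r c (h i) (h (Suc i)) j)"
    and "diverges (\<lambda>i. seg_min r c (h i) (h (Suc i)) j) \<longleftrightarrow> (\<nexists>b. cof r t (\<lambda>u. c u j) b)"
  unfolding limit_value_eq limn_def diverges_def tseq_cof[OF h]
  by (simp_all only: split: if_split) blast

lemma tseq_seg_min:
  assumes h: "tseq t h"
  shows "seg_min r c (h 0) t = (\<lambda>j. Inf (range (\<lambda>i. seg_min r c (h i) (h (Suc i)) j)))"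
proof
  fix j
  have ne: "iv r (h 0) t \<noteq> {}" using tseq_iv_ne[OF h, of 0] tseq_iv_sub[OF h, of 0 1] by (auto simp: iv_def)
  have eq: "iv r (h 0) t = (\<Union>i. iv r (h i) (h (Suc i)))"
  proof (intro set_eqI iffI)
    fix u assume "u \<in> iv r (h 0) t"
    then show "u \<in> (\<Union>i. iv r (h i) (h (Suc i)))" using tseq_locate[OF h, of u 0] by (auto simp: iv_def)
  next
    fix u assume "u \<in> (\<Union>i. iv r (h i) (h (Suc i)))"
    then obtain i where i: "u \<in> iv r (h i) (h (Suc i))" by blast
    have "(h 0, u) \<in> r" using tseq_mono[OF h, of 0 i] i lt_trans by (auto simp: iv_def)
    then show "u \<in> iv r (h 0) t" using i tseq_iv_sub[OF h] by (auto simp: iv_def)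
  qed
  show "seg_min r c (h 0) t j = Inf (range (\<lambda>i. seg_min r c (h i) (h (Suc i)) j))"
    unfolding seg_min_def eq
    by (rule nat_eq_by_le)
       (auto simp: Inf_nat_image_le_iff[OF ne[unfolded eq]] Inf_nat_image_le_iff Inf_nat_image_le_iff[OF tseq_iv_ne[OF h]])
qed

lemma ex_least:
  assumes "X \<subseteq> Field r" "X \<noteq> {}"
  obtains m where "m \<in> X" "\<And>x. x \<in> X \<Longrightarrow> (m, x) \<in> r"
  using wo_rel.minim_in[OF wr assms] wo_rel.minim_least[OF wr assms(1)] by blast

lemma ex_next:
  assumes "s \<in> underS r x"
  obtains t where "is_next r s t"
proof -
  have sF: "s \<in> Field r" "x \<in> Field r" using assms by (auto simp: underS_def Field_def)
  obtain t where t: "t \<in> {u. s \<in> underS r u}" "\<And>u. u \<in> {u. s \<in> underS r u} \<Longrightarrow> (t, u) \<in> r"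
    using ex_least[of "{u. s \<in> underS r u}"] assms by (auto simp: underS_def Field_def)
  have tF: "t \<in> Field r" using t by (auto simp: underS_def Field_def)
  have "underS r t = under r s"
  proof (intro set_eqI iffI)
    fix u assume u: "u \<in> underS r t"
    then have "u \<in> Field r" by (auto simp: underS_def Field_def)
    moreover have "s \<notin> underS r u"
      using t(2)[of u] u lt_antisym by (auto simp: underS_def)
    ultimately show "u \<in> under r s" using sF lt_total[of s u] lt_refl by (auto simp: under_def underS_def)
  next
    fix u assume "u \<in> under r s"
    then show "u \<in> underS r t" using t(1) lt_trans lt_antisym unfolding under_def underS_def by blast
  qed
  then show ?thesis using that sF tF by (auto simp: is_next_def)
qed

lemma limit_above:
  assumes t: "is_limit r t" and a: "a \<in> underS r t"
  obtains b where "b \<in> underS r t" "a \<in> underS r b"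
proof -
  have aF: "a \<in> Field r" "t \<in> Field r" using a by (auto simp: underS_def Field_def)
  have "underS r t \<noteq> under r a" using t aF by (auto simp: is_limit_def is_next_def)
  moreover have "under r a \<subseteq> underS r t"
    using a lt_trans lt_antisym unfolding under_def underS_def by blast
  ultimately obtain b where b: "b \<in> underS r t" "b \<notin> under r a" by blast
  then have "b \<in> Field r" by (auto simp: underS_def Field_def)
  then have "a \<in> underS r b" using b aF lt_total[of a b] lt_refl by (auto simp: under_def underS_def)
  then show ?thesis using that b by blast
qed

text \<open>Each term is chosen strictly above its predecessor and at or above the next time in an
  enumeration of the countably many times below \<open>t\<close>.\<close>

lemma limit_tseq:
  assumes t: "is_limit r t" and s: "s \<in> underS r t" and cnt: "countable (underS r t)"
  obtains h where "tseq t h" "h 0 = s"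
proof -
  define e where "e = from_nat_into (underS r t)"
  have e: "e i \<in> underS r t" for i using s unfolding e_def by (intro from_nat_into) auto
  have step: "\<exists>b. b \<in> underS r t \<and> a \<in> underS r b \<and> (e i, b) \<in> r" if a: "a \<in> underS r t" for a i
  proof -
    have F: "a \<in> Field r" "e i \<in> Field r" using a e[of i] by (auto simp: underS_def Field_def)
    obtain b1 where b1: "b1 \<in> underS r t" "a \<in> underS r b1" using limit_above[OF t a] .
    obtain b2 where b2: "b2 \<in> underS r t" "e i \<in> underS r b2" using limit_above[OF t e[of i]] .
    have "(b1, b2) \<in> r \<or> (b2, b1) \<in> r" using b1 b2 lt_total[of b1 b2] by (auto simp: underS_def Field_def)
    then show ?thesis using b1 b2 lt_trans lt_antisym unfolding underS_def by blast
  qed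
  obtain f where f: "f 0 = s" "\<And>n. f n \<in> underS r t"
    "\<And>n. f n \<in> underS r (f (Suc n)) \<and> (e n, f (Suc n)) \<in> r"
    by (rule dependent_choice_from[of "\<lambda>_ x. x \<in> underS r t" s "\<lambda>n x y. x \<in> underS r y \<and> (e n, y) \<in> r"])
      (use s step in auto)
  have "\<exists>i. (u, f i) \<in> r" if u: "u \<in> underS r t" for u
  proof -
    obtain n where "u = e n" using from_nat_into_surj[OF cnt u] by (auto simp: e_def)
    then show ?thesis using f(3) by blast
  qed
  then have "tseq t f" unfolding tseq_def using f by blast
  then show ?thesis using that f(1) by blast
qed

end

text \<open>Configurations as vectors: coordinate 0 is the active line, coordinate \<open>k + 1\<close> is register \<open>k\<close>.\<close>

definition vcons :: "nat \<Rightarrow> (nat \<Rightarrow> nat) \<Rightarrow> vec" where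
  "vcons l R j = (case j of 0 \<Rightarrow> l | Suc k \<Rightarrow> R k)"

lemma vcons_simps [simp]: "vcons l R 0 = l" "vcons l R (Suc k) = R k" "vcons l R 1 = R 0"
  by (simp_all add: vcons_def)

definition vexec :: "nat set \<Rightarrow> instr \<Rightarrow> vec \<Rightarrow> vec" where
  "vexec A I v = (case exec A I (v 0, \<lambda>k. v (Suc k)) of (l, R) \<Rightarrow> vcons l R)"

definition mstep :: "program \<Rightarrow> nat set \<Rightarrow> vec \<Rightarrow> vec \<Rightarrow> vec \<Rightarrow> bool" where
  "mstep P A c d M \<longleftrightarrow> c 0 < length P \<and> d = vexec A (P ! c 0) c \<and> M = c"

section \<open>Segments of machine evolutions and derivations of \<open>tcl\<close>\<close>

context wtime
begin

text \<open>Unlike in \<open>itrm_run\<close>, the successor of a halted configuration is left open,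
  so that an evolution exists on every well-order and activity becomes a property of its
  segments.\<close>

definition evol :: "program \<Rightarrow> nat set \<Rightarrow> ('a \<Rightarrow> vec) \<Rightarrow> bool" where
  "evol P A c \<longleftrightarrow>
     (\<forall>s t. is_next r s t \<longrightarrow> c s 0 < length P \<longrightarrow> c t = vexec A (P ! c s 0) (c s)) \<and>
     (\<forall>t. is_limit r t \<longrightarrow> c t = (\<lambda>j. limit_value r t (\<lambda>u. c u j)))"

text \<open>The overflow condition includes the right endpoint but not the left one: a limit is
  charged to the segment that reaches it, and segments compose.\<close>

definition good :: "program \<Rightarrow> nat set \<Rightarrow> ('a \<Rightarrow> vec) \<Rightarrow> 'a \<Rightarrow> 'a \<Rightarrow> bool" where
  "good P S c s t \<longleftrightarrow> s \<in> underS r t \<and> (\<forall>u\<in>iv r s t. c u 0 < length P) \<and>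
     (\<forall>u. is_limit r u \<and> s \<in> underS r u \<and> (u, t) \<in> r \<longrightarrow> {j. \<nexists>b. cof r u (\<lambda>v. c v j) b} \<subseteq> S)"

lemma good_sub:
  assumes "good P S c s t" "(s, s') \<in> r" "s' \<in> underS r t'" "(t', t) \<in> r"
  shows "good P S c s' t'"
proof -
  have "iv r s' t' \<subseteq> iv r s t"
    using assms lt_trans lt_antisym unfolding iv_def underS_def by blast
  moreover have "s \<in> underS r u" if "s' \<in> underS r u" for u
    using that assms lt_trans lt_antisym unfolding underS_def by blast
  ultimately show ?thesis using assms lt_trans unfolding good_def by blast
qed

lemma good_trans:
  assumes "good P S c s t" "good P S c t t'"
  shows "good P S c s t'"
proof -
  have st: "s \<in> underS r t" "t \<in> underS r t'" using assms by (auto simp: good_def)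
  have "s \<in> underS r t'" using st lt_trans lt_antisym unfolding underS_def by blast
  moreover have "\<forall>u\<in>iv r s t'. c u 0 < length P"
    unfolding iv_split(1)[OF st] using assms by (auto simp: good_def)
  moreover have "(u, t) \<in> r \<or> t \<in> underS r u" if "is_limit r u" for u
    using that st lt_total[of u t] lt_refl by (auto simp: is_limit_def underS_def Field_def)
  ultimately show ?thesis using assms unfolding good_def by blast
qed

lemma next_seg:
  assumes "is_next r s t"
  shows "iv r s t = {s}" "seg_min r c s t = c s" "s \<in> underS r t"
proof -
  show 1: "iv r s t = {s}"
    using assms lt_antisym lt_refl unfolding iv_def is_next_def under_def by auto
  show "seg_min r c s t = c s" by (rule ext) (simp add: seg_min_def 1)
  show "s \<in> underS r t" using 1 by (auto simp: iv_def)
qed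

text \<open>Induction on the right endpoint. At a limit, a fundamental sequence starting in
  \<open>s\<close> cuts the segment into pieces that end before \<open>t\<close>; otherwise the last
  step is split off.\<close>

lemma good_imp_tcl:
  assumes ev: "evol P A c" and cnt: "\<And>t. countable (underS r t)"
  shows "good P S c s t \<Longrightarrow> tcl S (mstep P A) (c s) (c t) (seg_min r c s t)"
proof (induction t arbitrary: s rule: wo_rel.well_order_induct[OF wr])
  case (1 t)
  have st: "s \<in> underS r t" using 1(2) by (simp add: good_def)
  then have sF: "s \<in> Field r" "t \<in> Field r" by (auto simp: underS_def Field_def)
  have IH: "tcl S (mstep P A) (c a) (c b) (seg_min r c a b)"
    if "good P S c a b" "b \<in> underS r t" for a b
    using 1(1) that by (auto simp: underS_def)
  show ?case
  proof (cases "is_limit r t")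
    case True
    obtain h where h: "tseq t h" "h 0 = s" using limit_tseq[OF True st cnt] .
    have "good P S c (h i) (h (Suc i))" for i
      by (rule good_sub[OF 1(2)])
        (use h tseq_mono[OF h(1), of 0 i] in \<open>auto simp: tseq_def underS_def\<close>)
    then have "tcl S (mstep P A) (c (h i)) (c (h (Suc i))) (seg_min r c (h i) (h (Suc i)))" for i
      using IH h(1) by (auto simp: tseq_def)
    moreover have "{j. diverges (\<lambda>i. seg_min r c (h i) (h (Suc i)) j)} \<subseteq> S"
      unfolding tseq_limit_value(2)[OF h(1)]
      using 1(2) True st lt_refl[OF sF(2)] unfolding good_def by blast
    ultimately have "tcl S (mstep P A) (c (h 0)) (\<lambda>j. limn (\<lambda>i. seg_min r c (h i) (h (Suc i)) j))
      (\<lambda>j. Inf (range (\<lambda>i. seg_min r c (h i) (h (Suc i)) j)))" by (rule tcl.lim)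
    moreover have "c t = (\<lambda>j. limn (\<lambda>i. seg_min r c (h i) (h (Suc i)) j))"
      using ev True unfolding evol_def tseq_limit_value(1)[OF h(1), symmetric] by blast
    ultimately show ?thesis using tseq_seg_min[OF h(1), of c] h(2) by simp
  next
    case False
    then obtain a where a: "is_next r a t" using sF st by (auto simp: is_limit_def is_start_def)
    have base: "tcl S (mstep P A) (c a) (c t) (seg_min r c a t)" if "good P S c a t"
    proof (rule tcl.base)
      have "c a 0 < length P" using that next_seg[OF a] by (auto simp: good_def)
      then show "mstep P A (c a) (c t) (seg_min r c a t)"
        using ev a next_seg(2)[OF a] unfolding evol_def mstep_def by auto
    qed
    show ?thesis
    proof (cases "s = a")
      case True
      then show ?thesis using base 1(2) by simp
    next
      case False
      have at: "a \<in> underS r t" using next_seg(3)[OF a] .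
      have sa: "s \<in> underS r a" using st a False by (auto simp: is_next_def under_def underS_def)
      have "good P S c s a" "good P S c a t"
        using sa at lt_refl sF by (auto intro!: good_sub[OF 1(2)] simp: underS_def)
      then show ?thesis
        using tcl.trans[OF IH base] at seg_min_trans[OF sa at, of c] by auto
    qed
  qed
qed

text \<open>The evolution is determined from \<open>s\<close> on, so a derivation can only retrace
  it. Strict bounds of countable sets of times provide the next step and the suprema for the rule
  \<open>lim\<close>.\<close>

lemma tcl_imp_good:
  assumes ev: "evol P A c"
    and bnd: "\<And>X. X \<subseteq> Field r \<Longrightarrow> countable X \<Longrightarrow> \<exists>t. X \<subseteq> underS r t"
  shows "tcl S (mstep P A) e d M \<Longrightarrow> s \<in> Field r \<Longrightarrow> c s = e \<Longrightarrow>
    \<exists>t. good P S c s t \<and> c t = d \<and> M = seg_min r c s t"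
proof (induction arbitrary: s rule: tcl.induct)
  case (base e d M)
  obtain x where "s \<in> underS r x" using bnd[of "{s}"] base by auto
  then obtain t where t: "is_next r s t" using ex_next by blast
  have "\<not> (is_limit r u \<and> s \<in> underS r u \<and> (u, t) \<in> r)" for u
  proof
    assume u: "is_limit r u \<and> s \<in> underS r u \<and> (u, t) \<in> r"
    have "u = t"
    proof (rule ccontr)
      assume "u \<noteq> t"
      then have "(u, s) \<in> r" using u t by (auto simp: is_next_def under_def underS_def)
      then show False using u lt_antisym by (auto simp: underS_def)
    qed
    then show False using u t by (auto simp: is_limit_def)
  qed
  then have "good P S c s t" using next_seg[OF t] base by (auto simp: good_def mstep_def)
  moreover have "c t = d" using ev t base by (auto simp: evol_def mstep_def)
  ultimately show ?case using next_seg(2)[OF t, of c] base by (auto simp: mstep_def)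
next
  case (trans e d M f N)
  obtain t where t: "good P S c s t" "c t = d" "M = seg_min r c s t" using trans.IH(1) trans.prems by blast
  have "t \<in> Field r" using t by (auto simp: good_def underS_def Field_def)
  then obtain t' where t': "good P S c t t'" "c t' = f" "N = seg_min r c t t'" using trans.IH(2) t by blast
  show ?case
  proof (intro exI conjI)
    show "good P S c s t'" using good_trans t t' by blast
    show "(\<lambda>j. min (M j) (N j)) = seg_min r c s t'"
      using seg_min_trans[of s t t' c] t t' by (simp add: good_def)
  qed (fact t')
next
  case (lim g Ms)
  have nxt: "\<exists>t. (t \<in> Field r \<and> c t = g (Suc n)) \<and> good P S c x t \<and> Ms n = seg_min r c x t"
    if x: "x \<in> Field r \<and> c x = g n" for x n
  proof -
    obtain t where t: "good P S c x t" "c t = g (Suc n)" "Ms n = seg_min r c x t" using lim.IH x by blast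
    then show ?thesis by (auto simp: good_def underS_def Field_def)
  qed
  obtain h where h0: "h 0 = s" "\<And>n. h n \<in> Field r \<and> c (h n) = g n"
    "\<And>n. good P S c (h n) (h (Suc n)) \<and> Ms n = seg_min r c (h n) (h (Suc n))"
    by (rule dependent_choice_from[of "\<lambda>n x. x \<in> Field r \<and> c x = g n" s
          "\<lambda>n x y. good P S c x y \<and> Ms n = seg_min r c x y"]) (use lim.prems nxt in auto)
  have h: "\<And>n. h n \<in> Field r" "\<And>n. c (h n) = g n" "h 0 = s"
    "\<And>n. good P S c (h n) (h (Suc n))" "\<And>n. Ms n = seg_min r c (h n) (h (Suc n))" using h0 by blast+
  have "u \<in> Field r" if "range h \<subseteq> underS r u" for u
    using that[THEN subsetD, OF rangeI[of h 0]] by (auto simp: underS_def Field_def)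
  then have "{t. range h \<subseteq> underS r t} \<noteq> {}" "{t. range h \<subseteq> underS r t} \<subseteq> Field r"
    using bnd[of "range h"] h(1) by blast+
  \<comment> \<open>The supremum of the chosen times is the limit time that ends the new
    segment.\<close>
  then obtain t where t: "range h \<subseteq> underS r t" "\<And>u. range h \<subseteq> underS r u \<Longrightarrow> (t, u) \<in> r"
    using ex_least[of "{t. range h \<subseteq> underS r t}"] by (metis mem_Collect_eq)
  have tF: "t \<in> Field r" using t by (auto simp: underS_def Field_def)
  have hs: "h n \<in> underS r (h (Suc n))" for n using h(4) by (simp add: good_def)
  have "\<exists>i. (u, h i) \<in> r" if u: "u \<in> underS r t" for u
  proof (rule ccontr)
    assume n: "\<nexists>i. (u, h i) \<in> r"
    have "u \<in> Field r" using u by (auto simp: underS_def Field_def)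
    then have "range h \<subseteq> underS r u" using n lt_total[of u] h(1) unfolding underS_def by blast
    then have "(t, u) \<in> r" by (rule t(2))
    then show False using u lt_antisym by (auto simp: underS_def)
  qed
  then have ts: "tseq t h" unfolding tseq_def using t(1) hs by blast
  have tl: "is_limit r t"
    unfolding is_limit_def
  proof (intro conjI notI)
    show "t \<in> Field r" by (fact tF)
  next
    assume "is_start r t" then show False using t(1) by (auto simp: is_start_def)
  next
    assume "\<exists>a. is_next r a t"
    then obtain a where a: "is_next r a t" by blast
    then obtain i where "(a, h i) \<in> r" using ts next_seg(3)[OF a] by (auto simp: tseq_def)
    moreover have "(h (Suc i), a) \<in> r" using a t(1) by (auto simp: is_next_def under_def)
    ultimately have "(h (Suc i), h i) \<in> r" using lt_trans by blast
    then show False using hs[of i] lt_antisym by (auto simp: underS_def)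
  qed
  have "good P S c s t"
    unfolding good_def
  proof (intro conjI allI impI ballI)
    show st: "s \<in> underS r t" using t(1) h(3) by auto
  next
    fix u assume u: "u \<in> iv r s t"
    then obtain k where "u \<in> iv r (h k) (h (Suc k))" using tseq_locate[OF ts, of u 0] h(3) by (auto simp: iv_def)
    then show "c u 0 < length P" using h(4)[of k] by (auto simp: good_def)
  next
    fix u assume u: "is_limit r u \<and> s \<in> underS r u \<and> (u, t) \<in> r"
    show "{j. \<nexists>b. cof r u (\<lambda>v. c v j) b} \<subseteq> S"
    proof (cases "u = t")
      case True
      then show ?thesis using lim.hyps unfolding h(5) tseq_limit_value(2)[OF ts] by blast
    next
      case False
      then have "u \<in> underS r t" using u by (auto simp: underS_def)
      moreover have "(h 0, u) \<in> r" using u h(3) by (auto simp: underS_def)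
      ultimately obtain k where k: "u \<in> iv r (h k) (h (Suc k))" using tseq_locate[OF ts] by blast
      show ?thesis
      proof (cases "u = h k")
        case False
        then have "h k \<in> underS r u" "(u, h (Suc k)) \<in> r" using k by (auto simp: iv_def underS_def)
        then show ?thesis using h(4)[of k] u unfolding good_def by blast
      next
        \<comment> \<open>A limit at the boundary \<open>h k\<close> belongs to the segment before
          it, which exists because \<open>s\<close> itself is excluded.\<close>
        case True
        have "s \<noteq> u" using u by (simp add: underS_def)
        then have "k \<noteq> 0" by (metis True h(3))
        then obtain k' where k': "k = Suc k'" by (cases k) auto
        then have "h k' \<in> underS r u" "(u, h (Suc k')) \<in> r" using True hs lt_refl h(1) by auto
        then show ?thesis using h(4)[of k'] u unfolding good_def by blast
      qed
    qed
  qed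
  moreover have "c t = (\<lambda>j. limn (\<lambda>i. Ms i j))"
    using ev tl unfolding evol_def h(5) tseq_limit_value(1)[OF ts, symmetric] by blast
  moreover have "(\<lambda>j. Inf (range (\<lambda>i. Ms i j))) = seg_min r c s t"
    unfolding h(5) using tseq_seg_min[OF ts, of c] h(3) by simp
  ultimately show ?case by blast
qed

end

text \<open>The first uncountable cardinal. A countable set without a strict upper bound would cover
  it by countably many countable initial segments.\<close>

lemma omega1:
  includes cardinal_syntax
  obtains r :: "nat set rel" where "Well_order r" "Field r \<noteq> {}" "\<And>t. countable (underS r t)"
    "\<And>X. X \<subseteq> Field r \<Longrightarrow> countable X \<Longrightarrow> \<exists>t. X \<subseteq> underS r t"
proof -
  define r :: "nat set rel" where "r = cardSuc natLeq"
  have co: "Card_order r" unfolding r_def by (rule cardSuc_Card_order[OF natLeq_Card_order])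
  then have wo: "Well_order r" by (rule card_order_on_well_order_on)
  interpret wtime r by unfold_locales (rule wo)
  have le: "countable X" if "|X| <o r" for X :: "nat set set"
  proof -
    have "|X| \<le>o natLeq"
      using that cardSuc_ordLeq_ordLess[OF natLeq_Card_order card_of_Card_order, of X] by (simp add: r_def)
    then show ?thesis using countable_card_le_natLeq by blast
  qed
  have us: "countable (underS r t)" for t
  proof (cases "t \<in> Field r")
    case True
    then show ?thesis using card_of_underS[OF co] le by blast
  next
    case False
    then have "underS r t = {}" by (auto simp: underS_def Field_def)
    then show ?thesis by simp
  qed
  have unc: "\<not> countable (Field r)"
  proof
    assume "countable (Field r)"
    then have "|Field r| \<le>o natLeq" using countable_card_le_natLeq by blast
    then have "r \<le>o natLeq" using card_of_Field_ordIso[OF co] ordIso_ordLeq_trans ordIso_symmetric by blast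
    moreover have "natLeq <o r" unfolding r_def by (rule cardSuc_greater[OF natLeq_Card_order])
    ultimately show False using not_ordLess_ordLeq by blast
  qed
  have bnd: "\<exists>t. X \<subseteq> underS r t" if X: "X \<subseteq> Field r" "countable X" for X
  proof (rule ccontr)
    assume n: "\<nexists>t. X \<subseteq> underS r t"
    have "Field r \<subseteq> (\<Union>x\<in>X. insert x (underS r x))"
    proof
      fix t assume t: "t \<in> Field r"
      obtain x where x: "x \<in> X" "x \<notin> underS r t" using n by blast
      then have "(t, x) \<in> r" using lt_total[of t x] t X lt_refl by (auto simp: underS_def)
      then show "t \<in> (\<Union>x\<in>X. insert x (underS r x))" using x by (auto simp: underS_def)
    qed
    moreover have "countable (\<Union>x\<in>X. insert x (underS r x))" using X us by auto
    ultimately show False using unc countable_subset by blast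
  qed
  have "Field r \<noteq> {}" using unc by auto
  then show ?thesis using that[OF wo] us bnd by blast
qed

section \<open>Evolutions by transfinite recursion, and determinism\<close>

context wtime
begin

lemma limit_value_cong:
  assumes "\<And>u. u \<in> underS r t \<Longrightarrow> f u = g u"
  shows "limit_value r t f = limit_value r t g"
proof -
  have "cof r t f = cof r t g" using assms by (intro ext) (auto simp: cof_def)
  then show ?thesis unfolding limit_value_eq by (simp only:)
qed

lemma next_fun: "is_next r s t \<Longrightarrow> is_next r s' t \<Longrightarrow> s = s'"
  using lt_refl lt_antisym unfolding is_next_def under_def by blast

lemma evol_exists:
  obtains c where "evol P A c" "\<And>t. is_start r t \<Longrightarrow> c t = v"
proof -
  \<comment> \<open>A halted configuration is simply kept; \<open>evol\<close> does not constrain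
    it.\<close>
  define H where "H f t = (if is_start r t then v else if \<exists>s. is_next r s t then
       (let s = (THE s. is_next r s t) in
         if f s 0 < length P then vexec A (P ! f s 0) (f s) else f s)
     else (\<lambda>j. limit_value r t (\<lambda>u. f u j)))" for f :: "'a \<Rightarrow> vec" and t
  have the: "(THE s. is_next r s t) = s" if "is_next r s t" for s t
    using that next_fun by blast
  have "wo_rel.adm_wo r H"
    unfolding wo_rel.adm_wo_def[OF wr]
  proof (intro allI impI)
    fix f g :: "'a \<Rightarrow> vec" and t assume eq: "\<forall>y\<in>underS r t. f y = g y"
    have "f (THE s. is_next r s t) = g (THE s. is_next r s t)" if "is_next r s t" for s
      using eq next_seg(3)[OF that] the[OF that] by simp
    moreover have "limit_value r t (\<lambda>u. f u j) = limit_value r t (\<lambda>u. g u j)" for j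
      by (rule limit_value_cong) (use eq in auto)
    ultimately show "H f t = H g t" unfolding H_def Let_def by auto
  qed
  then have rec: "wo_rel.worec r H = H (wo_rel.worec r H)"
    by (rule wo_rel.worec_fixpoint[OF wr])
  define c where "c = wo_rel.worec r H"
  have c: "c t = H c t" for t unfolding c_def by (subst rec) (rule refl)
  have "evol P A c"
    unfolding evol_def
  proof (intro conjI allI impI)
    fix s t assume st: "is_next r s t" "c s 0 < length P"
    moreover have "\<not> is_start r t" using next_seg(3)[OF st(1)] by (auto simp: is_start_def)
    ultimately show "c t = vexec A (P ! c s 0) (c s)"
      using the[OF st(1)] by (subst c) (auto simp: H_def Let_def)
  next
    fix t assume "is_limit r t"
    then show "c t = (\<lambda>j. limit_value r t (\<lambda>u. c u j))"
      by (subst c) (auto simp: H_def is_limit_def)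
  qed
  moreover have "c t = v" if "is_start r t" for t using that by (subst c) (simp add: H_def)
  ultimately show ?thesis using that by blast
qed

lemma start_exists:
  assumes "Field r \<noteq> {}"
  obtains s where "is_start r s" "s \<in> Field r" "\<And>t. t \<in> Field r \<Longrightarrow> (s, t) \<in> r"
proof -
  obtain s where s: "s \<in> Field r" "\<And>t. t \<in> Field r \<Longrightarrow> (s, t) \<in> r" using ex_least[of "Field r"] assms by blast
  have "underS r s = {}" using s lt_antisym unfolding underS_def Field_def by blast
  then show ?thesis using that s by (auto simp: is_start_def)
qed

end

text \<open>A machine on an uncountable well-order with countable initial segments realises every
  derivation of \<^const>\<open>tcl\<close>, since countable cofinal sequences of times have suprema there.\<close>

definition realises :: "program \<Rightarrow> nat set \<Rightarrow> 'a rel \<Rightarrow> 'a \<Rightarrow> ('a \<Rightarrow> vec) \<Rightarrow> bool" where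
  "realises P A r s c \<longleftrightarrow> wtime r \<and> is_start r s \<and> s \<in> Field r \<and> (\<forall>t\<in>Field r. (s, t) \<in> r) \<and> wtime.evol r P A c \<and>
     (\<forall>S u t. wtime.good r P S c u t \<longrightarrow> tcl S (mstep P A) (c u) (c t) (seg_min r c u t)) \<and>
     (\<forall>S u d M. tcl S (mstep P A) (c u) d M \<longrightarrow> u \<in> Field r \<longrightarrow>
       (\<exists>t. wtime.good r P S c u t \<and> c t = d \<and> M = seg_min r c u t))"

lemma omega1_evolution:
  fixes e :: vec
  obtains r :: "nat set rel" and s c where "realises P A r s c" "c s = e"
proof -
  obtain r :: "nat set rel" where r: "Well_order r" "Field r \<noteq> {}" "\<And>t. countable (underS r t)"
    "\<And>X. X \<subseteq> Field r \<Longrightarrow> countable X \<Longrightarrow> \<exists>t. X \<subseteq> underS r t"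
    using omega1 by blast
  interpret wtime r by unfold_locales (rule r)
  obtain c where c: "evol P A c" "\<And>t. is_start r t \<Longrightarrow> c t = e" using evol_exists by blast
  obtain s where s: "is_start r s" "s \<in> Field r" "\<And>t. t \<in> Field r \<Longrightarrow> (s, t) \<in> r"
    using start_exists[OF r(2)] by blast
  have "realises P A r s c"
    unfolding realises_def
  proof (intro conjI allI impI ballI)
    show "wtime r" by (rule wtime_axioms)
    show "evol P A c" by (rule c(1))
    show "tcl S (mstep P A) (c u) (c t) (seg_min r c u t)" if "good P S c u t" for S u t
      by (rule good_imp_tcl[OF c(1) r(3) that])
    show "\<exists>t. good P S c u t \<and> c t = d \<and> M = seg_min r c u t"
      if "tcl S (mstep P A) (c u) d M" "u \<in> Field r" for S u d M
      using tcl_imp_good[OF c(1) r(4) that(1,2) refl] by blast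
  qed (use s in auto)
  then show ?thesis using that c(2) s(1) by blast
qed

text \<open>Both derivations are segments of one evolution. The earlier halting time would lie
  inside the other segment, where every line is active.\<close>

lemma halting_unique:
  assumes "tcl UNIV (mstep P A) e d M" "tcl UNIV (mstep P A) e d' M'" "length P \<le> d 0" "length P \<le> d' 0"
  shows "d = d'"
proof -
  obtain r :: "nat set rel" and s c where rc: "realises P A r s c" and cs: "c s = e"
    using omega1_evolution by blast
  note * = rc[unfolded realises_def]
  interpret wtime r using * by blast
  obtain t t' where t: "good P UNIV c s t" "c t = d" "good P UNIV c s t'" "c t' = d'"
    using * cs assms(1,2) by meson
  have "False" if "good P UNIV c s t" "good P UNIV c s t'" "t \<noteq> t'" "length P \<le> c t 0" "(t, t') \<in> r" for t t'
  proof -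
    have "t \<in> iv r s t'" using that by (auto simp: good_def iv_def underS_def)
    then show False using that by (auto simp: good_def)
  qed
  moreover have "(t, t') \<in> r \<or> (t', t) \<in> r"
    using t lt_total[of t t'] by (auto simp: good_def underS_def Field_def)
  ultimately show ?thesis using t assms by metis
qed

primrec chain :: "(vec \<Rightarrow> vec \<Rightarrow> bool) \<Rightarrow> nat \<Rightarrow> vec \<Rightarrow> bool" where
  "chain Q 0 e \<longleftrightarrow> True"
| "chain Q (Suc k) e \<longleftrightarrow> (\<exists>e'. Q e e' \<and> chain Q k e')"

text \<open>The shortest segment with minimum \<open>d\<close> can start every longer chain; this is where
  determinism enters.\<close>

lemma chain_step:
  fixes P A S d
  defines "Q \<equiv> \<lambda>e e'. tcl S (mstep P A) e e' d"
  assumes ch: "\<And>k. chain Q k e"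
  shows "\<exists>e'. Q e e' \<and> (\<forall>k. chain Q k e')"
proof -
  obtain r :: "nat set rel" and s c where rc: "realises P A r s c" and cs: "c s = e"
    using omega1_evolution by blast
  note * = rc[unfolded realises_def]
  interpret wtime r using * by blast
  define Z where "Z = {t. good P S c s t \<and> seg_min r c s t = d}"
  have real: "\<exists>t. good P S c u t \<and> c t = e' \<and> d = seg_min r c u t" if "Q (c u) e'" "u \<in> Field r" for u e'
    using * that unfolding Q_def by blast
  have tcl: "Q (c u) (c t)" if "good P S c u t" "seg_min r c u t = d" for u t using * that unfolding Q_def by blast
  have sF: "s \<in> Field r" using * by blast
  have "Z \<noteq> {}" using ch[of 1] real[of s] sF cs by (auto simp: Z_def)
  moreover have "Z \<subseteq> Field r" by (auto simp: Z_def good_def underS_def Field_def)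
  ultimately obtain t where t: "t \<in> Z" "\<And>u. u \<in> Z \<Longrightarrow> (t, u) \<in> r" using ex_least by blast
  have st: "s \<in> underS r t" using t by (auto simp: Z_def good_def)
  have "chain Q k (c t)" for k
  proof (cases k)
    case (Suc k')
    \<comment> \<open>Take a chain with one link more than \<open>k\<close>. The part of its first
      two links from \<open>t\<close> on turns out to be a single link with the same
      minimum.\<close>
    obtain e1 e2 where e: "Q e e1" "Q e1 e2" "chain Q k' e2" using ch[of "Suc (Suc k')"] by auto
    obtain t1 where t1: "good P S c s t1" "c t1 = e1" "d = seg_min r c s t1"
      using real[of s e1] sF cs e by blast
    have t1F: "t1 \<in> Field r" using t1 by (auto simp: good_def underS_def Field_def)
    obtain t2 where t2: "good P S c t1 t2" "c t2 = e2" "d = seg_min r c t1 t2"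
      using real[of t1 e2] t1 t1F e by blast
    have tt1: "(t, t1) \<in> r" using t t1 by (auto simp: Z_def)
    have t12: "t1 \<in> underS r t2" using t2 by (simp add: good_def)
    then have tt2: "t \<in> underS r t2" using tt1 lt_trans lt_antisym unfolding underS_def by blast
    have "good P S c t t2"
      by (rule good_sub[OF good_trans[OF t1(1) t2(1)]])
        (use st tt2 lt_refl t2 in \<open>auto simp: underS_def Field_def\<close>)
    moreover have "seg_min r c t t2 = d"
    proof (cases "t = t1")
      case True
      then show ?thesis using t2 by simp
    next
      case False
      then have "t \<in> underS r t1" using tt1 by (auto simp: underS_def)
      \<comment> \<open>The segment from \<open>s\<close> to \<open>t1\<close> has minimum
        \<open>d\<close>, so its part from \<open>t\<close> on is bounded below by \<open>d\<close>,
        and the second link attains \<open>d\<close>.\<close>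
      then have a: "seg_min r c t t2 = (\<lambda>j. min (seg_min r c t t1 j) (d j))" and b: "d = (\<lambda>j. min (d j) (seg_min r c t t1 j))"
        using seg_min_trans[of t t1 t2 c] seg_min_trans[of s t t1 c] t12 t2 st t t1 by (auto simp: Z_def)
      have "d j \<le> seg_min r c t t1 j" for j using fun_cong[OF b, of j] by linarith
      then show ?thesis unfolding a by (intro ext min.absorb2)
    qed
    ultimately have "Q (c t) e2" using tcl t2(2) by blast
    then show ?thesis using e Suc by auto
  qed auto
  moreover have "Q e (c t)" using tcl[of s t] cs t by (auto simp: Z_def)
  ultimately show ?thesis by blast
qed

text \<open>Compactness by determinism: finite chains of all lengths yield an infinite one. A limit
  without overflow thereby gets premises about finite chains only.\<close>

lemma chain_limit:
  assumes ch: "\<And>k. chain (\<lambda>e e'. tcl S (mstep P A) e e' d) k e"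
  obtains g where "g 0 = e" "\<And>i. tcl S (mstep P A) (g i) (g (Suc i)) d"
proof -
  let ?Q = "\<lambda>e e'. tcl S (mstep P A) e e' d"
  have "\<exists>y. (\<forall>k. chain ?Q k y) \<and> ?Q x y" if "\<forall>k. chain ?Q k x" for x
    using chain_step[of S P A d x] that by blast
  then show ?thesis
    by (rule dependent_choice_from[of "\<lambda>_ e. \<forall>k. chain ?Q k e" e "\<lambda>_. ?Q", rotated]) (use ch that in auto)
qed

section \<open>Halting computations as derivations of \<open>tcl\<close>\<close>

lemma vexec_case: "vexec A I (vcons l R) = (case exec A I (l, R) of (l, R) \<Rightarrow> vcons l R)"
  by (simp add: vexec_def)

lemma itrm_outputs_imp_tcl:
  assumes "itrm_outputs P A R\<^sub>0 n" "P \<noteq> []"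
  shows "\<exists>d M. tcl UNIV (mstep P A) (vcons 0 R\<^sub>0) d M \<and> length P \<le> d 0 \<and> d 1 = n"
proof -
  obtain r :: "nat rel" and c t where run: "itrm_run r P A R\<^sub>0 c" and t: "t \<in> Field r" "under r t = Field r"
    "length P \<le> fst (c t)" "snd (c t) 0 = n"
    using assms(1) unfolding itrm_outputs_def itrm_halting_run_def by blast
  interpret wtime r using run by unfold_locales (simp add: itrm_run_def)
  define c' where "c' u = vcons (fst (c u)) (snd (c u))" for u
  obtain s where s: "is_start r s" "s \<in> Field r" "\<And>t. t \<in> Field r \<Longrightarrow> (s, t) \<in> r"
    using start_exists t by blast
  have ev: "evol P A c'"
    unfolding evol_def
  proof (intro conjI allI impI)
    fix s t assume "is_next r s t"
    then have "c t = exec A (P ! fst (c s)) (c s)" using run by (auto simp: itrm_run_def)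
    then show "c' t = vexec A (P ! c' s 0) (c' s)"
      by (simp add: c'_def vexec_case case_prod_beta)
  next
    fix t assume "is_limit r t"
    then have "c t = (limit_value r t (\<lambda>u. fst (c u)), \<lambda>k. limit_value r t (\<lambda>u. snd (c u) k))"
      using run by (auto simp: itrm_run_def)
    then show "c' t = (\<lambda>j. limit_value r t (\<lambda>u. c' u j))"
      by (intro ext) (simp add: c'_def vcons_def split: nat.split)
  qed
  have cs: "c s = (0, R\<^sub>0)" using run s by (simp add: itrm_run_def)
  then have "s \<noteq> t" using t assms(2) by auto
  then have st: "s \<in> underS r t" using s t by (auto simp: underS_def)
  have "c' u 0 < length P" if u: "u \<in> iv r s t" for u
  proof -
    have "u \<in> underS r t" using u by (auto simp: iv_def)
    then obtain v where "is_next r u v" using ex_next by blast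
    then show ?thesis using run by (auto simp: itrm_run_def c'_def)
  qed
  then have "good P UNIV c' s t" using st by (auto simp: good_def)
  then have "tcl UNIV (mstep P A) (c' s) (c' t) (seg_min r c' s t)"
    by (rule good_imp_tcl[OF ev, rotated]) simp
  then show ?thesis using t cs by (intro exI[of _ "c' t"] exI) (auto simp: c'_def)
qed

text \<open>The evolution on the uncountable well-order is cut off at the halting time
  \<open>t\<close>, which changes no start, successor or limit up to \<open>t\<close>;
  \<open>itrm_halting_run_imp_outputs\<close> then passes to times in \<open>nat\<close>.\<close>

lemma tcl_imp_itrm_outputs:
  assumes "tcl UNIV (mstep P A) (vcons 0 R\<^sub>0) d M" "length P \<le> d 0"
  shows "itrm_outputs P A R\<^sub>0 (d 1)"
proof -
  obtain r :: "nat set rel" and s c where rc: "realises P A r s c" and cs: "c s = vcons 0 R\<^sub>0"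
    using omega1_evolution by blast
  note * = rc[unfolded realises_def]
  interpret wtime r using * by blast
  have s: "is_start r s" "\<And>t. t \<in> Field r \<Longrightarrow> (s, t) \<in> r" and ev: "evol P A c" using * by blast+
  obtain t where t: "good P UNIV c s t" "c t = d" using * cs assms(1) by metis
  let ?H = "under r t"
  let ?r = "Restr r ?H"
  define c' where "c' u = (c u 0, \<lambda>k. c u (Suc k))" for u
  have tF: "t \<in> Field r" using t by (auto simp: good_def underS_def Field_def)
  have HF: "?H \<subseteq> Field r" by (auto simp: under_def Field_def)
  have F: "Field ?r = ?H" using REFL HF by (rule Refl_Field_Restr2)
  have un: "under ?r a = under r a" if "a \<in> ?H" for a
    using that lt_trans unfolding under_def by blast
  have unS: "underS ?r a = underS r a" if "a \<in> ?H" for a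
    using that lt_trans unfolding under_def underS_def by blast
  have st: "is_start r u" if "is_start ?r u" for u
    using that unS HF unfolding is_start_def F by auto
  have nx: "is_next ?r u v \<longleftrightarrow> is_next r u v" if "v \<in> ?H" for u v
  proof
    assume "is_next ?r u v" then show "is_next r u v" using un unS HF that unfolding is_next_def F by auto
  next
    assume n: "is_next r u v"
    then have "u \<in> underS r v" by (rule next_seg(3))
    then have "u \<in> ?H" using that lt_trans unfolding under_def underS_def by blast
    then show "is_next ?r u v" using n un unS that unfolding is_next_def F by auto
  qed
  have lm: "is_limit r u" if "is_limit ?r u" for u
    using that unS HF nx unfolding is_limit_def is_start_def F by auto
  have lv: "limit_value ?r u f = limit_value r u f" if "u \<in> ?H" for u f
  proof -
    have "underS r u \<subseteq> ?H" using that lt_trans unfolding under_def underS_def by blast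
    then have "cof ?r u f = cof r u f"
      unfolding cof_def unS[OF that] by (intro ext ball_cong refl bex_cong) auto
    then show ?thesis unfolding limit_value_eq by (simp only:)
  qed
  have "itrm_run ?r P A R\<^sub>0 c'"
    unfolding itrm_run_def
  proof (intro conjI allI impI)
    show "Well_order ?r" using WELL by (rule Well_order_Restr)
  next
    fix u assume "is_start ?r u"
    then have u: "is_start r u" by (rule st)
    then have "u = s" using s lt_antisym unfolding is_start_def underS_def by blast
    then show "c' u = (0, R\<^sub>0)" using cs by (simp add: c'_def)
  next
    fix u v assume a: "is_next ?r u v"
    then have v: "v \<in> ?H" using F by (simp add: is_next_def)
    then have uv: "is_next r u v" using a nx by simp
    have "u \<in> underS r v" using uv by (rule next_seg(3))
    then have "u \<in> underS r t" using v lt_trans lt_antisym unfolding under_def underS_def by blast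
    then have "u \<in> iv r s t" using s(2)[of u] by (auto simp: iv_def underS_def Field_def)
    then have l: "c u 0 < length P" using t by (auto simp: good_def)
    then show "fst (c' u) < length P" by (simp add: c'_def)
    have "c v = vexec A (P ! c u 0) (c u)" using ev uv l by (auto simp: evol_def)
    then show "c' v = exec A (P ! fst (c' u)) (c' u)"
      by (simp add: c'_def vexec_def case_prod_beta)
  next
    fix u assume u: "is_limit ?r u"
    then have uH: "u \<in> ?H" using F by (simp add: is_limit_def)
    show "c' u = (limit_value ?r u (\<lambda>u. fst (c' u)), \<lambda>k. limit_value ?r u (\<lambda>u. snd (c' u) k))"
      using ev lm[OF u] unfolding evol_def lv[OF uH] c'_def by simp
  qed
  moreover have "t \<in> ?H" using tF lt_refl by (simp add: under_def)
  ultimately have "itrm_halting_run ?r P A R\<^sub>0 (d 1)"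
    unfolding itrm_halting_run_def using assms(2) t un F by (intro exI[of _ c'] exI[of _ t]) (auto simp: c'_def)
  then show ?thesis by (rule itrm_halting_run_imp_outputs)
qed

lemma itrm_outputs_iff_tcl:
  assumes "P \<noteq> []"
  shows "itrm_outputs P A R\<^sub>0 n \<longleftrightarrow>
    (\<exists>d M. tcl UNIV (mstep P A) (vcons 0 R\<^sub>0) d M \<and> length P \<le> d 0 \<and> d 1 = n)"
  using itrm_outputs_imp_tcl[OF _ assms, of A R\<^sub>0 n] tcl_imp_itrm_outputs[of P A R\<^sub>0] by auto

section \<open>Structured programs\<close>

datatype com =
    CZero nat | CSucc nat | COracle nat | CTrans nat nat
  | CSeq com com (infixr ";;" 60)
  | CIf nat nat com com
  | CWhile nat nat com

abbreviation vmin :: "vec \<Rightarrow> vec \<Rightarrow> vec" where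
  "vmin M N \<equiv> (\<lambda>j. min (M j) (N j))"

lemma tcl_mono_rel: "(\<And>c d M. B c d M \<Longrightarrow> B' c d M) \<Longrightarrow> tcl S B c d M \<Longrightarrow> tcl S B' c d M"
proof (erule tcl.induct, goal_cases)
  case 1 then show ?case by (blast intro: tcl.base)
next
  case 2 then show ?case by (blast intro: tcl.trans)
next
  case (3 g Ms) then show ?case by (intro tcl.lim) auto
qed

text \<open>Registered so that \<open>big\<close> may occur under \<open>tcl\<close> in the premise
  of its own loop rule.\<close>

lemma tcl_mono [mono]:
  "(\<And>c d M. B c d M \<longrightarrow> B' c d M) \<Longrightarrow> tcl S B c d M \<longrightarrow> tcl S B' c d M"
  using tcl_mono_rel by blast

text \<open>A loop may be iterated transfinitely: its head is the least line visited cofinally often, so the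
  machine is at the head again at limits of iterations.\<close>

inductive big :: "nat set \<Rightarrow> com \<Rightarrow> vec \<Rightarrow> vec \<Rightarrow> vec \<Rightarrow> bool" for A where
  Zero: "big A (CZero n) R (R(n := 0)) R"
| Succ: "big A (CSucc n) R (R(n := Suc (R n))) R"
| Oracle: "big A (COracle n) R (R(n := (if R n \<in> A then 1 else 0))) R"
| Trans: "big A (CTrans m n) R (R(n := R m)) R"
| Seq: "big A a R R1 M1 \<Longrightarrow> big A b R1 R2 M2 \<Longrightarrow> big A (a ;; b) R R2 (vmin M1 M2)"
| IfT: "R m = R n \<Longrightarrow> big A a R R' M \<Longrightarrow> big A (CIf m n a b) R R' (vmin R M)"
| IfF: "R m \<noteq> R n \<Longrightarrow> big A b R R' M \<Longrightarrow> big A (CIf m n a b) R R' (vmin (vmin R M) R')"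
| WhileF: "R m = R n \<Longrightarrow> big A (CWhile m n c) R R R"
| WhileT: "tcl UNIV (\<lambda>R R' M. R m \<noteq> R n \<and> (\<exists>M0. big A c R R' M0 \<and> M = vmin (vmin R M0) R')) R R' M \<Longrightarrow>
    R' m = R' n \<Longrightarrow> big A (CWhile m n c) R R' (vmin M R')"

fun clen :: "com \<Rightarrow> nat" where
  "clen (a ;; b) = clen a + clen b"
| "clen (CIf m n a b) = clen a + clen b + 2"
| "clen (CWhile m n c) = clen c + 2"
| "clen _ = 1"

text \<open>Jump targets are absolute, hence the start address \<open>k\<close>.
  \<open>Jump 0 0 q\<close> is unconditional, and the branch for unequal registers comes
  first.\<close>

fun compile :: "nat \<Rightarrow> com \<Rightarrow> program" where
  "compile k (CZero n) = [Zero n]"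
| "compile k (CSucc n) = [Succ n]"
| "compile k (COracle n) = [Oracle n]"
| "compile k (CTrans m n) = [Transfer m n]"
| "compile k (a ;; b) = compile k a @ compile (k + clen a) b"
| "compile k (CIf m n a b) = Jump m n (k + 2 + clen b) # compile (k + 1) b
     @ Jump 0 0 (k + 2 + clen b + clen a) # compile (k + 2 + clen b) a"
| "compile k (CWhile m n c) = Jump m n (k + 2 + clen c) # compile (k + 1) c @ [Jump 0 0 k]"

lemma length_compile [simp]: "length (compile k c) = clen c"
  by (induction c arbitrary: k) auto

definition placed :: "program \<Rightarrow> nat \<Rightarrow> program \<Rightarrow> bool" where
  "placed P k xs \<longleftrightarrow> (\<exists>pre post. P = pre @ xs @ post \<and> length pre = k)"

lemma placed_append: "placed P k (xs @ ys) \<Longrightarrow> placed P k xs \<and> placed P (k + length xs) ys"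
  unfolding placed_def
proof (elim exE conjE)
  fix pre post assume P: "P = pre @ (xs @ ys) @ post" and k: "length pre = k"
  have "P = pre @ xs @ (ys @ post)" "P = (pre @ xs) @ ys @ post" "length (pre @ xs) = k + length xs"
    using P k by auto
  then show "(\<exists>pre post. P = pre @ xs @ post \<and> length pre = k) \<and>
    (\<exists>pre post. P = pre @ ys @ post \<and> length pre = k + length xs)" using k by blast
qed

lemma placed_Cons: "placed P k (I # ys) \<Longrightarrow> k < length P \<and> P ! k = I \<and> placed P (Suc k) ys"
proof -
  assume a: "placed P k (I # ys)"
  then obtain pre post where "P = pre @ I # ys @ post" "length pre = k" unfolding placed_def by auto
  then have "k < length P" "P ! k = I" by (auto simp: nth_append)
  then show ?thesis using placed_append[of P k "[I]" ys] a by simp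
qed

lemma limn_const [simp]: "limn (\<lambda>i. k) = k" "\<not> diverges (\<lambda>i. k)"
proof -
  have "(\<exists>\<^sub>\<infinity>i::nat. k \<le> b) \<longleftrightarrow> k \<le> b" for b by (auto simp: INFM_nat_le)
  then show "limn (\<lambda>i. k) = k" "\<not> diverges (\<lambda>i. k)"
    unfolding limn_def diverges_def by (auto intro: Least_equality)
qed

lemma mstep_jumpT:
  assumes "k < length P \<and> P ! k = Jump m n q" "R m = R n"
  shows "tcl S (mstep P A) (vcons k R) (vcons q R) (vcons k R)"
  by (rule tcl.base) (use assms in \<open>auto simp: mstep_def vexec_case\<close>)

lemma mstep_jumpF:
  assumes "k < length P \<and> P ! k = Jump m n q" "R m \<noteq> R n"
  shows "tcl S (mstep P A) (vcons k R) (vcons (Suc k) R) (vcons k R)"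
  by (rule tcl.base) (use assms in \<open>auto simp: mstep_def vexec_case\<close>)

lemma vcons_min: "(\<lambda>j. min (vcons a M j) (vcons b N j)) = vcons (min a b) (vmin M N)"
  by (rule ext) (simp add: vcons_def split: nat.split)

lemma big_imp_tcl:
  "big A c R R' M \<Longrightarrow> placed P k (compile k c) \<Longrightarrow>
    tcl UNIV (mstep P A) (vcons k R) (vcons (k + clen c) R') (vcons k M)"
proof (induction arbitrary: k rule: big.induct)
  case (Seq a R R1 M1 b R2 M2)
  have "placed P k (compile k a)" "placed P (k + clen a) (compile (k + clen a) b)"
    using Seq.prems placed_append by fastforce+
  then have "tcl UNIV (mstep P A) (vcons k R) (vcons (k + clen a) R1) (vcons k M1)"
    "tcl UNIV (mstep P A) (vcons (k + clen a) R1) (vcons (k + clen a + clen b) R2) (vcons (k + clen a) M2)"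
    using Seq.IH by blast+
  from tcl.trans[OF this] show ?case by (simp add: vcons_min add.assoc)
next
  case (IfT R m n a R' M b)
  have j: "k < length P \<and> P ! k = Jump m n (k + 2 + clen b)"
    using placed_Cons[OF IfT.prems[unfolded compile.simps]] by simp
  have a: "placed P (k + 2 + clen b) (compile (k + 2 + clen b) a)"
    using placed_append[of P k "Jump m n (k + 2 + clen b) # compile (k + 1) b @ [Jump 0 0 (k + 2 + clen b + clen a)]"
        "compile (k + 2 + clen b) a"] IfT.prems by simp
  from tcl.trans[OF mstep_jumpT[OF j IfT.hyps(1)] IfT.IH[OF a]]
  show ?case by (simp add: vcons_min add_ac)
next
  case (IfF R m n b R' M a)
  let ?e = "k + 2 + clen b + clen a"
  have j: "k < length P \<and> P ! k = Jump m n (k + 2 + clen b)"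
    and 0: "placed P (Suc k) (compile (Suc k) b @ Jump 0 0 ?e # compile (k + 2 + clen b) a)"
    using placed_Cons[OF IfF.prems[simplified]] by simp_all
  have b: "placed P (Suc k) (compile (Suc k) b)" and
    j2: "k + 1 + clen b < length P \<and> P ! (k + 1 + clen b) = Jump 0 0 ?e"
    using placed_append[OF 0] placed_Cons[OF conjunct2[OF placed_append[OF 0]]] by simp_all
  have 1: "tcl UNIV (mstep P A) (vcons k R) (vcons (Suc k + clen b) R') (vcons k (vmin R M))"
    using tcl.trans[OF mstep_jumpF[OF j IfF.hyps(1)] IfF.IH[OF b]] by (simp add: vcons_min)
  have 2: "tcl UNIV (mstep P A) (vcons (Suc k + clen b) R') (vcons ?e R') (vcons (Suc k + clen b) R')"
    using mstep_jumpT[OF j2, of R'] by simp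
  from tcl.trans[OF 1 2] show ?case by (simp add: vcons_min add_ac)
next
  case (WhileF R m n c)
  have j: "k < length P \<and> P ! k = Jump m n (k + 2 + clen c)"
    using placed_Cons[OF WhileF.prems[simplified]] by simp
  then show ?case using mstep_jumpT[OF j WhileF.hyps] by (simp add: add_ac)
next
  case (WhileT m n c R R' M)
  have j: "k < length P \<and> P ! k = Jump m n (k + 2 + clen c)"
    and 0: "placed P (Suc k) (compile (Suc k) c @ [Jump 0 0 k])"
    using placed_Cons[OF WhileT.prems[simplified]] by simp_all
  have c: "placed P (Suc k) (compile (Suc k) c)" and
    j2: "k + 1 + clen c < length P \<and> P ! (k + 1 + clen c) = Jump 0 0 k"
    using placed_append[OF 0] placed_Cons[OF conjunct2[OF placed_append[OF 0]]] by simp_all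
  from WhileT.IH have "tcl UNIV (mstep P A) (vcons k R) (vcons k R') (vcons k M)"
  proof (induction rule: tcl.induct)
    case (base R R' M)
    then obtain M0 where M0: "R m \<noteq> R n" "M = vmin (vmin R M0) R'"
      "tcl UNIV (mstep P A) (vcons (Suc k) R) (vcons (Suc k + clen c) R') (vcons (Suc k) M0)"
      using c by blast
    have 1: "tcl UNIV (mstep P A) (vcons k R) (vcons (Suc k + clen c) R') (vcons k (vmin R M0))"
      using tcl.trans[OF mstep_jumpF[OF j M0(1)] M0(3)] by (simp add: vcons_min)
    have 2: "tcl UNIV (mstep P A) (vcons (Suc k + clen c) R') (vcons k R') (vcons (Suc k + clen c) R')"
      using mstep_jumpT[OF j2, of R'] by simp
    from tcl.trans[OF 1 2] show ?case by (simp add: vcons_min M0)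
  next
    case (trans c d M e N)
    from tcl.trans[OF trans.IH] show ?case by (simp add: vcons_min)
  next
    \<comment> \<open>Every iteration has the head \<open>k\<close> as its least line, so the limit
      inferior of the lines is \<open>k\<close>.\<close>
    case (lim g Ms)
    have "(\<lambda>j. limn (\<lambda>i. vcons k (Ms i) j)) = vcons k (\<lambda>j. limn (\<lambda>i. Ms i j))"
      "(\<lambda>j. Inf (range (\<lambda>i. vcons k (Ms i) j))) = vcons k (\<lambda>j. Inf (range (\<lambda>i. Ms i j)))"
      by (auto simp: vcons_def split: nat.split)
    with tcl.lim[where g = "\<lambda>i. vcons k (g i)" and Ms = "\<lambda>i. vcons k (Ms i)", OF lim.IH] show ?case by simp
  qed
  from tcl.trans[OF this mstep_jumpT[OF j WhileT.hyps]]
  show ?case by (simp add: vcons_min add_ac)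
next
  case (Zero n R)
  have "k < length P \<and> P ! k = instr.Zero n" using placed_Cons[of P k "instr.Zero n" "[]"] Zero.prems by simp
  then show ?case by (intro tcl.base) (simp add: mstep_def vexec_case fun_upd_def)
next
  case (Succ n R)
  have "k < length P \<and> P ! k = instr.Succ n" using placed_Cons[of P k "instr.Succ n" "[]"] Succ.prems by simp
  then show ?case by (intro tcl.base) (simp add: mstep_def vexec_case fun_upd_def)
next
  case (Oracle n R)
  have "k < length P \<and> P ! k = instr.Oracle n" using placed_Cons[of P k "instr.Oracle n" "[]"] Oracle.prems by simp
  then show ?case by (intro tcl.base) (simp add: mstep_def vexec_case fun_upd_def)
next
  case (Trans m n R)
  have "k < length P \<and> P ! k = instr.Transfer m n" using placed_Cons[of P k "instr.Transfer m n" "[]"] Trans.prems by simp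
  then show ?case by (intro tcl.base) (simp add: mstep_def vexec_case fun_upd_def)
qed

lemma big_imp_itrm_outputs:
  assumes "big A c R R' M"
  shows "itrm_outputs (compile 0 c) A R (R' 0)"
proof -
  have "placed (compile 0 c) 0 (compile 0 c)" by (auto simp: placed_def)
  from tcl_imp_itrm_outputs[OF big_imp_tcl[OF assms this]] show ?thesis by simp
qed

section \<open>Relocating the registers of a subroutine\<close>

fun shift :: "nat \<Rightarrow> com \<Rightarrow> com" where
  "shift k (CZero n) = CZero (n + k)"
| "shift k (CSucc n) = CSucc (n + k)"
| "shift k (COracle n) = COracle (n + k)"
| "shift k (CTrans m n) = CTrans (m + k) (n + k)"
| "shift k (a ;; b) = shift k a ;; shift k b"
| "shift k (CIf m n a b) = CIf (m + k) (n + k) (shift k a) (shift k b)"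
| "shift k (CWhile m n c) = CWhile (m + k) (n + k) (shift k c)"

definition vmerge :: "nat \<Rightarrow> vec \<Rightarrow> vec \<Rightarrow> vec" where
  "vmerge k S R = (\<lambda>i. if i < k then S i else R (i - k))"

lemma vmerge_upd: "vmerge k S (R(n := v)) = (vmerge k S R)(n + k := v)"
  by (rule ext) (auto simp: vmerge_def)

lemma vmerge_at [simp]: "vmerge k S R (n + k) = R n" by (simp add: vmerge_def)

lemma vmerge_min: "vmin (vmerge k S M) (vmerge k S N) = vmerge k S (vmin M N)"
  by (rule ext) (simp add: vmerge_def)

text \<open>Registers below \<open>k\<close> are not addressed, so they are constant and survive
  limits; they can hold the data of a caller.\<close>

lemma big_shift: "big A c R R' M \<Longrightarrow> big A (shift k c) (vmerge k S R) (vmerge k S R') (vmerge k S M)"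
proof (induction rule: big.induct)
  case (Oracle n R)
  show ?case using big.Oracle[of A "n + k" "vmerge k S R"] unfolding vmerge_upd by (simp only: shift.simps vmerge_at)
next
  case (Trans m n R)
  show ?case using big.Trans[of A "m + k" "n + k" "vmerge k S R"] unfolding vmerge_upd by (simp only: shift.simps vmerge_at)
next
  case (Zero n R)
  show ?case using big.Zero[of A "n + k" "vmerge k S R"] unfolding vmerge_upd by (simp only: shift.simps vmerge_at)
next
  case (Succ n R)
  show ?case using big.Succ[of A "n + k" "vmerge k S R"] unfolding vmerge_upd by (simp only: shift.simps vmerge_at)
next
  case (Seq a R R1 M1 b R2 M2)
  then show ?case using big.Seq by (simp add: vmerge_min[symmetric])
next
  case (IfT R m n a R' M b)
  then show ?case using big.IfT[of "vmerge k S R" "m + k" "n + k"] by (simp add: vmerge_min[symmetric])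
next
  case (IfF R m n b R' M a)
  then show ?case using big.IfF[of "vmerge k S R" "m + k" "n + k"] by (simp add: vmerge_min[symmetric])
next
  case (WhileF R m n c)
  then show ?case using big.WhileF[of "vmerge k S R" "m + k" "n + k"] by simp
next
  case (WhileT m n c R R' M)
  let ?B = "\<lambda>R R' M. R (m + k) \<noteq> R (n + k) \<and> (\<exists>M0. big A (shift k c) R R' M0 \<and> M = vmin (vmin R M0) R')"
  from WhileT.IH have "tcl UNIV ?B (vmerge k S R) (vmerge k S R') (vmerge k S M)"
  proof (induction rule: tcl.induct)
    case (base R R' M)
    then obtain M0 where "R m \<noteq> R n" "big A (shift k c) (vmerge k S R) (vmerge k S R') (vmerge k S M0)"
      "M = vmin (vmin R M0) R'" by blast
    then show ?case by (intro tcl.base) (auto simp: vmerge_min[symmetric] intro!: exI[of _ "vmerge k S M0"])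
  next
    case (trans c d M e N)
    from tcl.trans[OF trans.IH] show ?case by (simp add: vmerge_min)
  next
    case (lim g Ms)
    have "(\<lambda>j. limn (\<lambda>i. vmerge k S (Ms i) j)) = vmerge k S (\<lambda>j. limn (\<lambda>i. Ms i j))"
      "(\<lambda>j. Inf (range (\<lambda>i. vmerge k S (Ms i) j))) = vmerge k S (\<lambda>j. Inf (range (\<lambda>i. Ms i j)))"
      by (auto simp: vmerge_def)
    with tcl.lim[where g = "\<lambda>i. vmerge k S (g i)" and Ms = "\<lambda>i. vmerge k S (Ms i)", OF lim.IH] show ?case by simp
  qed
  from big.WhileT[OF this] WhileT.hyps show ?case by (simp add: vmerge_min)
qed

lemma big_shift':
  assumes "big A c (\<lambda>i. R (i + k)) R' M"
  shows "big A (shift k c) R (vmerge k R R') (vmerge k R M)"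
proof -
  have "vmerge k R (\<lambda>i. R (i + k)) = R" by (rule ext) (simp add: vmerge_def)
  then show ?thesis using big_shift[OF assms, of k R] by simp
qed

section \<open>Relations closed under accessible parts\<close>

definition pr :: "nat \<Rightarrow> nat \<Rightarrow> nat" where "pr a b = prod_encode (a, b)"
definition p1 :: "nat \<Rightarrow> nat" where "p1 w = fst (prod_decode w)"
definition p2 :: "nat \<Rightarrow> nat" where "p2 w = snd (prod_decode w)"

lemma pr_simps [simp]: "p1 (pr a b) = a" "p2 (pr a b) = b" "pr (p1 w) (p2 w) = w"
  by (simp_all add: pr_def p1_def p2_def)

lemma pr_inject [simp]: "pr a b = pr c d \<longleftrightarrow> a = c \<and> b = d"
  by (metis pr_simps(1,2))

abbreviation "acc_part \<equiv> Wellfounded.accp"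

text \<open>The single argument \<open>w\<close> of a relation codes the tuple of the values of its variables.\<close>

inductive fn :: "(nat \<Rightarrow> nat) \<Rightarrow> bool" where
  fn_id: "fn (\<lambda>w. w)"
| fn_zero: "fn (\<lambda>w. 0)"
| fn_Suc: "fn t \<Longrightarrow> fn (\<lambda>w. Suc (t w))"
| fn_pred: "fn t \<Longrightarrow> fn (\<lambda>w. t w - 1)"
| fn_dbl: "fn t \<Longrightarrow> fn (\<lambda>w. 2 * t w)"
| fn_p1: "fn t \<Longrightarrow> fn (\<lambda>w. p1 (t w))"
| fn_p2: "fn t \<Longrightarrow> fn (\<lambda>w. p2 (t w))"
| fn_pr: "fn t \<Longrightarrow> fn u \<Longrightarrow> fn (\<lambda>w. pr (t w) (u w))"

text \<open>The parameter \<open>w\<close> stays available inside the relation of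
  \<open>dfn_acc\<close>, so accessible parts can be nested. Each one corresponds to a hyperjump,
  and nesting gives finitely iterated hyperjumps.\<close>

inductive dfn :: "(nat set \<Rightarrow> nat \<Rightarrow> bool) \<Rightarrow> bool" where
  dfn_mem: "fn t \<Longrightarrow> dfn (\<lambda>x w. t w \<in> x)"
| dfn_eq: "fn t \<Longrightarrow> fn u \<Longrightarrow> dfn (\<lambda>x w. t w = u w)"
| dfn_not: "dfn \<phi> \<Longrightarrow> dfn (\<lambda>x w. \<not> \<phi> x w)"
| dfn_conj: "dfn \<phi> \<Longrightarrow> dfn \<psi> \<Longrightarrow> dfn (\<lambda>x w. \<phi> x w \<and> \<psi> x w)"
| dfn_acc: "dfn \<phi> \<Longrightarrow> fn t \<Longrightarrow> dfn (\<lambda>x w. acc_part (\<lambda>a b. \<phi> x (pr w (pr a b))) (t w))"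

text \<open>Total correctness with a postcondition that also sees the minimum along the run, because
  minima decide what happens at limits of loop iterations.\<close>

definition ok :: "nat set \<Rightarrow> com \<Rightarrow> vec \<Rightarrow> (vec \<Rightarrow> vec \<Rightarrow> bool) \<Rightarrow> bool" where
  "ok A c R Q \<longleftrightarrow> (\<exists>R' M. big A c R R' M \<and> Q R' M)"

lemma okI: "big A c R R' M \<Longrightarrow> Q R' M \<Longrightarrow> ok A c R Q"
  by (auto simp: ok_def)

lemma ok_mono: "ok A c R Q \<Longrightarrow> (\<And>R' M. Q R' M \<Longrightarrow> Q' R' M) \<Longrightarrow> ok A c R Q'"
  by (auto simp: ok_def)

lemma ok_basic:
  "Q (R(n := 0)) R \<Longrightarrow> ok A (CZero n) R Q"
  "Q (R(n := Suc (R n))) R \<Longrightarrow> ok A (CSucc n) R Q"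
  "Q (R(n := (if R n \<in> A then 1 else 0))) R \<Longrightarrow> ok A (COracle n) R Q"
  "Q (R(n := R m)) R \<Longrightarrow> ok A (CTrans m n) R Q"
  by (auto intro: okI big.intros)

lemma ok_seq: "ok A a R (\<lambda>R1 M1. ok A b R1 (\<lambda>R2 M2. Q R2 (vmin M1 M2))) \<Longrightarrow> ok A (a ;; b) R Q"
  unfolding ok_def by (blast intro: big.Seq)

lemma ok_if:
  assumes "R m = R n \<Longrightarrow> ok A a R (\<lambda>R' M. Q R' (vmin R M))"
    and "R m \<noteq> R n \<Longrightarrow> ok A b R (\<lambda>R' M. Q R' (vmin (vmin R M) R'))"
  shows "ok A (CIf m n a b) R Q"
  using assms unfolding ok_def by (cases "R m = R n") (blast intro: big.IfT big.IfF)+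

lemma ok_shift: "ok A c (\<lambda>i. R (i + k)) (\<lambda>R' M. Q (vmerge k R R') (vmerge k R M)) \<Longrightarrow> ok A (shift k c) R Q"
  unfolding ok_def by (blast intro: big_shift')

definition body_rel :: "nat set \<Rightarrow> nat \<Rightarrow> nat \<Rightarrow> com \<Rightarrow> vec \<Rightarrow> vec \<Rightarrow> vec \<Rightarrow> bool" where
  "body_rel A m n c R R' M \<longleftrightarrow> R m \<noteq> R n \<and> (\<exists>M0. big A c R R' M0 \<and> M = vmin (vmin R M0) R')"

lemma big_while:
  "tcl UNIV (body_rel A m n c) R R' M \<Longrightarrow> R' m = R' n \<Longrightarrow> big A (CWhile m n c) R R' (vmin M R')"
  using big.WhileT[of m n A c R R' M] by (simp add: body_rel_def[abs_def])

lemma while_finite: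
  assumes step: "\<And>R. I R \<Longrightarrow> R m \<noteq> R n \<Longrightarrow> ok A c R (\<lambda>R' _. I R' \<and> v R' < (v R :: nat))"
    and I: "I R"
  shows "ok A (CWhile m n c) R (\<lambda>R' _. I R' \<and> R' m = R' n)"
proof (cases "R m = R n")
  case True
  then show ?thesis using I by (intro okI[OF big.WhileF]) auto
next
  case False
  have "\<exists>R' M. tcl UNIV (body_rel A m n c) R R' M \<and> I R' \<and> R' m = R' n" if "I R" "R m \<noteq> R n" for R
    using that
  proof (induction "v R" arbitrary: R rule: less_induct)
    case less
    obtain R1 M1 where 1: "big A c R R1 M1" "I R1" "v R1 < v R"
      using step[OF less.prems] by (auto simp: ok_def)
    have b: "tcl UNIV (body_rel A m n c) R R1 (vmin (vmin R M1) R1)"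
      using 1 less.prems by (intro tcl.base) (auto simp: body_rel_def)
    show ?case
    proof (cases "R1 m = R1 n")
      case True then show ?thesis using b 1 by blast
    next
      case False
      then show ?thesis using less.hyps[of R1] 1 b tcl.trans by blast
    qed
  qed
  then show ?thesis using False I big_while unfolding ok_def by blast
qed

definition implT :: "com \<Rightarrow> (nat \<Rightarrow> nat) \<Rightarrow> bool" where
  "implT c t \<longleftrightarrow> (\<forall>A R. ok A c R (\<lambda>R' _. R' 0 = t (R 0)))"

definition implD :: "com \<Rightarrow> (nat set \<Rightarrow> nat \<Rightarrow> bool) \<Rightarrow> bool" where
  "implD c \<phi> \<longleftrightarrow> (\<forall>A R. ok A c R (\<lambda>R' _. R' 0 = (if \<phi> A (R 0) then 1 else 0)))"

lemma implT_seq: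
  assumes "implT a t" "implT b u"
  shows "implT (a ;; b) (\<lambda>w. u (t w))"
  unfolding implT_def
proof (intro allI)
  fix A R
  show "ok A (a ;; b) R (\<lambda>R' _. R' 0 = u (t (R 0)))"
    apply (rule ok_seq)
    apply (rule ok_mono[OF assms(1)[unfolded implT_def, rule_format]])
    apply (rule ok_mono[OF assms(2)[unfolded implT_def, rule_format]])
    by simp
qed

lemma implTD_seq:
  assumes "implT a t" "implD b \<phi>"
  shows "implD (a ;; b) (\<lambda>x w. \<phi> x (t w))"
  unfolding implD_def
proof (intro allI)
  fix A R
  show "ok A (a ;; b) R (\<lambda>R' _. R' 0 = (if \<phi> A (t (R 0)) then 1 else 0))"
    apply (rule ok_seq)
    apply (rule ok_mono[OF assms(1)[unfolded implT_def, rule_format]])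
    apply (rule ok_mono[OF assms(2)[unfolded implD_def, rule_format]])
    by simp
qed

text \<open>The clause on \<open>M\<close> says that the lower registers keep their values at every
  moment of the call, not only at its end.\<close>

lemma call_T:
  assumes "implT c t"
  shows "ok A (shift k c) R (\<lambda>R' M. R' k = t (R k) \<and> (\<forall>i<k. R' i = R i \<and> M i = R i))"
  by (rule ok_shift, rule ok_mono[OF assms[unfolded implT_def, rule_format]]) (simp add: vmerge_def)

lemma call_D:
  assumes "implD c \<phi>"
  shows "ok A (shift k c) R (\<lambda>R' M. R' k = (if \<phi> A (R k) then 1 else 0) \<and> (\<forall>i<k. R' i = R i \<and> M i = R i))"
  by (rule ok_shift, rule ok_mono[OF assms[unfolded implD_def, rule_format]]) (simp add: vmerge_def)

section \<open>Programs for arithmetic and pairing\<close>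

lemma impl_dbl: "\<exists>c. implT c (\<lambda>w. 2 * w)"
proof -
  let ?b = "CSucc 1 ;; CSucc 2 ;; CSucc 2"
  have "implT (CZero 1 ;; CZero 2 ;; CWhile 1 0 ?b ;; CTrans 2 0) (\<lambda>w. 2 * w)"
    unfolding implT_def
    apply (intro allI ok_seq ok_basic)
    subgoal for A R
      apply (rule ok_mono[OF while_finite[where v = "\<lambda>R'. R 0 - R' 1" and I = "\<lambda>R'. R' 0 = R 0 \<and> R' 2 = 2 * R' 1 \<and> R' 1 \<le> R 0"]])
      by (((intro ok_basic ok_seq)?); force)+
    done
  then show ?thesis ..
qed

lemma impl_pred: "\<exists>c. implT c (\<lambda>w. w - 1)"
proof -
  let ?b = "CSucc 1 ;; CSucc 2"
  have "implT (CZero 1 ;; CZero 2 ;; CIf 0 1 (CZero 0) (CSucc 1 ;; CWhile 1 0 ?b ;; CTrans 2 0)) (\<lambda>w. w - 1)"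
    unfolding implT_def
    apply (intro allI ok_seq ok_basic ok_if)
    subgoal by simp
    subgoal for A R
      apply (rule ok_mono[OF while_finite[where v = "\<lambda>R'. R 0 - R' 1" and I = "\<lambda>R'. R' 0 = R 0 \<and> R' 1 = Suc (R' 2) \<and> R' 1 \<le> R 0"]])
      by (((intro ok_basic ok_seq)?); force)+
    done
  then show ?thesis ..
qed

lemma prod_encode_step: "Suc (prod_encode (m, s - m)) = (if m = s then prod_encode (0, Suc s) else prod_encode (Suc m, s - Suc m))"
  if "m \<le> s"
  using that by (cases s) (auto simp: prod_encode_def)

text \<open>Registers 1, 2, 3 hold \<open>i\<close>, \<open>m\<close> and \<open>s\<close> with \<open>i = pr m (s - m)\<close>: the enumeration of the pairs
  along the diagonals.\<close>

definition diag_step :: com where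
  "diag_step = CSucc 1 ;; CIf 2 3 (CZero 2 ;; CSucc 3) (CSucc 2)"

definition diag_inv :: "vec \<Rightarrow> bool" where
  "diag_inv R \<longleftrightarrow> R 2 \<le> R 3 \<and> R 1 = prod_encode (R 2, R 3 - R 2)"

lemma diag_step:
  assumes "diag_inv R"
  shows "ok A diag_step R (\<lambda>R' _. diag_inv R' \<and> R' 1 = Suc (R 1) \<and> R' 0 = R 0 \<and> (\<forall>i>3. R' i = R i)
    \<and> R' 3 = (if R 2 = R 3 then Suc (R 3) else R 3) \<and> R' 2 = (if R 2 = R 3 then 0 else Suc (R 2)))"
  unfolding diag_step_def
  apply (intro ok_seq ok_basic ok_if)
  using assms prod_encode_step[of "R 2" "R 3"] by (auto simp: diag_inv_def)

lemma impl_p12: "\<exists>c. implT c p1" "\<exists>c. implT c p2"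
proof -
  let ?c = "CZero 1 ;; CZero 2 ;; CZero 3 ;; CWhile 1 0 diag_step"
  have *: "ok A ?c R (\<lambda>R' _. R' 2 \<le> R' 3 \<and> R' 2 = p1 (R 0) \<and> R' 3 - R' 2 = p2 (R 0))" for A R
    apply (intro ok_seq ok_basic)
    apply (rule ok_mono[OF while_finite[where v = "\<lambda>R'. R 0 - R' 1" and I = "\<lambda>R'. diag_inv R' \<and> R' 0 = R 0 \<and> R' 1 \<le> R 0"]])
    subgoal by (rule ok_mono[OF diag_step]) auto
    subgoal by (auto simp: diag_inv_def prod_encode_def)
    subgoal for R' M
    proof (elim conjE)
      assume a: "diag_inv R'" "R' 0 = R 0" "R' 1 = R' 0"
      then have "prod_decode (R 0) = (R' 2, R' 3 - R' 2)" by (metis diag_inv_def prod_encode_inverse)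
      then show ?thesis using a by (simp add: p1_def p2_def diag_inv_def)
    qed
    done
  have "implT (?c ;; CTrans 2 0) p1"
    unfolding implT_def by (intro allI, rule ok_seq, rule ok_mono[OF *], rule ok_basic) auto
  then show "\<exists>c. implT c p1" ..
  have "implT (?c ;; CZero 4 ;; CWhile 2 3 (CSucc 2 ;; CSucc 4) ;; CTrans 4 0) p2"
    unfolding implT_def
    apply (intro allI, rule ok_seq, rule ok_mono[OF *], intro ok_seq ok_basic)
    subgoal for A R R1 M1
      apply (rule ok_mono[OF while_finite[where v = "\<lambda>R'. R' 3 - R' 2" and I = "\<lambda>R'. R' 2 \<le> R' 3 \<and> R' 3 - R' 2 + R' 4 = p2 (R 0)"]])
      by (((intro ok_basic ok_seq)?); force)+
    done
  then show "\<exists>c. implT c p2" ..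
qed

text \<open>\<open>prod_encode (a, b)\<close> is \<open>triangle (a + b) + a\<close>: the walk stops
  at the start of the diagonal \<open>a + b\<close>, and \<open>a\<close> more steps are
  counted.\<close>

definition cpair :: com where
  "cpair = CTrans 0 4 ;; CTrans 1 5 ;; CTrans 0 0 ;; CZero 6 ;;
     CWhile 6 5 (CSucc 0 ;; CSucc 6) ;;
     CZero 1 ;; CZero 2 ;; CZero 3 ;; CWhile 3 0 diag_step ;; CWhile 2 4 (CSucc 1 ;; CSucc 2) ;; CTrans 1 0"

lemma cpair: "ok A cpair R (\<lambda>R' _. R' 0 = pr (R 0) (R 1))"
  unfolding cpair_def
  apply (intro ok_seq ok_basic)
  apply (rule ok_mono[OF while_finite[where v = "\<lambda>R'. R 1 - R' 6" and I = "\<lambda>R'. R' 4 = R 0 \<and> R' 5 = R 1 \<and> R' 6 \<le> R 1 \<and> R' 0 = R 0 + R' 6"]])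
    apply (intro ok_basic ok_seq; force)
   apply simp
  apply (intro ok_seq ok_basic)
  apply (rule ok_mono[OF while_finite[where v = "\<lambda>R'. prod_encode (0, R 0 + R 1) - R' 1" and I = "\<lambda>R'. diag_inv R' \<and> R' 4 = R 0 \<and> R' 0 = R 0 + R 1 \<and> R' 3 \<le> R 0 + R 1 \<and> (R' 3 = R 0 + R 1 \<longrightarrow> R' 2 = 0)"]])
    apply (rule ok_mono[OF diag_step], simp)
  subgoal for R1 M1 R2 R3 M3
  proof -
    assume a: "diag_inv R2 \<and> R2 4 = R 0 \<and> R2 0 = R 0 + R 1 \<and> R2 3 \<le> R 0 + R 1 \<and> (R2 3 = R 0 + R 1 \<longrightarrow> R2 2 = 0)"
      "R2 3 \<noteq> R2 0"
    and b: "diag_inv R3 \<and> R3 1 = Suc (R2 1) \<and> R3 0 = R2 0 \<and> (\<forall>i>3. R3 i = R2 i) \<and>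
       R3 3 = (if R2 2 = R2 3 then Suc (R2 3) else R2 3) \<and> R3 2 = (if R2 2 = R2 3 then 0 else Suc (R2 2))"
    \<comment> \<open>The walk is still on an earlier diagonal.\<close>
    have "R2 1 < prod_encode (0, R 0 + R 1)"
    proof -
      have "R2 2 \<le> R2 3" "R2 1 = triangle (R2 3) + R2 2" using a(1) by (auto simp: diag_inv_def prod_encode_def)
      then have "R2 1 < triangle (Suc (R2 3))" by simp
      also have "\<dots> \<le> triangle (R 0 + R 1)"
      proof -
        have "Suc (R2 3) \<le> R 0 + R 1" using a by auto
        then show ?thesis by (rule lift_Suc_mono_le[of triangle, rotated]) simp
      qed
      finally show ?thesis by (simp add: prod_encode_def)
    qed
    then show ?thesis using a b by auto
  qed
   apply (auto simp: diag_inv_def prod_encode_def)[1]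
  apply (intro ok_seq ok_basic)
  apply (rule ok_mono[OF while_finite[where v = "\<lambda>R'. R 0 - R' 2" and I = "\<lambda>R'. R' 4 = R 0 \<and> R' 2 \<le> R 0 \<and> R' 1 = triangle (R 0 + R 1) + R' 2"]])
    apply (intro ok_basic ok_seq; force)
   apply (auto simp: diag_inv_def prod_encode_def)[1]
  apply (rule ok_basic)
  apply (simp add: pr_def prod_encode_def)
  done

lemma call_pair:
  "ok A (shift k cpair) R (\<lambda>R' M. R' k = pr (R k) (R (Suc k)) \<and> (\<forall>i<k. R' i = R i \<and> M i = R i))"
  by (rule ok_shift, rule ok_mono[OF cpair]) (simp add: vmerge_def)

lemma fn_impl: "fn t \<Longrightarrow> \<exists>c. implT c t"
proof (induction rule: fn.induct)
  case fn_id
  have "implT (CTrans 0 0) (\<lambda>w. w)" unfolding implT_def by (intro allI ok_basic) simp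
  then show ?case ..
next
  case fn_zero
  have "implT (CZero 0) (\<lambda>w. 0)" unfolding implT_def by (intro allI ok_basic) simp
  then show ?case ..
next
  case (fn_Suc t)
  have "implT (CSucc 0) Suc" unfolding implT_def by (intro allI ok_basic) simp
  then show ?case using fn_Suc.IH implT_seq by blast
next
  case (fn_pr t u)
  then obtain a b where ab: "implT a t" "implT b u" by blast
  have "implT (CTrans 0 1 ;; shift 1 a ;; CTrans 0 2 ;; shift 2 b ;; shift 1 cpair ;; CTrans 1 0) (\<lambda>w. pr (t w) (u w))"
    unfolding implT_def
    apply (intro allI ok_seq ok_basic)
    apply (rule ok_mono[OF call_T[OF ab(1)]])
    apply (intro allI ok_seq ok_basic)
    apply (rule ok_mono[OF call_T[OF ab(2)]])
    apply (intro allI ok_seq ok_basic)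
    apply (rule ok_mono[OF call_pair])
    apply (rule ok_basic)
    by (auto simp: numeral_2_eq_2)
  then show ?case ..
qed (use impl_dbl impl_pred impl_p12 implT_seq in blast)+

section \<open>Deciding accessibility by depth-first search\<close>

lemma p2_le: "p2 n \<le> n"
  using le_prod_encode_2[of "p2 n" "p1 n"] pr_simps(3)[of n] by (simp add: pr_def)

lemma p2_0 [simp]: "p2 0 = 0" using p2_le[of 0] by simp

lemma list_encode_pr: "list_encode (a # l) = Suc (pr a (list_encode l))"
  by (simp add: pr_def)

lemma list_encode_Cons_le: "list_encode l \<le> list_encode (k # l)"
  using le_prod_encode_2[of "list_encode l" k] by (simp add: pr_def)

lemma pr_le_child [simp]: "pr a c \<le> pr k (Suc (pr a c))"
  using le_prod_encode_2[of "Suc (pr a c)" k] by (simp add: pr_def)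

declare list_encode.simps(2) [simp del] list_encode_pr [simp]

text \<open>The stack codes a list of the current node followed by its ancestors;
  \<open>list_encode\<close> adds 1 to a pair, which \<open>D - 1\<close> undoes. \<open>cq\<close>
  assembles the query whether the top is related to its parent.\<close>

locale dfs =
  fixes \<phi> :: "nat set \<Rightarrow> nat \<Rightarrow> bool" and cphi cpar cchild cnext cq :: com
  assumes cphi: "implD cphi \<phi>"
    and cpar: "implT cpar (\<lambda>D. p2 (D - 1))"
    and cchild: "implT cchild (\<lambda>D. Suc (pr 0 D))"
    and cnext: "implT cnext (\<lambda>D. Suc (pr (Suc (p1 (D - 1))) (p2 (D - 1))))"
    and cq: "implT cq (\<lambda>q. pr (p1 q) (pr (p1 (p2 q - 1)) (p1 (p2 (p2 q - 1) - 1))))"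
begin

text \<open>Register 0 holds the parameter, register 1 the stack, register 2 is 1 at the head of the
  loop except at limit times, register 3 signals termination, registers 4 and 5 hold the
  constants 0 and 1.\<close>

definition "getpar = CTrans 1 6 ;; shift 6 cpar"

definition "check = CTrans 0 6 ;; CTrans 1 7 ;; shift 6 cpair ;; shift 6 cq ;; shift 6 cphi"

definition "push = CTrans 1 6 ;; shift 6 cchild ;; CTrans 6 1"

text \<open>The stack visits the parent before the next sibling, so that the stack is the parent
  again when all children have been explored.\<close>

definition "backtrack = getpar ;; CIf 6 4 (CZero 0 ;; CSucc 0 ;; CSucc 3)
   (CTrans 1 7 ;; shift 7 cnext ;; CTrans 6 1 ;; CTrans 7 1)"

text \<open>Every iteration sets register 2 to 0 before setting it to 1, so its limit inferior is 0
  and identifies limits. At a limit, stack 0 can only come from an overflow, that is, from an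
  infinite branch; any other stack is a node whose children have all been tried.\<close>

definition "body = CIf 2 4 (CIf 1 4 (CZero 0 ;; CSucc 3) backtrack)
   (getpar ;; CIf 6 4 push (check ;; CIf 6 4 backtrack push))
   ;; CZero 2 ;; CSucc 2"

definition st :: "vec \<Rightarrow> nat \<Rightarrow> nat \<Rightarrow> nat \<Rightarrow> bool" where
  "st R w D F \<longleftrightarrow> R 0 = w \<and> R 1 = D \<and> R 2 = F \<and> R 3 = 0 \<and> R 4 = 0 \<and> R 5 = 1"

definition rel :: "nat set \<Rightarrow> nat \<Rightarrow> nat \<Rightarrow> nat \<Rightarrow> bool" where
  "rel A w a b \<longleftrightarrow> \<phi> A (pr w (pr a b))"

definition node :: "nat set \<Rightarrow> nat \<Rightarrow> nat list \<Rightarrow> bool" where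
  "node A w l \<longleftrightarrow> (case l of a # b # l' \<Rightarrow> rel A w a b | _ \<Rightarrow> True)"

lemma push_ok: "st R w D F \<Longrightarrow> ok A push R (\<lambda>R' M. st R' w (Suc (pr 0 D)) F \<and> st M w D F)"
  unfolding push_def
  apply (intro ok_seq ok_basic)
  apply (rule ok_mono[OF call_T[OF cchild]])
  apply (rule ok_basic)
  by (simp add: st_def)

lemma getpar_ok:
  "st R w (list_encode (a # l)) F \<Longrightarrow> ok A getpar R (\<lambda>R' M. st R' w (list_encode (a # l)) F \<and>
     st M w (list_encode (a # l)) F \<and> R' 6 = list_encode l)"
  unfolding getpar_def
  apply (intro ok_seq ok_basic)
  apply (rule ok_mono[OF call_T[OF cpar]])
  by (simp add: st_def)

lemma check_ok:
  "st R w (list_encode (k # a # l)) F \<Longrightarrow> ok A check R (\<lambda>R' M. st R' w (list_encode (k # a # l)) F \<and>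
     st M w (list_encode (k # a # l)) F \<and> R' 6 = (if rel A w k a then 1 else 0))"
  unfolding check_def
  apply (intro ok_seq ok_basic)
  apply (rule ok_mono[OF call_pair])
  apply (rule ok_seq)
  apply (rule ok_mono[OF call_T[OF cq]])
  apply (rule ok_mono[OF call_D[OF cphi]])
  by (simp add: st_def rel_def)

lemma next_ok:
  "st R w (list_encode (k # a # l)) F \<Longrightarrow> R 6 = list_encode (a # l) \<Longrightarrow>
    ok A (CTrans 1 7 ;; shift 7 cnext ;; CTrans 6 1 ;; CTrans 7 1) R
     (\<lambda>R' M. st R' w (list_encode (Suc k # a # l)) F \<and> st M w (list_encode (a # l)) F)"
  apply (intro ok_seq ok_basic)
  apply (rule ok_mono[OF call_T[OF cnext]])
  apply (intro ok_seq ok_basic)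
  by (simp add: st_def)

lemma st_vmin: "st M w D F \<Longrightarrow> st N w E G \<Longrightarrow> D' = min D E \<Longrightarrow> F' = min F G \<Longrightarrow> st (vmin M N) w D' F'"
  by (simp add: st_def)

lemma reset_ok:
  "st R w D F \<Longrightarrow> F \<le> 1 \<Longrightarrow> ok A (CZero 2 ;; CSucc 2) R (\<lambda>R' M. st R' w D 1 \<and> st M w D 0)"
  by (intro ok_seq ok_basic) (simp add: st_def)

lemma backtrack_ok:
  assumes "st R w (list_encode (k # a # l)) F"
  shows "ok A backtrack R (\<lambda>R' M. st R' w (list_encode (Suc k # a # l)) F \<and> st M w (list_encode (a # l)) F)"
  unfolding backtrack_def
  apply (rule ok_seq, rule ok_mono[OF getpar_ok[OF assms]])
  apply (rule ok_if)
  subgoal by (auto simp: st_def)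
  subgoal for R1 M1
    apply (rule ok_mono[OF next_ok[of R1 w k a l F]])
    by (simp_all add: st_def)
  done

lemma backtrack_root:
  assumes "st R w (list_encode [a]) F"
  shows "ok A backtrack R (\<lambda>R' M. R' 0 = 1 \<and> R' 3 = 1 \<and> R' 5 = 1)"
  unfolding backtrack_def
  apply (rule ok_seq, rule ok_mono[OF getpar_ok[OF assms]])
  apply (rule ok_if)
   apply (intro ok_seq ok_basic)
  by (simp_all add: st_def)

lemma body_limit:
  assumes "st R w (list_encode (k # a # l)) 0"
  shows "ok A body R (\<lambda>R' M. st R' w (list_encode (Suc k # a # l)) 1 \<and> st M w (list_encode (a # l)) 0)"
  unfolding body_def
  apply (intro ok_seq)
  apply (rule ok_if)
   apply (rule ok_if)
  subgoal using assms by (auto simp: st_def)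
   apply (rule ok_mono[OF backtrack_ok[OF assms]])
   apply (intro ok_seq ok_basic)
  subgoal using assms by (auto simp: st_def)
  subgoal using assms by (simp add: st_def)
  done

lemma body_limit_root:
  assumes "st R w (list_encode [a]) 0"
  shows "ok A body R (\<lambda>R' M. R' 0 = 1 \<and> R' 3 = 1 \<and> R' 5 = 1)"
  unfolding body_def
  apply (intro ok_seq)
  apply (rule ok_if)
   apply (rule ok_if)
  subgoal using assms by (auto simp: st_def)
   apply (rule ok_mono[OF backtrack_root[OF assms]])
   apply (intro ok_seq ok_basic)
  subgoal using assms by (auto simp: st_def)
  subgoal using assms by (simp add: st_def)
  done

lemma body_overflow:
  assumes "st R w 0 0"
  shows "ok A body R (\<lambda>R' M. R' 0 = 0 \<and> R' 3 = 1 \<and> R' 5 = 1)"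
  unfolding body_def
  apply (intro ok_seq)
  apply (rule ok_if)
   apply (rule ok_if)
    apply (intro ok_seq ok_basic)
  using assms by (simp_all add: st_def)

lemma body_enter_root:
  assumes s: "st R w (list_encode [a]) 1"
  shows "ok A body R (\<lambda>R' M. st R' w (list_encode [0, a]) 1 \<and> st M w (list_encode [a]) 0)"
  unfolding body_def
  apply (rule ok_seq, rule ok_if)
  subgoal using s by (auto simp: st_def)
  apply (rule ok_seq, rule ok_mono[OF getpar_ok[OF s]])
  apply (rule ok_if)
  subgoal for R1 M1
    apply (rule ok_mono[OF push_ok[of R1 w "list_encode [a]" 1]], simp)
    subgoal for R2 M2
      apply (rule ok_mono[OF reset_ok[of R2 w "list_encode [0, a]" 1]], simp, simp)
      apply (elim conjE, rule conjI, assumption)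
      by (rule st_vmin, (assumption | rule s | rule st_vmin | rule refl)+, simp_all)
    done
  subgoal by (auto simp: st_def)
  done

lemma body_enter:
  assumes s: "st R w (list_encode (k # a # l)) 1"
  shows "ok A body R (\<lambda>R' M. if rel A w k a
    then st R' w (list_encode (0 # k # a # l)) 1 \<and> st M w (list_encode (k # a # l)) 0
    else st R' w (list_encode (Suc k # a # l)) 1 \<and> st M w (list_encode (a # l)) 0)"
  unfolding body_def
  apply (rule ok_seq, rule ok_if)
  subgoal using s by (auto simp: st_def)
  apply (rule ok_seq, rule ok_mono[OF getpar_ok[OF s]])
  apply (rule ok_if)
  subgoal by (auto simp: st_def)
  subgoal for R1 M1
    apply (rule ok_seq, rule ok_mono[OF check_ok[of R1 w k a l 1]], simp)
    subgoal for R2 M2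
      apply (rule ok_if)
      subgoal
        apply (rule ok_mono[OF backtrack_ok[of R2 w k a l 1]], simp)
        subgoal for R3 M3
          apply (rule ok_mono[OF reset_ok[of R3 w "list_encode (Suc k # a # l)" 1]], simp, simp)
          apply (elim conjE, subst if_not_P, simp add: st_def split: if_splits, rule conjI, assumption)
          by (rule st_vmin, (assumption | rule s | rule st_vmin | rule refl)+, simp_all)
        done
      subgoal
        apply (rule ok_mono[OF push_ok[of R2 w "list_encode (k # a # l)" 1]], simp)
        subgoal for R3 M3
          apply (rule ok_mono[OF reset_ok[of R3 w "list_encode (0 # k # a # l)" 1]], simp, simp)
          apply (elim conjE, subst if_P, simp add: st_def split: if_splits, rule conjI, assumption)
          by (rule st_vmin, (assumption | rule s | rule st_vmin | rule refl)+, simp_all)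
        done
      done
    done
  done

section \<open>Transfinite iterations of the search loop\<close>

abbreviation "It A \<equiv> body_rel A 3 5 body"
abbreviation "run A \<equiv> tcl UNIV (It A)"

text \<open>The two inequalities make \<open>D\<close> the least stack of the whole iteration,
  including the tests at the loop head.\<close>

lemma It_ok:
  assumes "ok A body R (\<lambda>R' M. st R' w D' 1 \<and> st M w D F)" "st R w E G" "D \<le> E" "D \<le> D'" "F = 0"
  shows "\<exists>R' M. run A R R' M \<and> st R' w D' 1 \<and> st M w D 0"
proof -
  obtain R' M where *: "big A body R R' M" "st R' w D' 1" "st M w D F" using assms(1) by (auto simp: ok_def)
  have "run A R R' (vmin (vmin R M) R')"
    using * assms(2) by (intro tcl.base) (auto simp: body_rel_def st_def)
  moreover have "st (vmin (vmin R M) R') w D 0" using * assms by (auto simp: st_def)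
  ultimately show ?thesis using * by blast
qed

lemma run_limit:
  assumes "st R w (list_encode (k # a # l)) 0"
  shows "\<exists>R' M. run A R R' M \<and> st R' w (list_encode (Suc k # a # l)) 1 \<and> st M w (list_encode (a # l)) 0"
proof -
  show ?thesis
    by (rule It_ok[OF body_limit[OF assms] assms]) (rule list_encode_Cons_le refl)+
qed

lemma run_skip:
  assumes "st R w (list_encode (k # a # l)) 1" "\<not> rel A w k a"
  shows "\<exists>R' M. run A R R' M \<and> st R' w (list_encode (Suc k # a # l)) 1 \<and> st M w (list_encode (a # l)) 0"
proof -
  have "ok A body R (\<lambda>R' M. st R' w (list_encode (Suc k # a # l)) 1 \<and> st M w (list_encode (a # l)) 0)"
    by (rule ok_mono[OF body_enter[OF assms(1)]]) (use assms(2) in auto)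
  then show ?thesis
    by (rule It_ok[OF _ assms(1)]) (rule list_encode_Cons_le refl)+
qed

lemma run_push:
  assumes "st R w (list_encode (a # l)) 1" "node A w (a # l)"
  shows "\<exists>R' M. run A R R' M \<and> st R' w (list_encode (0 # a # l)) 1 \<and> st M w (list_encode (a # l)) 0"
proof -
  have "ok A body R (\<lambda>R' M. st R' w (list_encode (0 # a # l)) 1 \<and> st M w (list_encode (a # l)) 0)"
  proof (cases l)
    case Nil
    then show ?thesis using body_enter_root assms by simp
  next
    case (Cons b l')
    show ?thesis unfolding Cons
      by (rule ok_mono[OF body_enter]) (use assms Cons in \<open>auto simp: node_def\<close>)
  qed
  then show ?thesis
    by (rule It_ok[OF _ assms(1)]) (rule list_encode_Cons_le order_refl refl)+
qed

lemma st_min: "st M w D 0 \<Longrightarrow> st N w E 0 \<Longrightarrow> st (vmin M N) w (min D E) 0"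
  by (simp add: st_def)

lemma run_trans:
  "run A R R1 M1 \<Longrightarrow> st M1 w D 0 \<Longrightarrow> run A R1 R2 M2 \<Longrightarrow> st M2 w E 0 \<Longrightarrow>
    \<exists>M. run A R R2 M \<and> st M w (min D E) 0"
  by (rule exI, rule conjI, erule (1) tcl.trans, erule (1) st_min)

lemma run_lim:
  assumes "\<And>i. run A (g i) (g (Suc i)) (Ms i)" "\<And>i. st (Ms i) w (D i) 0"
  shows "run A (g 0) (\<lambda>j. limn (\<lambda>i. Ms i j)) (\<lambda>j. Inf (range (\<lambda>i. Ms i j)))"
    "st (\<lambda>j. limn (\<lambda>i. Ms i j)) w (limn D) 0"
    "st (\<lambda>j. Inf (range (\<lambda>i. Ms i j))) w (Inf (range D)) 0"
proof -
  show "run A (g 0) (\<lambda>j. limn (\<lambda>i. Ms i j)) (\<lambda>j. Inf (range (\<lambda>i. Ms i j)))"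
    by (rule tcl.lim) (use assms in auto)
  have e: "(\<lambda>i. Ms i 0) = (\<lambda>i. w)" "(\<lambda>i. Ms i 1) = D" "(\<lambda>i. Ms i 2) = (\<lambda>i. 0)" "(\<lambda>i. Ms i 3) = (\<lambda>i. 0)"
    "(\<lambda>i. Ms i 4) = (\<lambda>i. 0)" "(\<lambda>i. Ms i 5) = (\<lambda>i. 1)"
    using assms(2) by (auto simp: st_def)
  show "st (\<lambda>j. limn (\<lambda>i. Ms i j)) w (limn D) 0" "st (\<lambda>j. Inf (range (\<lambda>i. Ms i j))) w (Inf (range D)) 0"
    unfolding st_def e by simp_all
qed

text \<open>The candidates 0, 1, 2, ... for children of \<open>a\<close> are treated in turn, and
  each stage has the code of \<open>a # l\<close> as the minimum of its stack. At the limit of the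
  stages the stack is therefore \<open>a # l\<close> again and the flag is 0; this is so even for a
  leaf.\<close>

lemma explore:
  assumes "acc_part (rel A w) a"
  shows "st R w (list_encode (a # l)) 1 \<Longrightarrow> node A w (a # l) \<Longrightarrow>
    \<exists>R' M. run A R R' M \<and> st R' w (list_encode (a # l)) 0 \<and> st M w (list_encode (a # l)) 0"
  using assms
proof (induction a arbitrary: R l rule: accp.induct)
  case (accI a)
  let ?D = "list_encode (a # l)"
  have le: "?D \<le> pr j ?D" for j unfolding pr_def by (rule le_prod_encode_2)
  have child: "\<exists>R' M. run A R R' M \<and> st R' w (list_encode (Suc k # a # l)) 1 \<and> st M w ?D 0"
    if s: "st R w (list_encode (k # a # l)) 1" for k R
  proof (cases "rel A w k a")
    case True
    have "node A w (k # a # l)" using True by (simp add: node_def)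
    then obtain R1 M1 where 1: "run A R R1 M1" "st R1 w (list_encode (k # a # l)) 0" "st M1 w (list_encode (k # a # l)) 0"
      using accI.IH[OF True s] by blast
    obtain R2 M2 where 2: "run A R1 R2 M2" "st R2 w (list_encode (Suc k # a # l)) 1" "st M2 w ?D 0"
      using run_limit[OF 1(2)] by blast
    have "min (list_encode (k # a # l)) ?D = ?D" using le[of k] by simp
    then show ?thesis using run_trans[OF 1(1,3) 2(1,3)] 2(2) by metis
  next
    case False
    then show ?thesis using run_skip[OF s] by blast
  qed
  obtain R0 M0 where 0: "run A R R0 M0" "st R0 w (list_encode (0 # a # l)) 1" "st M0 w ?D 0"
    using run_push[OF accI.prems] by blast
  let ?Q = "\<lambda>x y. run A (fst x) (fst y) (snd y) \<and> st (snd y) w ?D 0"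
  have nxt: "\<exists>y. st (fst y) w (list_encode (Suc n # a # l)) 1 \<and> ?Q x y"
    if "st (fst x) w (list_encode (n # a # l)) 1" for n and x :: "vec \<times> vec"
    using child[OF that] by auto
  have start: "st (fst (R0, R0)) w (list_encode (0 # a # l)) 1" using 0(2) by simp
  obtain g where g: "g 0 = (R0, R0)" "\<And>n. st (fst (g n)) w (list_encode (n # a # l)) 1" "\<And>n. ?Q (g n) (g (Suc n))"
    by (rule dependent_choice_from[of "\<lambda>n x. st (fst x) w (list_encode (n # a # l)) 1" "(R0, R0)" "\<lambda>_. ?Q", OF start nxt]) (assumption, rule that)
  have g0: "fst (g 0) = R0" using g(1) by simp
  note L = run_lim[of A "\<lambda>n. fst (g n)" "\<lambda>n. snd (g (Suc n))" w "\<lambda>_. ?D"]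
  have "run A (fst (g n)) (fst (g (Suc n))) (snd (g (Suc n)))" "st (snd (g (Suc n))) w ?D 0" for n
    using g by blast+
  note L = L[OF this]
  show ?case using run_trans[OF 0(1,3) L(1)[unfolded g0] L(3)] L(2) by auto
qed

text \<open>Let \<open>k\<close> be the least inaccessible child. Smaller candidates are accessible
  children, which \<open>explore\<close> completes, or no children, so the search gets to
  \<open>k\<close>.\<close>

lemma descend:
  assumes "\<not> acc_part (rel A w) a" "st R w (list_encode (a # l)) 1" "node A w (a # l)"
  shows "\<exists>k R' M. \<not> acc_part (rel A w) k \<and> rel A w k a \<and> run A R R' M \<and>
    st R' w (list_encode (k # a # l)) 1 \<and> st M w (list_encode (a # l)) 0"
proof -
  let ?D = "list_encode (a # l)"
  let ?bad = "\<lambda>k. rel A w k a \<and> \<not> acc_part (rel A w) k"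
  have le: "?D \<le> pr j ?D" for j unfolding pr_def by (rule le_prod_encode_2)
  have "\<exists>k. ?bad k" using assms(1) not_accp_down by metis
  then obtain k where k: "?bad k" "\<And>j. j < k \<Longrightarrow> \<not> ?bad j" using exists_least_iff[of ?bad] by blast
  have "\<exists>R' M. run A R R' M \<and> st R' w (list_encode (j # a # l)) 1 \<and> st M w ?D 0" if "j \<le> k" for j
    using that
  proof (induction j)
    case 0
    then show ?case using run_push[OF assms(2,3)] by blast
  next
    case (Suc j)
    then obtain R0 M0 where 0: "run A R R0 M0" "st R0 w (list_encode (j # a # l)) 1" "st M0 w ?D 0" by auto
    have "\<exists>R' M. run A R0 R' M \<and> st R' w (list_encode (Suc j # a # l)) 1 \<and> st M w ?D 0"
    proof (cases "rel A w j a")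
      case True
      then have acc: "acc_part (rel A w) j" using k(2)[of j] Suc.prems by auto
      have "node A w (j # a # l)" using True by (simp add: node_def)
      then obtain R1 M1 where 1: "run A R0 R1 M1" "st R1 w (list_encode (j # a # l)) 0" "st M1 w (list_encode (j # a # l)) 0"
        using explore[OF acc 0(2)] by blast
      obtain R2 M2 where 2: "run A R1 R2 M2" "st R2 w (list_encode (Suc j # a # l)) 1" "st M2 w ?D 0"
        using run_limit[OF 1(2)] by blast
      have "min (list_encode (j # a # l)) ?D = ?D" using le[of j] by simp
      then show ?thesis using run_trans[OF 1(1,3) 2(1,3)] 2(2) by metis
    next
      case False
      then show ?thesis using run_skip[OF 0(2)] by blast
    qed
    then obtain R1 M1 where 1: "run A R0 R1 M1" "st R1 w (list_encode (Suc j # a # l)) 1" "st M1 w ?D 0" by blast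
    then show ?case using run_trans[OF 0(1,3) 1(1,3)] by auto
  qed
  then show ?thesis using k by blast
qed

lemma loop_accp:
  assumes "acc_part (rel A w) a" "st R w (list_encode [a]) 1"
  shows "ok A (CWhile 3 5 body) R (\<lambda>R' _. R' 0 = 1)"
proof -
  obtain R1 M1 where 1: "run A R R1 M1" "st R1 w (list_encode [a]) 0"
    using explore[OF assms(1), of R "[]"] assms(2) by (auto simp: node_def)
  obtain R2 M2 where 2: "big A body R1 R2 M2" "R2 0 = 1" "R2 3 = 1" "R2 5 = 1"
    using body_limit_root[OF 1(2), of A] by (auto simp: ok_def)
  have "run A R1 R2 (vmin (vmin R1 M2) R2)"
    using 1 2 by (intro tcl.base) (auto simp: body_rel_def st_def)
  from big_while[OF tcl.trans[OF 1(1) this]] 2 show ?thesis by (auto simp: ok_def)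
qed

lemma diverges_ge:
  assumes "\<And>i. i \<le> f i"
  shows "diverges f"
  unfolding diverges_def INFM_nat_le
proof (intro notI, elim exE)
  fix b assume "\<forall>m. \<exists>n\<ge>m. f n \<le> b"
  then obtain n where "n \<ge> Suc b" "f n \<le> b" by blast
  then show False using assms[of n] by simp
qed

lemma length_le_list_encode: "length l \<le> list_encode l"
proof (induction l)
  case (Cons a l)
  then show ?case using le_prod_encode_2[of "list_encode l" a] by (simp add: pr_def)
qed simp

lemma loop_not_accp:
  assumes "\<not> acc_part (rel A w) a" "st R w (list_encode [a]) 1"
  shows "ok A (CWhile 3 5 body) R (\<lambda>R' _. R' 0 = 0)"
proof -
  define good where "good n l R \<longleftrightarrow> length l = n \<and> l \<noteq> [] \<and> \<not> acc_part (rel A w) (hd l) \<and> node A w l \<and>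
    st R w (list_encode l) 1" for n l R
  let ?Q = "\<lambda>x y :: nat list \<times> vec \<times> vec. run A (fst (snd x)) (fst (snd y)) (snd (snd y)) \<and>
    st (snd (snd y)) w (list_encode (fst x)) 0"
  have nxt: "\<exists>y. good (Suc (Suc n)) (fst y) (fst (snd y)) \<and> ?Q x y"
    if good: "good (Suc n) (fst x) (fst (snd x))" for n and x :: "nat list \<times> vec \<times> vec"
  proof -
    obtain a l where al: "fst x = a # l" "length l = n" "\<not> acc_part (rel A w) a"
      "node A w (a # l)" "st (fst (snd x)) w (list_encode (a # l)) 1"
      using good unfolding good_def by (cases "fst x") auto
    obtain k R' M where k: "\<not> acc_part (rel A w) k" "rel A w k a" "run A (fst (snd x)) R' M"
      "st R' w (list_encode (k # a # l)) 1" "st M w (list_encode (a # l)) 0"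
      using descend[OF al(3,5,4)] by blast
    have "good (Suc (Suc n)) (k # a # l) R'" using k al by (auto simp: good_def node_def)
    then show ?thesis using k al by (intro exI[of _ "(k # a # l, R', M)"]) auto
  qed
  have start: "good (Suc 0) (fst ([a], R, R)) (fst (snd ([a], R, R)))" using assms by (auto simp: good_def node_def)
  obtain g where g: "g 0 = ([a], R, R)" "\<And>n. good (Suc n) (fst (g n)) (fst (snd (g n)))" "\<And>n. ?Q (g n) (g (Suc n))"
    by (rule dependent_choice_from[of "\<lambda>n x. good (Suc n) (fst x) (fst (snd x))" "([a], R, R)" "\<lambda>_. ?Q", OF start nxt]) (assumption, rule that)
  have g0: "fst (snd (g 0)) = R" using g(1) by simp
  have "run A (fst (snd (g n))) (fst (snd (g (Suc n)))) (snd (snd (g (Suc n))))"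
    "st (snd (snd (g (Suc n)))) w (list_encode (fst (g n))) 0" for n using g by blast+
  note L = run_lim[of A "\<lambda>n. fst (snd (g n))" "\<lambda>n. snd (snd (g (Suc n)))" w "\<lambda>n. list_encode (fst (g n))", OF this]
  \<comment> \<open>The minimal stack of the \<open>n\<close>-th segment has \<open>n + 1\<close>
    entries, so the stack register diverges and is reset to 0.\<close>
  have "n \<le> list_encode (fst (g n))" for n
    using g(2)[of n] length_le_list_encode[of "fst (g n)"] by (auto simp: good_def)
  then have "limn (\<lambda>n. list_encode (fst (g n))) = 0" using diverges_ge by (simp add: limn_def)
  with L(2) have s: "st (\<lambda>j. limn (\<lambda>i. snd (snd (g (Suc i))) j)) w 0 0" (is "st ?R1 w 0 0") by simp
  obtain R2 M2 where 2: "big A body ?R1 R2 M2" "R2 0 = 0" "R2 3 = 1" "R2 5 = 1"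
    using body_overflow[OF s, of A] by (auto simp: ok_def)
  have "run A ?R1 R2 (vmin (vmin ?R1 M2) R2)"
    using s 2 by (intro tcl.base) (auto simp: body_rel_def st_def)
  from big_while[OF tcl.trans[OF L(1)[unfolded g0] this]] 2 show ?thesis by (auto simp: ok_def)
qed

end

lemma dfn_impl: "dfn \<phi> \<Longrightarrow> \<exists>c. implD c \<phi>"
proof (induction rule: dfn.induct)
  case (dfn_mem t)
  have "implD (COracle 0) (\<lambda>x w. w \<in> x)" unfolding implD_def by (intro allI ok_basic) simp
  then show ?case using fn_impl[OF dfn_mem] implTD_seq by blast
next
  case (dfn_eq t u)
  then obtain a b where ab: "implT a t" "implT b u" using fn_impl by blast
  have "implD (CTrans 0 1 ;; shift 1 a ;; CTrans 0 2 ;; shift 2 b ;; CIf 1 2 (CZero 0 ;; CSucc 0) (CZero 0))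
    (\<lambda>x w. t w = u w)"
    unfolding implD_def
    apply (intro allI ok_seq ok_basic)
    apply (rule ok_mono[OF call_T[OF ab(1)]])
    apply (intro allI ok_seq ok_basic)
    apply (rule ok_mono[OF call_T[OF ab(2)]])
    apply (intro allI ok_seq ok_basic ok_if)
    by auto
  then show ?case ..
next
  case (dfn_not \<phi>)
  then obtain a where a: "implD a \<phi>" by blast
  have "implD (a ;; CZero 1 ;; CIf 0 1 (CSucc 0) (CZero 0)) (\<lambda>x w. \<not> \<phi> x w)"
    unfolding implD_def
    apply (intro allI, rule ok_seq)
    apply (rule ok_mono[OF a[unfolded implD_def, rule_format]])
    apply (intro allI ok_seq ok_basic ok_if)
    by (auto split: if_splits)
  then show ?case ..
next
  case (dfn_conj \<phi> \<psi>)
  then obtain a b where ab: "implD a \<phi>" "implD b \<psi>" by blast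
  have "implD (CTrans 0 1 ;; shift 1 a ;; CTrans 0 2 ;; shift 2 b ;; CZero 3 ;; CIf 1 3 (CZero 0) (CTrans 2 0))
    (\<lambda>x w. \<phi> x w \<and> \<psi> x w)"
    unfolding implD_def
    apply (intro allI ok_seq ok_basic)
    apply (rule ok_mono[OF call_D[OF ab(1)]])
    apply (intro allI ok_seq ok_basic)
    apply (rule ok_mono[OF call_D[OF ab(2)]])
    apply (intro allI ok_seq ok_basic ok_if)
    by (auto split: if_splits)
  then show ?case ..
next
  case (dfn_acc \<phi> t)
  obtain cphi where 1: "implD cphi \<phi>" using dfn_acc by blast
  have f: "fn (\<lambda>D. p2 (D - 1))" "fn (\<lambda>D. Suc (pr 0 D))" "fn (\<lambda>D. Suc (pr (Suc (p1 (D - 1))) (p2 (D - 1))))"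
    "fn (\<lambda>q. pr (p1 q) (pr (p1 (p2 q - 1)) (p1 (p2 (p2 q - 1) - 1))))" "fn (\<lambda>w. Suc (pr (t w) 0))"
    by (intro fn.intros dfn_acc)+
  obtain cpar cchild cnext cq ci where 2: "implT cpar (\<lambda>D. p2 (D - 1))" "implT cchild (\<lambda>D. Suc (pr 0 D))"
    "implT cnext (\<lambda>D. Suc (pr (Suc (p1 (D - 1))) (p2 (D - 1))))"
    "implT cq (\<lambda>q. pr (p1 q) (pr (p1 (p2 q - 1)) (p1 (p2 (p2 q - 1) - 1))))" "implT ci (\<lambda>w. Suc (pr (t w) 0))"
    using f[THEN fn_impl] by blast
  interpret dfs \<phi> cphi cpar cchild cnext cq by unfold_locales (use 1 2 in auto)
  have "implD (CTrans 0 1 ;; shift 1 ci ;; CZero 2 ;; CSucc 2 ;; CZero 3 ;; CZero 4 ;; CZero 5 ;; CSucc 5 ;; CWhile 3 5 body)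
    (\<lambda>x w. acc_part (\<lambda>a b. \<phi> x (pr w (pr a b))) (t w))"
    unfolding implD_def
    apply (intro allI ok_seq ok_basic)
    apply (rule ok_mono[OF call_T[OF 2(5)]])
    apply (intro allI ok_seq ok_basic)
    subgoal for A R R1 M1
    proof -
      assume a: "R1 1 = Suc (pr (t ((R(1 := R 0)) 1)) 0) \<and> (\<forall>i<1. R1 i = (R(1 := R 0)) i \<and> M1 i = (R(1 := R 0)) i)"
      have s: "st (R1(2 := 0, 2 := Suc ((R1(2 := 0)) 2), 3 := 0, 4 := 0, 5 := 0,
         5 := Suc ((R1(2 := 0, 2 := Suc ((R1(2 := 0)) 2), 3 := 0, 4 := 0, 5 := 0)) 5))) (R 0) (list_encode [t (R 0)]) 1"
        using a by (simp add: st_def)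
      show ?thesis
        using loop_accp[OF _ s, of A] loop_not_accp[OF _ s, of A]
        unfolding rel_def by (cases "acc_part (\<lambda>a b. \<phi> A (pr (R 0) (pr a b))) (t (R 0))") simp_all
    qed
    done
  then show ?case ..
qed

section \<open>Inductive definitions\<close>

lemma fn_comp: "fn u \<Longrightarrow> fn t \<Longrightarrow> fn (\<lambda>w. u (t w))"
  by (induction rule: fn.induct) (assumption | rule fn.intros)+

lemma fn_const: "fn (\<lambda>w. k)"
  by (induction k) (rule fn.intros, assumption?)+

lemma dfn_subst: "dfn \<phi> \<Longrightarrow> fn t \<Longrightarrow> dfn (\<lambda>x w. \<phi> x (t w))"
proof (induction arbitrary: t rule: dfn.induct)
  case (dfn_acc \<phi> u)
  have "dfn (\<lambda>x w. \<phi> x (pr (t (p1 w)) (p2 w)))"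
    by (rule dfn_acc.IH) (intro fn.intros fn_comp[OF dfn_acc.prems])
  from dfn.dfn_acc[OF this fn_comp[OF dfn_acc.hyps(2) dfn_acc.prems]] show ?case by simp
qed (auto intro: dfn.intros fn_comp)

text \<open>Lets a relation read one half of a join, with \<open>h\<close> doubling its argument or
  adding 1 to the double.\<close>

lemma dfn_pullback:
  assumes "fn h"
  shows "dfn \<phi> \<Longrightarrow> dfn (\<lambda>u w. \<phi> {i. h i \<in> u} w)"
proof (induction rule: dfn.induct)
  case (dfn_mem t)
  then show ?case using dfn.dfn_mem[OF fn_comp[OF assms]] by simp
next
  case (dfn_acc \<phi> t)
  from dfn.dfn_acc[OF dfn_acc.IH dfn_acc.hyps(2)] show ?case .
qed (auto intro: dfn.intros)

lemma not_accp_iff: "\<not> acc_part R v \<longleftrightarrow> (\<exists>f. f 0 = v \<and> (\<forall>i. R (f (Suc i)) (f i)))"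
proof
  assume v: "\<not> acc_part R v"
  have nxt: "\<exists>y. \<not> acc_part R y \<and> R y x" if "\<not> acc_part R x" for x
    by (rule not_accp_down[OF that]) blast
  obtain f where "f 0 = v" "\<And>n. \<not> acc_part R (f n)" "\<And>n. R (f (Suc n)) (f n)"
    by (rule dependent_choice_from[of "\<lambda>_ x. \<not> acc_part R x" v "\<lambda>_ x y. R y x", OF v nxt]) (assumption, rule that)
  then show "\<exists>f. f 0 = v \<and> (\<forall>i. R (f (Suc i)) (f i))" by blast
next
  assume "\<exists>f. f 0 = v \<and> (\<forall>i. R (f (Suc i)) (f i))"
  then obtain f where f: "f 0 = v" "\<And>i. R (f (Suc i)) (f i)" by blast
  have "x \<notin> range f" if "acc_part R x" for x
    using that by (induction rule: accp.induct) (use f in blast)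
  then show "\<not> acc_part R v" using f(1) by blast
qed

lemma dfn_accp:
  assumes "dfn (\<lambda>x w. \<phi> x (p1 (p2 w)) (p2 (p2 w)) (p1 w))" "fn t"
  shows "dfn (\<lambda>x w. acc_part (\<lambda>a b. \<phi> x a b w) (t w))"
  using dfn_acc[OF assms] by simp

text \<open>When the relation ignores its second argument, one witness repeated forever is an
  infinite descending path.\<close>

lemma dfn_ex:
  assumes "dfn (\<lambda>x w. \<phi> x (p2 w) (p1 w))"
  shows "dfn (\<lambda>x w. \<exists>k. \<phi> x k w)"
proof -
  have "(\<exists>k. \<phi> x k w) \<longleftrightarrow> \<not> acc_part (\<lambda>a b. \<phi> x a w) 0" for x w
  proof -
    have "\<exists>f :: nat \<Rightarrow> nat. f 0 = 0 \<and> (\<forall>i. \<phi> x (f (Suc i)) w)" if "\<phi> x k w" for k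
      using that by (intro exI[of _ "\<lambda>i. if i = 0 then 0 else k"]) auto
    then show ?thesis unfolding not_accp_iff by blast
  qed
  moreover have "dfn (\<lambda>x w. acc_part (\<lambda>a b. \<phi> x a w) 0)"
  proof (rule dfn_accp)
    show "dfn (\<lambda>x w. \<phi> x (p1 (p2 w)) (p1 w))"
      using dfn_subst[OF assms, of "\<lambda>w. pr (p1 w) (p1 (p2 w))"] by (simp add: fn.intros)
  qed (rule fn_zero)
  ultimately show ?thesis by (simp add: dfn_not)
qed

lemma dfn_disj:
  assumes "dfn \<phi>" "dfn \<psi>"
  shows "dfn (\<lambda>x w. \<phi> x w \<or> \<psi> x w)"
proof -
  have "dfn (\<lambda>x w. \<not> (\<not> \<phi> x w \<and> \<not> \<psi> x w))" by (intro dfn_not dfn_conj assms)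
  then show ?thesis by simp
qed

lemma dfn_imp:
  assumes "dfn \<phi>" "dfn \<psi>"
  shows "dfn (\<lambda>x w. \<phi> x w \<longrightarrow> \<psi> x w)"
  unfolding imp_conv_disj by (intro dfn_not dfn_disj assms)

lemma dfn_iff:
  assumes "dfn \<phi>" "dfn \<psi>"
  shows "dfn (\<lambda>x w. \<phi> x w \<longleftrightarrow> \<psi> x w)"
  unfolding iff_conv_conj_imp by (intro dfn_imp dfn_conj assms)

lemma dfn_all:
  assumes "dfn (\<lambda>x w. \<phi> x (p2 w) (p1 w))"
  shows "dfn (\<lambda>x w. \<forall>k. \<phi> x k w)"
  using dfn_not[OF dfn_ex[of "\<lambda>x k w. \<not> \<phi> x k w", OF dfn_not[OF assms]]] by simp

lemma dfn_const: "dfn (\<lambda>x w. P)"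
proof (cases P)
  case True
  then show ?thesis using dfn_eq[OF fn_zero fn_zero] by simp
next
  case False
  then show ?thesis using dfn_not[OF dfn_eq[OF fn_zero fn_zero]] by simp
qed

lemma dfn_fin_conj: "finite I \<Longrightarrow> (\<And>i. i \<in> I \<Longrightarrow> dfn (\<phi> i)) \<Longrightarrow> dfn (\<lambda>x w. \<forall>i\<in>I. \<phi> i x w)"
  by (induction I rule: finite_induct) (simp_all add: dfn_const dfn_conj)

lemma dfn_fin_disj: "finite I \<Longrightarrow> (\<And>i. i \<in> I \<Longrightarrow> dfn (\<phi> i)) \<Longrightarrow> dfn (\<lambda>x w. \<exists>i\<in>I. \<phi> i x w)"
  by (induction I rule: finite_induct) (simp_all add: dfn_const dfn_disj)

lemmas dfn_logic = dfn_ex dfn_all dfn_not dfn_conj dfn_disj dfn_imp dfn_iff dfn_eq fn.intros fn_const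

lemma dfn2:
  assumes "dfn (\<lambda>x w. R x (p1 w) (p2 w))" "fn t" "fn u"
  shows "dfn (\<lambda>x w. R x (t w) (u w))"
  using dfn_subst[OF assms(1) fn_pr[OF assms(2,3)]] by simp

lemma dfn3:
  assumes "dfn (\<lambda>x w. R x (p1 w) (p1 (p2 w)) (p2 (p2 w)))" "fn t" "fn u" "fn v"
  shows "dfn (\<lambda>x w. R x (t w) (u w) (v w))"
  using dfn_subst[OF assms(1) fn_pr[OF assms(2) fn_pr[OF assms(3,4)]]] by simp

section \<open>Order and list membership as accessibility\<close>

lemma descent_meets:
  fixes f :: "nat \<Rightarrow> nat"
  assumes "\<And>i. f (Suc i) < f i \<or> Q (f i)"
  shows "\<exists>i. Q (f i)"
proof (rule ccontr)
  assume "\<nexists>i. Q (f i)"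
  then have dec: "f (Suc i) < f i" for i using assms by blast
  have "f i + i \<le> f 0" for i
  proof (induction i)
    case (Suc i)
    then show ?case using dec[of i] by linarith
  qed simp
  from this[of "Suc (f 0)"] show False by simp
qed

text \<open>The path descends from \<open>b\<close> by ones; only the loop at \<open>a\<close> can
  make it infinite.\<close>

lemma le_iff_accp:
  "a \<le> b \<longleftrightarrow> \<not> acc_part (\<lambda>c d. d = Suc c \<or> (d = a \<and> c = a)) b"
  unfolding not_accp_iff
proof
  assume "a \<le> b"
  then show "\<exists>f. f 0 = b \<and> (\<forall>i. f i = Suc (f (Suc i)) \<or> f i = a \<and> f (Suc i) = a)"
    by (intro exI[of _ "\<lambda>i. max a (b - i)"]) auto
next
  assume "\<exists>f. f 0 = b \<and> (\<forall>i. f i = Suc (f (Suc i)) \<or> f i = a \<and> f (Suc i) = a)"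
  then obtain f where f: "f 0 = b" "\<And>i. f i = Suc (f (Suc i)) \<or> f i = a \<and> f (Suc i) = a" by blast
  have dec: "f i \<le> b" for i by (induction i) (use f in \<open>auto, metis Suc_leD\<close>)
  obtain i where "f i = a" using descent_meets[of f "\<lambda>c. c = a"] f(2) by (metis lessI)
  then show "a \<le> b" using dec by metis
qed

lemma dfn_le:
  assumes "fn t" "fn u"
  shows "dfn (\<lambda>x w. t w \<le> u w)"
  unfolding le_iff_accp by (intro dfn_logic dfn_accp fn_comp[OF assms(1)] fn_comp[OF assms(2)] assms)

definition lmem :: "nat \<Rightarrow> nat \<Rightarrow> bool" where
  "lmem m L \<longleftrightarrow> m \<in> set (list_decode L)"

definition lcons :: "nat \<Rightarrow> nat \<Rightarrow> nat" where
  "lcons m L = Suc (pr m L)"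

lemma lmem_simps [simp]: "\<not> lmem m 0" "lmem m (lcons n L) \<longleftrightarrow> m = n \<or> lmem m L"
  by (auto simp: lmem_def lcons_def pr_def)

lemma lcons_cases: obtains "L = 0" | m L' where "L = lcons m L'" "L' < L"
proof (cases L)
  case (Suc n)
  have "p2 n \<le> n" using le_prod_encode_2[of "p2 n" "p1 n"] pr_simps(3)[of n] by (simp add: pr_def)
  then show ?thesis using that(2)[of "p1 n" "p2 n"] Suc by (simp add: lcons_def)
qed (use that in blast)

lemma lcons_inject [simp]: "lcons m L = lcons m' L' \<longleftrightarrow> m = m' \<and> L = L'" "lcons m L \<noteq> 0"
  by (simp_all add: lcons_def)

lemma lcons_gt: "L < lcons m L"
  using le_prod_encode_2[of L m] by (simp add: lcons_def pr_def)

lemma fn_lcons: "fn t \<Longrightarrow> fn u \<Longrightarrow> fn (\<lambda>w. lcons (t w) (u w))"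
  unfolding lcons_def by (intro fn.intros)

text \<open>The path removes heads from the list and becomes infinite only by staying at a list with
  head \<open>m\<close>.\<close>

lemma lmem_iff_accp:
  "lmem m L \<longleftrightarrow> \<not> acc_part (\<lambda>a b. (\<exists>k. b = lcons k a) \<or> (a = b \<and> (\<exists>c. b = lcons m c))) L"
  unfolding not_accp_iff
proof
  show "\<exists>f. f 0 = L \<and> (\<forall>i. (\<exists>k. f i = lcons k (f (Suc i))) \<or> f (Suc i) = f i \<and> (\<exists>c. f i = lcons m c))" if "lmem m L"
    using that
  proof (induction L rule: less_induct)
    case (less L)
    then obtain n L' where L: "L = lcons n L'" "L' < L" using lcons_cases[of L] by (metis lmem_simps(1))
    show ?case
    proof (cases "n = m")
      case True
      then show ?thesis using L by (intro exI[of _ "\<lambda>i. L"]) auto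
    next
      case False
      then have "lmem m L'" using less.prems L by auto
      then obtain f where "f 0 = L'" "\<forall>i. (\<exists>k. f i = lcons k (f (Suc i))) \<or> f (Suc i) = f i \<and> (\<exists>c. f i = lcons m c)"
        using less.IH[OF L(2)] by blast
      then show ?thesis using L by (intro exI[of _ "\<lambda>i. case i of 0 \<Rightarrow> L | Suc i \<Rightarrow> f i"]) (auto split: nat.split)
    qed
  qed
next
  assume "\<exists>f. f 0 = L \<and> (\<forall>i. (\<exists>k. f i = lcons k (f (Suc i))) \<or> f (Suc i) = f i \<and> (\<exists>c. f i = lcons m c))"
  then obtain f where f: "f 0 = L" "\<And>i. (\<exists>k. f i = lcons k (f (Suc i))) \<or> f (Suc i) = f i \<and> (\<exists>c. f i = lcons m c)" by blast
  have "f (Suc i) < f i \<or> (\<exists>c. f i = lcons m c)" for i using f(2)[of i] lcons_gt by metis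
  then obtain i c where i: "f i = lcons m c" using descent_meets[of f "\<lambda>d. \<exists>c. d = lcons m c"] by blast
  have "lmem m (f (i - j))" for j
  proof (induction j)
    case 0
    then show ?case using i by simp
  next
    case (Suc j)
    show ?case
    proof (cases "j < i")
      case True
      then have e: "i - j = Suc (i - Suc j)" by simp
      then show ?thesis using f(2)[of "i - Suc j"] Suc by (auto simp: e)
    next
      case False
      then show ?thesis using Suc by simp
    qed
  qed
  from this[of i] show "lmem m L" using f(1) by simp
qed

lemma dfn_lmem:
  assumes "fn t" "fn u"
  shows "dfn (\<lambda>x w. lmem (t w) (u w))"
  unfolding lmem_iff_accp
  by (intro dfn_logic dfn_accp fn_lcons fn_comp[OF assms(1)] fn_comp[OF assms(2)] assms)

text \<open>Read \<open>\<theta> c a\<close> as: the rule instance \<open>a\<close> has conclusion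
  \<open>c\<close>; and \<open>\<eta> a b\<close> as: \<open>b\<close> is one of its possibly
  infinitely many premises.\<close>

inductive gm :: "(nat \<Rightarrow> nat \<Rightarrow> bool) \<Rightarrow> (nat \<Rightarrow> nat \<Rightarrow> bool) \<Rightarrow> nat \<Rightarrow> bool" for \<theta> \<eta> where
  "\<theta> c a \<Longrightarrow> (\<And>b. \<eta> a b \<Longrightarrow> gm \<theta> \<eta> b) \<Longrightarrow> gm \<theta> \<eta> c"

text \<open>The list \<open>L\<close> is an initial part of a function \<open>f\<close>: the set of all \<open>c\<close> with
  \<open>p1 (f c) = 0\<close> contains \<open>c\<^sub>0\<close> and avoids the inductively defined set, as witnessed by the choices
  \<open>p2 (f a)\<close> among the premises of the rule instances \<open>a\<close>.\<close>

definition gm_ok :: "(nat \<Rightarrow> nat \<Rightarrow> bool) \<Rightarrow> (nat \<Rightarrow> nat \<Rightarrow> bool) \<Rightarrow> nat \<Rightarrow> nat \<Rightarrow> bool" where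
  "gm_ok \<theta> \<eta> c\<^sub>0 L \<longleftrightarrow> (\<forall>v. lmem (pr c\<^sub>0 v) L \<longrightarrow> p1 v = 0) \<and>
     (\<forall>c a v u. lmem (pr c v) L \<and> p1 v = 0 \<and> \<theta> c a \<and> lmem (pr a u) L \<longrightarrow>
        \<eta> a (p2 u) \<and> (\<forall>v'. lmem (pr (p2 u) v') L \<longrightarrow> p1 v' = 0))"

text \<open>A state is a list with its length; a step adds the value at the next argument, so an
  infinite path is a total function.\<close>

definition gm_step :: "(nat \<Rightarrow> nat \<Rightarrow> bool) \<Rightarrow> (nat \<Rightarrow> nat \<Rightarrow> bool) \<Rightarrow> nat \<Rightarrow> nat \<Rightarrow> nat \<Rightarrow> bool" where
  "gm_step \<theta> \<eta> c\<^sub>0 s' s \<longleftrightarrow> (\<exists>v. s' = pr (lcons (pr (p2 s) v) (p1 s)) (Suc (p2 s))) \<and> gm_ok \<theta> \<eta> c\<^sub>0 (p1 s')"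

text \<open>A point is outside the inductively defined set iff it belongs to some set in which each
  rule instance with conclusion in the set has a premise in the set. This asks for one function,
  which exists iff the tree of its finite approximations has an infinite path.\<close>

lemma gm_iff_accp: "gm \<theta> \<eta> c\<^sub>0 \<longleftrightarrow> acc_part (gm_step \<theta> \<eta> c\<^sub>0) (pr 0 0)"
proof -
  have "\<not> gm \<theta> \<eta> c\<^sub>0 \<longleftrightarrow> \<not> acc_part (gm_step \<theta> \<eta> c\<^sub>0) (pr 0 0)"
    unfolding not_accp_iff
  proof
    assume c0: "\<not> gm \<theta> \<eta> c\<^sub>0"
    define F where "F m = pr (if gm \<theta> \<eta> m then 1 else 0) (SOME b. \<eta> m b \<and> \<not> gm \<theta> \<eta> b)" for m
    define L where "L = rec_nat 0 (\<lambda>i L. lcons (pr i (F i)) L)"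
    have L: "L 0 = 0" "L (Suc i) = lcons (pr i (F i)) (L i)" for i by (simp_all add: L_def)
    have mem: "lmem (pr c v) (L i) \<longleftrightarrow> c < i \<and> v = F c" for c v i
      by (induction i) (auto simp: L less_Suc_eq)
    have F1: "p1 (F c) = 0 \<longleftrightarrow> \<not> gm \<theta> \<eta> c" for c by (simp add: F_def)
    have F2: "\<eta> a (p2 (F a)) \<and> \<not> gm \<theta> \<eta> (p2 (F a))" if "\<not> gm \<theta> \<eta> c" "\<theta> c a" for c a
    proof -
      have "\<exists>b. \<eta> a b \<and> \<not> gm \<theta> \<eta> b" using that gm.intros by metis
      then show ?thesis unfolding F_def pr_simps by (rule someI_ex)
    qed
    have ok: "gm_ok \<theta> \<eta> c\<^sub>0 (L i)" for i
      unfolding gm_ok_def mem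
    proof (intro conjI allI impI)
      fix v assume "c\<^sub>0 < i \<and> v = F c\<^sub>0" then show "p1 v = 0" using F1 c0 by simp
    next
      fix c a v u assume *: "(c < i \<and> v = F c) \<and> p1 v = 0 \<and> \<theta> c a \<and> a < i \<and> u = F a"
      then have "\<not> gm \<theta> \<eta> c" using F1 by auto
      then have **: "\<eta> a (p2 (F a)) \<and> \<not> gm \<theta> \<eta> (p2 (F a))" using F2 * by simp
      then show "\<eta> a (p2 u)" using * by simp
      fix v' assume "p2 u < i \<and> v' = F (p2 u)"
      then show "p1 v' = 0" using ** * F1 by simp
    qed
    have "gm_ok \<theta> \<eta> c\<^sub>0 (lcons (pr i (F i)) (L i))" for i using ok[of "Suc i"] by (simp add: L)
    then show "\<exists>f. f 0 = pr 0 0 \<and> (\<forall>i. gm_step \<theta> \<eta> c\<^sub>0 (f (Suc i)) (f i))"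
      by (intro exI[of _ "\<lambda>i. pr (L i) i"]) (auto simp: gm_step_def L)
  next
    assume "\<exists>f. f 0 = pr 0 0 \<and> (\<forall>i. gm_step \<theta> \<eta> c\<^sub>0 (f (Suc i)) (f i))"
    then obtain f where f: "f 0 = pr 0 0" "\<And>i. gm_step \<theta> \<eta> c\<^sub>0 (f (Suc i)) (f i)" by blast
    have "\<exists>v. f (Suc i) = pr (lcons (pr (p2 (f i)) v) (p1 (f i))) (Suc (p2 (f i)))" for i
      using f(2)[of i] by (simp add: gm_step_def)
    then obtain F where F: "\<And>i. f (Suc i) = pr (lcons (pr (p2 (f i)) (F i)) (p1 (f i))) (Suc (p2 (f i)))" by metis
    have i: "p2 (f i) = i" for i by (induction i) (simp_all add: f F)
    have mem: "lmem (pr c v) (p1 (f i)) \<longleftrightarrow> c < i \<and> v = F c" for c v i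
      by (induction i) (auto simp: f F i less_Suc_eq)
    have ok: "gm_ok \<theta> \<eta> c\<^sub>0 (p1 (f (Suc i)))" for i using f(2)[of i] by (simp add: gm_step_def)
    have "p1 (F c) \<noteq> 0" if "gm \<theta> \<eta> c" for c
      using that
    proof (induction rule: gm.induct)
      case (1 c a)
      show ?case
      proof
        assume "p1 (F c) = 0"
        \<comment> \<open>Wait until the three values involved in this instance are on the
          list.\<close>
        moreover obtain n where "c < Suc n" "a < Suc n" "p2 (F a) < Suc n"
          using that[of "c + a + p2 (F a)"] by simp
        ultimately have "\<eta> a (p2 (F a)) \<and> p1 (F (p2 (F a))) = 0"
          using ok[of n, unfolded gm_ok_def mem, THEN conjunct2, rule_format, of c "F c" a "F a"] 1(1) by auto
        then show False using 1 by blast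
      qed
    qed
    moreover have "p1 (F c\<^sub>0) = 0" using ok[of c\<^sub>0, unfolded gm_ok_def mem] by simp
    ultimately show "\<not> gm \<theta> \<eta> c\<^sub>0" by blast
  qed
  then show ?thesis by blast
qed

lemma dfn_gm:
  assumes \<theta>: "dfn (\<lambda>x w. \<theta> x (p1 (p2 w)) (p2 (p2 w)) (p1 w))"
    and \<eta>: "dfn (\<lambda>x w. \<eta> x (p1 (p2 w)) (p2 (p2 w)) (p1 w))" and t: "fn t"
  shows "dfn (\<lambda>x w. gm (\<lambda>c a. \<theta> x c a w) (\<lambda>a b. \<eta> x a b w) (t w))"
proof -
  have \<theta>': "dfn (\<lambda>x w. \<theta> x (c w) (a w) (v w))" if "fn c" "fn a" "fn v" for c a v
    using dfn_subst[OF \<theta>, of "\<lambda>w. pr (v w) (pr (c w) (a w))"] that by (simp add: fn.intros)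
  have \<eta>': "dfn (\<lambda>x w. \<eta> x (c w) (a w) (v w))" if "fn c" "fn a" "fn v" for c a v
    using dfn_subst[OF \<eta>, of "\<lambda>w. pr (v w) (pr (c w) (a w))"] that by (simp add: fn.intros)
  show ?thesis
    unfolding gm_iff_accp gm_step_def gm_ok_def
    by (intro dfn_logic dfn_accp dfn_lmem fn_lcons \<theta>' \<eta>' fn_comp[OF t])
qed

section \<open>Definability of halting\<close>

fun reg_bound :: "nat \<Rightarrow> instr \<Rightarrow> bool" where
  "reg_bound N (Zero n) \<longleftrightarrow> Suc n < N"
| "reg_bound N (Succ n) \<longleftrightarrow> Suc n < N"
| "reg_bound N (Oracle n) \<longleftrightarrow> Suc n < N"
| "reg_bound N (Transfer m n) \<longleftrightarrow> Suc m < N \<and> Suc n < N"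
| "reg_bound N (Jump m n q) \<longleftrightarrow> Suc m < N \<and> Suc n < N"

lemma reg_bound_mono: "reg_bound N I \<Longrightarrow> N \<le> N' \<Longrightarrow> reg_bound N' I"
  by (cases I) auto

lemma ex_reg_bound: "\<exists>N\<ge>2. \<forall>I\<in>set P. reg_bound N I"
proof (induction P)
  case (Cons I P)
  then obtain N where N: "N \<ge> 2" "\<forall>I\<in>set P. reg_bound N I" by blast
  obtain N' where "reg_bound N' I"
  proof (cases I)
    case (Zero n) then show ?thesis using that[of "n + 2"] by simp
  next
    case (Succ n) then show ?thesis using that[of "n + 2"] by simp
  next
    case (Oracle n) then show ?thesis using that[of "n + 2"] by simp
  next
    case (Transfer m n) then show ?thesis using that[of "m + n + 2"] by simp
  next
    case (Jump m n q) then show ?thesis using that[of "m + n + 2"] by simp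
  qed
  then show ?case using N reg_bound_mono[of N' I "max N N'"] reg_bound_mono[of N _ "max N N'"]
    by (intro exI[of _ "max N N'"]) auto
qed auto

lemma vexec_nth:
  "vexec A I v j = (case I of
     Zero n \<Rightarrow> if j = 0 then Suc (v 0) else if j = Suc n then 0 else v j
   | Succ n \<Rightarrow> if j = 0 then Suc (v 0) else if j = Suc n then Suc (v j) else v j
   | Oracle n \<Rightarrow> if j = 0 then Suc (v 0) else if j = Suc n then (if v j \<in> A then 1 else 0) else v j
   | Transfer m n \<Rightarrow> if j = 0 then Suc (v 0) else if j = Suc n then v (Suc m) else v j
   | Jump m n q \<Rightarrow> if j = 0 then (if v (Suc m) = v (Suc n) then q else Suc (v 0)) else v j)"
  by (cases I; cases j) (auto simp: vexec_def)

text \<open>Vectors are coded by nested pairs. Codes are not unique, so vectors are compared through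
  their coordinates.\<close>

definition tv :: "nat \<Rightarrow> nat \<Rightarrow> vec" where
  "tv N e j = (if j < N then p2 ((p1 ^^ j) e) else 0)"

lemma tv_surj: "(\<And>j. N \<le> j \<Longrightarrow> v j = 0) \<Longrightarrow> \<exists>e. tv N e = v"
proof (induction N arbitrary: v)
  case 0
  then show ?case by (auto simp: tv_def fun_eq_iff)
next
  case (Suc N)
  obtain e where e: "tv N e = (\<lambda>j. v (Suc j))" using Suc.IH[of "\<lambda>j. v (Suc j)"] Suc.prems by auto
  have "tv (Suc N) (pr e (v 0)) j = v j" for j
  proof (cases j)
    case (Suc k)
    have "tv N e k = v (Suc k)" using e by simp
    then show ?thesis using Suc by (simp add: tv_def funpow_swap1 del: funpow.simps(2)) (auto simp: funpow_Suc_right split: if_splits simp del: funpow.simps)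
  qed (simp add: tv_def)
  then show ?case by blast
qed

lemma fn_tv: "fn t \<Longrightarrow> fn (\<lambda>w. tv N (t w) j)"
proof -
  assume t: "fn t"
  have "fn (\<lambda>w. (p1 ^^ j) (t w))" by (induction j) (auto intro: fn.intros t)
  then show ?thesis by (cases "j < N") (auto simp: tv_def intro: fn.intros)
qed

lemma dfn_eq_if:
  assumes "dfn \<phi>" "dfn (\<lambda>x w. t w = u x w)" "dfn (\<lambda>x w. t w = v x w)"
  shows "dfn (\<lambda>x w. t w = (if \<phi> x w then u x w else v x w))"
proof -
  have "(t w = (if \<phi> x w then u x w else v x w)) \<longleftrightarrow> (\<phi> x w \<and> t w = u x w) \<or> (\<not> \<phi> x w \<and> t w = v x w)" for x w
    by auto
  then show ?thesis using assms by (simp add: dfn_disj dfn_conj dfn_not)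
qed

lemma dfn_vexec:
  assumes "fn a" "fn b"
  shows "dfn (\<lambda>x w. b w = vexec x I (tv N (a w)) j)"
proof -
  note i = dfn_eq fn_tv fn.intros fn_const assms dfn_eq_if dfn_mem
  show ?thesis
  proof (cases I)
    case (Zero n)
    then show ?thesis unfolding vexec_nth by (cases "j = 0"; cases "j = Suc n") (auto intro!: i)
  next
    case (Succ n)
    then show ?thesis unfolding vexec_nth by (cases "j = 0"; cases "j = Suc n") (auto intro!: i)
  next
    case (Oracle n)
    have "dfn (\<lambda>x w. b w = (if tv N (a w) j \<in> x then 1 else 0))" by (intro i)
    then show ?thesis using Oracle unfolding vexec_nth by (cases "j = 0"; cases "j = Suc n") (auto intro!: i)
  next
    case (Transfer m n)
    then show ?thesis unfolding vexec_nth by (cases "j = 0"; cases "j = Suc n") (auto intro!: i)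
  next
    case (Jump m n q)
    have "dfn (\<lambda>x w. b w = (if tv N (a w) (Suc m) = tv N (a w) (Suc n) then q else Suc (tv N (a w) 0)))" by (intro i)
    then show ?thesis using Jump unfolding vexec_nth by (cases "j = 0") (auto intro!: i)
  qed
qed

section \<open>Regrouping the segments of a limit\<close>

definition smin :: "(nat \<Rightarrow> vec) \<Rightarrow> nat \<Rightarrow> nat \<Rightarrow> vec" where
  "smin Ms a b j = Inf ((\<lambda>l. Ms l j) ` {a..<b})"

lemma smin_le_iff: "a < b \<Longrightarrow> smin Ms a b j \<le> y \<longleftrightarrow> (\<exists>l. a \<le> l \<and> l < b \<and> Ms l j \<le> y)"
  unfolding smin_def by (subst Inf_nat_image_le_iff) auto

lemma le_smin_iff:
  assumes "a < b"
  shows "y \<le> smin Ms a b j \<longleftrightarrow> (\<forall>l. a \<le> l \<and> l < b \<longrightarrow> y \<le> Ms l j)"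
proof -
  have "smin Ms a b j \<le> y - 1 \<longleftrightarrow> (\<exists>l. a \<le> l \<and> l < b \<and> Ms l j \<le> y - 1)" by (rule smin_le_iff[OF assms])
  then show ?thesis by (cases y) (auto simp: not_le[symmetric] Suc_le_eq simp del: not_le)
qed

lemma smin_single: "smin Ms a (Suc a) = Ms a"
  by (rule ext) (simp add: smin_def)

lemma smin_append: "a < b \<Longrightarrow> b < c \<Longrightarrow> smin Ms a c = vmin (smin Ms a b) (smin Ms b c)"
proof (rule ext)
  fix j assume ab: "a < b" "b < c"
  have "(\<exists>l. a \<le> l \<and> l < c \<and> Ms l j \<le> y) \<longleftrightarrow> (\<exists>l. a \<le> l \<and> l < b \<and> Ms l j \<le> y) \<or> (\<exists>l. b \<le> l \<and> l < c \<and> Ms l j \<le> y)" for y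
  proof
    assume "\<exists>l. a \<le> l \<and> l < c \<and> Ms l j \<le> y"
    then obtain l where "a \<le> l" "l < c" "Ms l j \<le> y" by blast
    then show "(\<exists>l. a \<le> l \<and> l < b \<and> Ms l j \<le> y) \<or> (\<exists>l. b \<le> l \<and> l < c \<and> Ms l j \<le> y)" by (cases "l < b") auto
  next
    assume "(\<exists>l. a \<le> l \<and> l < b \<and> Ms l j \<le> y) \<or> (\<exists>l. b \<le> l \<and> l < c \<and> Ms l j \<le> y)"
    then show "\<exists>l. a \<le> l \<and> l < c \<and> Ms l j \<le> y" using ab by (elim disjE exE conjE) (rule exI, rule conjI[rotated], rule conjI[rotated], assumption, simp, simp)+
  qed
  then show "smin Ms a c j = min (smin Ms a b j) (smin Ms b c j)"
    using ab by (intro nat_eq_by_le) (simp add: min_le_iff_disj smin_le_iff)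
qed

lemma limn_props:
  assumes "\<not> diverges f"
  shows "\<exists>n0. \<forall>l\<ge>n0. limn f \<le> f l" "\<exists>l\<ge>n. f l \<le> limn f"
proof -
  let ?Q = "\<lambda>b. \<exists>\<^sub>\<infinity>i. f i \<le> b"
  have ex: "\<exists>b. ?Q b" and l: "limn f = (LEAST b. ?Q b)" using assms by (auto simp: diverges_def limn_def)
  have "?Q (limn f)" unfolding l using ex by (rule LeastI_ex)
  then show "\<exists>l\<ge>n. f l \<le> limn f" unfolding INFM_nat_le by blast
  show "\<exists>n0. \<forall>l\<ge>n0. limn f \<le> f l"
  proof (cases "limn f")
    case (Suc b)
    then have "\<not> ?Q b" using not_less_Least[of b ?Q] l by simp
    then obtain m where "\<forall>n\<ge>m. \<not> f n \<le> b" unfolding INFM_nat_le by blast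
    then show ?thesis using Suc by (intro exI[of _ m]) auto
  qed auto
qed

lemma diverges_ev: "diverges f \<Longrightarrow> \<exists>n0. \<forall>l\<ge>n0. b \<le> f l"
  unfolding diverges_def INFM_nat_le by (metis linorder_not_le nle_le)

lemma finite_bound:
  assumes "\<And>j. \<exists>n0 :: nat. \<forall>l\<ge>n0. Q l j"
  shows "\<exists>n0\<ge>a. \<forall>l\<ge>n0. \<forall>j<(N::nat). Q l j"
proof (induction N)
  case (Suc N)
  then obtain n0 where 0: "n0 \<ge> a" "\<forall>l\<ge>n0. \<forall>j<N. Q l j" by blast
  obtain n1 where 1: "\<forall>l\<ge>n1. Q l N" using assms by blast
  show ?case using 0 1 by (intro exI[of _ "max n0 n1"]) (auto simp: less_Suc_eq)
qed auto

text \<open>As only \<open>N\<close> coordinates matter, one can wait for all of them at once: from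
  \<open>n0\<close> on no coordinate outside \<open>T\<close> is below its limit inferior, each
  block is long enough to attain it, and on \<open>T\<close> the blocks rise beyond every
  bound.\<close>

lemma regroup:
  fixes Ms :: "nat \<Rightarrow> vec"
  assumes z: "\<And>i j. N \<le> j \<Longrightarrow> Ms i j = 0"
  defines "T \<equiv> {j. diverges (\<lambda>i. Ms i j)}" and "d \<equiv> \<lambda>j. limn (\<lambda>i. Ms i j)"
  obtains k where "1 \<le> k 0" "\<And>i. k i < k (Suc i)"
    "\<And>i j. j \<notin> T \<Longrightarrow> smin Ms (k i) (k (Suc i)) j = d j"
    "\<And>i j. j \<in> T \<Longrightarrow> i \<le> smin Ms (k i) (k (Suc i)) j"
    "\<And>l j. k 0 \<le> l \<Longrightarrow> smin Ms (k 0) (k 1) j \<le> Ms l j"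
    "\<And>l j. j \<in> T \<Longrightarrow> k 0 \<le> l \<Longrightarrow> 1 \<le> Ms l j"
proof -
  have d0: "d j = 0" "j \<notin> T" if "N \<le> j" for j using z[OF that] by (simp_all add: d_def T_def)
  have "\<exists>n0. \<forall>l\<ge>n0. (j \<notin> T \<longrightarrow> d j \<le> Ms l j) \<and> (j \<in> T \<longrightarrow> 1 \<le> Ms l j)" for j
  proof (cases "j \<in> T")
    case True
    then show ?thesis using diverges_ev[of "\<lambda>i. Ms i j" 1] by (simp add: T_def)
  next
    case False
    then show ?thesis using limn_props(1)[of "\<lambda>i. Ms i j"] by (simp add: T_def d_def)
  qed
  from finite_bound[of "\<lambda>l j. (j \<notin> T \<longrightarrow> d j \<le> Ms l j) \<and> (j \<in> T \<longrightarrow> 1 \<le> Ms l j)", OF this, of 1 N]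
  obtain n0 where n0: "1 \<le> n0" "\<And>l j. n0 \<le> l \<Longrightarrow> j < N \<Longrightarrow> (j \<notin> T \<longrightarrow> d j \<le> Ms l j) \<and> (j \<in> T \<longrightarrow> 1 \<le> Ms l j)"
    by blast
  have n0d: "d j \<le> Ms l j" if "n0 \<le> l" "j \<notin> T" for l j using n0(2)[OF that(1), of j] d0[of j] that(2) by (cases "j < N") auto
  have n0T: "1 \<le> Ms l j" if "n0 \<le> l" "j \<in> T" for l j using n0(2)[OF that(1), of j] d0[of j] that(2) by (cases "j < N") auto
  have step: "\<exists>n>a. (\<forall>j. j \<notin> T \<longrightarrow> (\<exists>l. a \<le> l \<and> l < n \<and> Ms l j \<le> d j)) \<and> (\<forall>l\<ge>n. \<forall>j\<in>T. b j \<le> Ms l j)" for a b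
  proof -
    have "\<exists>n1. \<forall>n\<ge>n1. (j \<notin> T \<longrightarrow> (\<exists>l. a \<le> l \<and> l < n \<and> Ms l j \<le> d j)) \<and> (j \<in> T \<longrightarrow> (\<forall>l\<ge>n. b j \<le> Ms l j))" for j
    proof (cases "j \<in> T")
      case True
      then obtain n1 where "\<forall>l\<ge>n1. b j \<le> Ms l j" using diverges_ev unfolding T_def by blast
      then show ?thesis using True by (intro exI[of _ n1]) auto
    next
      case False
      then obtain l where "a \<le> l" "Ms l j \<le> d j" using limn_props(2)[of "\<lambda>i. Ms i j" a] unfolding T_def d_def by blast
      then show ?thesis using False by (intro exI[of _ "Suc l"]) auto
    qed
    from finite_bound[of "\<lambda>n j. (j \<notin> T \<longrightarrow> (\<exists>l. a \<le> l \<and> l < n \<and> Ms l j \<le> d j)) \<and> (j \<in> T \<longrightarrow> (\<forall>l\<ge>n. b j \<le> Ms l j))", OF this, of "Suc a" N]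
    obtain n where n: "Suc a \<le> n" "\<And>j. j < N \<Longrightarrow> (j \<notin> T \<longrightarrow> (\<exists>l. a \<le> l \<and> l < n \<and> Ms l j \<le> d j)) \<and> (j \<in> T \<longrightarrow> (\<forall>l\<ge>n. b j \<le> Ms l j))"
      by blast
    have "\<exists>l. a \<le> l \<and> l < n \<and> Ms l j \<le> d j" if "j \<notin> T" for j
      using n(2)[of j] that z[of j a] n(1) by (cases "j < N") (auto intro!: exI[of _ a])
    moreover have "b j \<le> Ms l j" if "j \<in> T" "n \<le> l" for j l using n(2)[of j] d0[of j] that by (cases "j < N") auto
    ultimately show ?thesis using n(1) by (intro exI[of _ n]) auto
  qed
  \<comment> \<open>The summand \<open>Ms n0 j\<close> keeps all later blocks at or above a value in
    the first one, so that the first block attains the minimum of the whole tail.\<close>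
  let ?Q = "\<lambda>i a n. a < n \<and> (\<forall>j. j \<notin> T \<longrightarrow> (\<exists>l. a \<le> l \<and> l < n \<and> Ms l j \<le> d j)) \<and>
    (\<forall>l\<ge>n. \<forall>j\<in>T. Suc i + Ms n0 j \<le> Ms l j)"
  have nxt: "\<exists>n. n0 \<le> n \<and> ?Q i a n" if "n0 \<le> a" for i a
    using step[of a "\<lambda>j. Suc i + Ms n0 j"] that by (auto dest: le_less_trans less_imp_le)
  obtain k where kk: "k 0 = n0" "\<And>i. n0 \<le> k i" "\<And>i. ?Q i (k i) (k (Suc i))"
    by (rule dependent_choice_from[of "\<lambda>_ a. n0 \<le> a" n0 ?Q, OF order_refl nxt]) (assumption, rule that)
  have k: "\<And>i. n0 \<le> k i" "k 0 = n0" "\<And>i. k i < k (Suc i)"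
    "\<And>i j. j \<notin> T \<Longrightarrow> \<exists>l. k i \<le> l \<and> l < k (Suc i) \<and> Ms l j \<le> d j"
    "\<And>i l j. k (Suc i) \<le> l \<Longrightarrow> j \<in> T \<Longrightarrow> Suc i + Ms n0 j \<le> Ms l j" using kk by blast+
  have eq: "smin Ms (k i) (k (Suc i)) j = d j" if "j \<notin> T" for i j
  proof (rule antisym)
    show "smin Ms (k i) (k (Suc i)) j \<le> d j" using smin_le_iff[OF k(3)] k(4)[OF that] by blast
    show "d j \<le> smin Ms (k i) (k (Suc i)) j" unfolding le_smin_iff[OF k(3)] using n0d that k(1) order_trans by blast
  qed
  show ?thesis
  proof (rule that[of k])
    show "1 \<le> k 0" using n0 k by simp
    show "k i < k (Suc i)" for i by (rule k)
    show "smin Ms (k i) (k (Suc i)) j = d j" if "j \<notin> T" for i j using that by (rule eq)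
    show "i \<le> smin Ms (k i) (k (Suc i)) j" if "j \<in> T" for i j
    proof (cases i)
      case (Suc i')
      show ?thesis unfolding le_smin_iff[OF k(3)]
        using k(5)[of i' _ j] that Suc by fastforce
    qed simp
    show "smin Ms (k 0) (k 1) j \<le> Ms l j" if l: "k 0 \<le> l" for l j
    proof (cases "j \<in> T")
      case False
      then show ?thesis using eq[OF False, of 0] n0d[of l j] l k(2) by simp
    next
      case True
      have kk: "k 0 < k 1" using k(3)[of 0] by simp
      show ?thesis
      proof (cases "l < k 1")
        case True
        then show ?thesis using l smin_le_iff[OF kk, of Ms j "Ms l j"] by blast
      next
        case False
        then have "Ms n0 j \<le> Ms l j" using k(5)[of 0 l j] True by simp
        moreover have "smin Ms (k 0) (k 1) j \<le> Ms n0 j" using smin_le_iff[OF kk, of Ms j "Ms n0 j"] k(2) kk by auto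
        ultimately show ?thesis by simp
      qed
    qed
    show "1 \<le> Ms l j" if "j \<in> T" "k 0 \<le> l" for l j using n0T that k(2) by simp
  qed
qed

lemma Inf_range_split:
  assumes "1 \<le> a" "a < b" "\<And>l. a \<le> l \<Longrightarrow> smin Ms a b j \<le> Ms l j"
  shows "Inf (range (\<lambda>i. Ms i j)) = min (smin Ms 0 a j) (smin Ms a b j)"
proof (rule nat_eq_by_le)
  fix y
  have "(\<exists>i. Ms i j \<le> y) \<longleftrightarrow> smin Ms 0 a j \<le> y \<or> smin Ms a b j \<le> y"
  proof
    assume "\<exists>i. Ms i j \<le> y"
    then obtain i where i: "Ms i j \<le> y" ..
    show "smin Ms 0 a j \<le> y \<or> smin Ms a b j \<le> y"
    proof (cases "i < a")
      case True
      then show ?thesis using i smin_le_iff[of 0 a Ms j y] assms(1) by auto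
    next
      case False
      then show ?thesis using i assms(3)[of i] by simp
    qed
  next
    assume "smin Ms 0 a j \<le> y \<or> smin Ms a b j \<le> y"
    then show "\<exists>i. Ms i j \<le> y" using smin_le_iff[of 0 a Ms j y] smin_le_iff[of a b Ms j y] assms(1,2) by auto
  qed
  then show "Inf (range (\<lambda>i. Ms i j)) \<le> y \<longleftrightarrow> min (smin Ms 0 a j) (smin Ms a b j) \<le> y"
    by (simp add: Inf_nat_image_le_iff min_le_iff_disj)
qed

lemma tcl_mono_S: "tcl S B c d M \<Longrightarrow> S \<subseteq> S' \<Longrightarrow> tcl S' B c d M"
proof (induction rule: tcl.induct)
  case (lim g Ms)
  then show ?case by (intro tcl.lim) auto
next
  case (trans c d M e N)
  then show ?case using tcl.trans[of S' B c d M e N] by blast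
qed (rule tcl.base)

section \<open>Runs with a bounded set of overflowing registers\<close>

locale machine =
  fixes P :: program and N :: nat
  assumes bound: "\<And>I. I \<in> set P \<Longrightarrow> reg_bound N I"
begin

abbreviation "step \<equiv> mstep P"

lemma vexec_zero: "I \<in> set P \<Longrightarrow> N > 0 \<Longrightarrow> (\<And>j. N \<le> j \<Longrightarrow> v j = 0) \<Longrightarrow> N \<le> j \<Longrightarrow> vexec A I v j = 0"
  using bound[of I] by (cases I) (auto simp: vexec_nth)

lemma N_pos: "I \<in> set P \<Longrightarrow> N > 0"
  using bound[of I] by (cases I) auto

lemma mstep_zero: "step A c d M \<Longrightarrow> (\<And>j. N \<le> j \<Longrightarrow> c j = 0) \<Longrightarrow> N \<le> j \<Longrightarrow> d j = 0 \<and> M j = 0"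
  unfolding mstep_def using vexec_zero N_pos by (metis nth_mem)

lemma tcl_zero:
  "tcl S (step A) c d M \<Longrightarrow> (\<And>j. N \<le> j \<Longrightarrow> c j = 0) \<Longrightarrow> N \<le> j \<Longrightarrow> d j = 0 \<and> M j = 0"
proof (induction arbitrary: j rule: tcl.induct)
  case (base c d M)
  then show ?case using mstep_zero by blast
next
  case (trans c d M e M')
  then show ?case by auto
next
  case (lim g Ms)
  have g: "\<forall>j. N \<le> j \<longrightarrow> g i j = 0" for i
    by (induction i) (use lim in auto)
  have "Ms i j = 0" for i using lim.IH[of i j] g[of i] lim.prems(2) by auto
  then show ?case by simp
qed

lemma tcl_le: "tcl S (step A) c d M \<Longrightarrow> M j \<le> c j"
proof (induction rule: tcl.induct)
  case (lim g Ms)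
  have "Inf (range (\<lambda>i. Ms i j)) \<le> Ms 0 j" by (rule cINF_lower) auto
  then show ?case using lim.IH[of 0] by simp
next
  case (trans c d M e M')
  then show ?case by (simp add: min.coboundedI1)
qed (simp add: mstep_def)

text \<open>An overflow leaves 0 in the register at the limit, and this configuration is either the
  last one or counted in the minimum of what follows. A register that stays positive thus never
  overflows.\<close>

lemma tcl_shrink:
  "tcl S (step A) c d M \<Longrightarrow> (\<And>j. j \<in> T \<Longrightarrow> 1 \<le> M j \<and> 1 \<le> d j) \<Longrightarrow> tcl (S - T) (step A) c d M"
proof (induction rule: tcl.induct)
  case (base c d M)
  then show ?case by (blast intro: tcl.base)
next
  case (trans c d M e M')
  have "1 \<le> d j" if "j \<in> T" for j
    using trans.prems[OF that] tcl_le[OF trans.hyps(2), of j] by simp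
  then show ?case using trans by (intro tcl.trans[of _ _ _ d]) auto
next
  case (lim g Ms)
  have M: "1 \<le> Ms i j" if "j \<in> T" for i j
  proof -
    have "Inf (range (\<lambda>i. Ms i j)) \<le> Ms i j" by (rule cINF_lower) auto
    then show ?thesis using lim.prems[OF that] by simp
  qed
  have "1 \<le> g i j" if "j \<in> T" for i j using M[OF that, of i] tcl_le[OF lim.hyps(1), of i j] by simp
  then have "tcl (S - T) (step A) (g i) (g (Suc i)) (Ms i)" for i using lim.IH[of i] M by blast
  moreover have "j \<notin> T" if "diverges (\<lambda>i. Ms i j)" for j using lim.prems[of j] that by (auto simp: limn_def)
  ultimately show ?case using lim.hyps by (intro tcl.lim) auto
qed

abbreviation "tm \<equiv> tv N"

lemma tm_zero [simp]: "N \<le> j \<Longrightarrow> tm e j = 0" by (simp add: tv_def)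

lemma tm_eq_iff:
  assumes "\<forall>j. N \<le> j \<longrightarrow> v j = 0"
  shows "tm e = v \<longleftrightarrow> (\<forall>j\<in>{..<N}. tm e j = v j)"
proof
  assume "\<forall>j\<in>{..<N}. tm e j = v j"
  then have "tm e j = v j" for j using assms by (cases "j < N") auto
  then show "tm e = v" by blast
qed simp

lemma step_iff:
  "step x (tm e) (tm d) (tm m) \<longleftrightarrow> (\<exists>l\<in>{..<length P}. tm e 0 = l \<and>
     (\<forall>j\<in>{..<N}. tm d j = vexec x (P ! l) (tm e) j) \<and> (\<forall>j\<in>{..<N}. tm m j = tm e j))"
proof -
  have "tm d = vexec x (P ! l) (tm e) \<longleftrightarrow> (\<forall>j\<in>{..<N}. tm d j = vexec x (P ! l) (tm e) j)" if "l < length P" for l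
    by (rule tm_eq_iff) (use vexec_zero N_pos that nth_mem in auto)
  moreover have "tm m = tm e \<longleftrightarrow> (\<forall>j\<in>{..<N}. tm m j = tm e j)" by (rule tm_eq_iff) auto
  ultimately show ?thesis unfolding mstep_def by auto
qed

lemma dfn_step:
  assumes "fn a" "fn b" "fn c"
  shows "dfn (\<lambda>x w. step x (tm (a w)) (tm (b w)) (tm (c w)))"
  unfolding step_iff
  by (intro dfn_fin_disj dfn_fin_conj dfn_conj dfn_vexec dfn_eq fn_tv fn_const assms) auto

text \<open>A state is a block number with a configuration. The clauses are what
  \<open>regroup\<close> provides: the block minimum is \<open>d\<close> off \<open>T\<close> and at
  least the block number on \<open>T\<close>, and \<open>m\<close> is the minimum of the first block
  and so of all blocks.\<close>

definition ov_step :: "nat set \<Rightarrow> nat set \<Rightarrow> nat set \<Rightarrow> nat \<Rightarrow> nat \<Rightarrow> nat \<Rightarrow> nat \<Rightarrow> bool" where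
  "ov_step S T x d m s' s \<longleftrightarrow> p1 s' = Suc (p1 s) \<and> (\<exists>k. tcl (S - T) (step x) (tm (p2 s)) (tm (p2 s')) (tm k) \<and>
     (\<forall>j\<in>{..<N} - T. tm k j = tm d j) \<and> (\<forall>j\<in>T. p1 s \<le> tm k j \<and> tm m j \<le> tm k j) \<and>
     (p1 s = 0 \<longrightarrow> (\<forall>j\<in>{..<N}. tm k j = tm m j)))"

text \<open>A run from \<open>e\<close> to a limit configuration \<open>d\<close>, at which exactly the registers in \<open>T\<close> overflow,
  but nowhere before.\<close>

definition ov :: "nat set \<Rightarrow> nat set \<Rightarrow> nat set \<Rightarrow> nat \<Rightarrow> nat \<Rightarrow> nat \<Rightarrow> bool" where
  "ov S T x e d m \<longleftrightarrow> \<not> acc_part (ov_step S T x d m) (pr 0 e) \<and> (\<forall>j\<in>T. tm d j = 0)"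

definition prim :: "nat set \<Rightarrow> nat set \<Rightarrow> nat \<Rightarrow> nat \<Rightarrow> nat \<Rightarrow> bool" where
  "prim S x e d m \<longleftrightarrow> step x (tm e) (tm d) (tm m) \<or> (\<exists>T\<in>Pow S - {{}}. ov S T x e d m)"

text \<open>Statements: \<open>Rn e d m\<close> is a run from \<open>e\<close> to \<open>d\<close> with minimum \<open>m\<close>; \<open>Kn k e d\<close> is a chain of \<open>k\<close> runs
  with minimum \<open>d\<close> that starts in \<open>e\<close>.\<close>

definition "Rn e d m = pr 0 (pr e (pr d m))"
definition "Kn k e d = pr (Suc k) (pr e d)"

text \<open>The tag \<open>p1 a\<close> gives the kind of instance: 0 has no premises, 1 has the two
  premises in \<open>p2 a\<close>, and 2, the limit without overflow, has the premises
  \<open>Kn k e d\<close> for all \<open>k\<close>. As \<open>Kn k\<close> has the tag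
  \<open>Suc k\<close>, \<open>p1 c = 1\<close> means an empty chain.\<close>

definition th :: "nat set \<Rightarrow> nat set \<Rightarrow> nat \<Rightarrow> nat \<Rightarrow> bool" where
  "th S x c a \<longleftrightarrow>
     (p1 a = 0 \<and> p1 c = 0 \<and> prim S x (p1 (p2 c)) (p1 (p2 (p2 c))) (p2 (p2 (p2 c)))) \<or>
     (p1 a = 0 \<and> p1 c = 1) \<or>
     (p1 a = 1 \<and> (\<exists>e g d m m1 m2. c = Rn e d m \<and> p2 a = pr (Rn e g m1) (Rn g d m2) \<and>
        (\<forall>j\<in>{..<N}. tm m j = min (tm m1 j) (tm m2 j)))) \<or>
     (p1 a = 1 \<and> (\<exists>k e d g. c = Kn (Suc k) e d \<and> p2 a = pr (Rn e g d) (Kn k g d))) \<or>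
     (p1 a = 2 \<and> (\<exists>e d m. c = Rn e d m \<and> p2 a = pr e d \<and> (\<forall>j\<in>{..<N}. tm m j = tm d j)))"

definition et :: "nat \<Rightarrow> nat \<Rightarrow> bool" where
  "et a b \<longleftrightarrow> (p1 a = 1 \<and> (b = p1 (p2 a) \<or> b = p2 (p2 a))) \<or> (p1 a = 2 \<and> (\<exists>k. b = pr (Suc k) (p2 a)))"

lemma gm_prim: "prim S x e d m \<Longrightarrow> gm (th S x) et (Rn e d m)"
  by (rule gm.intros[of _ _ "pr 0 0"]) (auto simp: th_def et_def Rn_def)

lemma gm_trans:
  assumes "gm (th S x) et (Rn e g m1)" "gm (th S x) et (Rn g d m2)" "tm m = vmin (tm m1) (tm m2)"
  shows "gm (th S x) et (Rn e d m)"
proof (rule gm.intros[of _ _ "pr 1 (pr (Rn e g m1) (Rn g d m2))"])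
  have z: "\<forall>j\<in>{..<N}. tm m j = min (tm m1 j) (tm m2 j)" using assms(3) by simp
  show "th S x (Rn e d m) (pr 1 (pr (Rn e g m1) (Rn g d m2)))" unfolding th_def pr_simps
    by (rule disjI2, rule disjI2, rule disjI1, intro conjI exI, (rule refl)+, rule z)
qed (use assms in \<open>auto simp: et_def\<close>)

lemma gm_K0: "gm (th S x) et (Kn 0 e d)"
  by (rule gm.intros[of _ _ "pr 0 0"]) (auto simp: th_def et_def Kn_def)

lemma gm_KSuc:
  assumes "gm (th S x) et (Rn e g d)" "gm (th S x) et (Kn k g d)"
  shows "gm (th S x) et (Kn (Suc k) e d)"
proof (rule gm.intros[of _ _ "pr 1 (pr (Rn e g d) (Kn k g d))"])
  show "th S x (Kn (Suc k) e d) (pr 1 (pr (Rn e g d) (Kn k g d)))" unfolding th_def pr_simps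
    by (rule disjI2, rule disjI2, rule disjI2, rule disjI1, intro conjI exI, (rule refl)+)
qed (use assms in \<open>auto simp: et_def\<close>)

lemma gm_lim:
  assumes "\<And>k. gm (th S x) et (Kn k e d)" "tm m = tm d"
  shows "gm (th S x) et (Rn e d m)"
proof (rule gm.intros[of _ _ "pr 2 (pr e d)"])
  show "th S x (Rn e d m) (pr 2 (pr e d))" using assms(2) by (auto simp: th_def Rn_def Kn_def)
qed (use assms in \<open>auto simp: et_def Kn_def\<close>)

definition sem :: "nat set \<Rightarrow> nat set \<Rightarrow> nat \<Rightarrow> bool" where
  "sem S x c \<longleftrightarrow> (case p1 c of
     0 \<Rightarrow> tcl S (step x) (tm (p1 (p2 c))) (tm (p1 (p2 (p2 c)))) (tm (p2 (p2 (p2 c))))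
   | Suc k \<Rightarrow> chain (\<lambda>e e'. tcl S (step x) e e' (tm (p2 (p2 c)))) k (tm (p1 (p2 c))))"

lemma sem_Rn: "sem S x (Rn e d m) \<longleftrightarrow> tcl S (step x) (tm e) (tm d) (tm m)"
  by (simp add: sem_def Rn_def)

lemma sem_Kn: "sem S x (Kn k e d) \<longleftrightarrow> chain (\<lambda>e e'. tcl S (step x) e e' (tm d)) k (tm e)"
  by (simp add: sem_def Kn_def)

lemma ov_sound:
  assumes "ov S T x e d m" "T \<subseteq> S" "S \<subseteq> {..<N}"
  shows "tcl S (step x) (tm e) (tm d) (tm m)"
proof -
  obtain f where f: "f 0 = pr 0 e" "\<And>i. ov_step S T x d m (f (Suc i)) (f i)"
    using assms(1) unfolding ov_def not_accp_iff by blast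
  have p: "p1 (f i) = i" for i
    by (induction i) (use f in \<open>auto simp: ov_step_def\<close>)
  have "\<forall>i. \<exists>k. tcl (S - T) (step x) (tm (p2 (f i))) (tm (p2 (f (Suc i)))) (tm k) \<and>
     (\<forall>j\<in>{..<N} - T. tm k j = tm d j) \<and> (\<forall>j\<in>T. i \<le> tm k j \<and> tm m j \<le> tm k j) \<and>
     (i = 0 \<longrightarrow> (\<forall>j\<in>{..<N}. tm k j = tm m j))"
    using f(2) unfolding ov_step_def p by blast
  from choice[OF this] obtain k where kk: "\<forall>i. tcl (S - T) (step x) (tm (p2 (f i))) (tm (p2 (f (Suc i)))) (tm (k i)) \<and>
     (\<forall>j\<in>{..<N} - T. tm (k i) j = tm d j) \<and> (\<forall>j\<in>T. i \<le> tm (k i) j \<and> tm m j \<le> tm (k i) j) \<and>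
     (i = 0 \<longrightarrow> (\<forall>j\<in>{..<N}. tm (k i) j = tm m j))" ..
  have k: "\<And>i. tcl (S - T) (step x) (tm (p2 (f i))) (tm (p2 (f (Suc i)))) (tm (k i))"
     "\<And>i j. j < N \<Longrightarrow> j \<notin> T \<Longrightarrow> tm (k i) j = tm d j" "\<And>i j. j \<in> T \<Longrightarrow> i \<le> tm (k i) j \<and> tm m j \<le> tm (k i) j"
     "\<And>j. j < N \<Longrightarrow> tm (k 0) j = tm m j" using kk by blast+
  have k0: "tm (k 0) = tm m" using k(4) by (intro ext) (metis linorder_not_le tm_zero)
  have off: "tm (k i) j = tm d j" if "j \<notin> T" for i j using k(2) that by (metis linorder_not_le tm_zero)
  have div: "diverges (\<lambda>i. tm (k i) j)" if "j \<in> T" for j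
    unfolding diverges_def INFM_nat_le using k(3)[OF that] by (metis Suc_n_not_le_n order_trans)
  have "tcl S (step x) (tm (p2 (f i))) (tm (p2 (f (Suc i)))) (tm (k i))" for i
    using k(1) by (rule tcl_mono_S) auto
  moreover have "{j. diverges (\<lambda>i. tm (k i) j)} \<subseteq> S"
  proof
    fix j assume j: "j \<in> {j. diverges (\<lambda>i. tm (k i) j)}"
    show "j \<in> S"
    proof (rule ccontr)
      assume "j \<notin> S"
      then have "(\<lambda>i. tm (k i) j) = (\<lambda>i. tm d j)" using off assms(2) by auto
      then show False using j by simp
    qed
  qed
  ultimately have "tcl S (step x) (tm (p2 (f 0))) (\<lambda>j. limn (\<lambda>i. tm (k i) j)) (\<lambda>j. Inf (range (\<lambda>i. tm (k i) j)))"
    by (rule tcl.lim[where g = "\<lambda>i. tm (p2 (f i))"])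
  moreover have "limn (\<lambda>i. tm (k i) j) = tm d j" for j
  proof (cases "j \<in> T")
    case True
    then show ?thesis using div assms(1) by (auto simp: limn_def ov_def)
  next
    case False
    then show ?thesis using off by simp
  qed
  moreover have "Inf (range (\<lambda>i. tm (k i) j)) = tm m j" for j
  proof (rule nat_eq_by_le)
    fix y
    have "(\<exists>i. tm (k i) j \<le> y) \<longleftrightarrow> tm m j \<le> y"
    proof (cases "j \<in> T")
      case True
      then show ?thesis using k(3)[OF True] fun_cong[OF k0, of j] by (metis order_trans order_refl)
    next
      case False
      then show ?thesis using off[OF False] fun_cong[OF k0, of j] by simp
    qed
    then show "Inf (range (\<lambda>i. tm (k i) j)) \<le> y \<longleftrightarrow> tm m j \<le> y" by (simp add: Inf_nat_image_le_iff)
  qed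
  ultimately show ?thesis using f(1) by simp
qed

lemma gm_sound:
  assumes S: "S \<subseteq> {..<N}"
  shows "gm (th S x) et c \<Longrightarrow> sem S x c"
proof (induction rule: gm.induct)
  case (1 c a)
  consider (prim) "p1 c = 0" "prim S x (p1 (p2 c)) (p1 (p2 (p2 c))) (p2 (p2 (p2 c)))"
    | (K0) "p1 c = 1"
    | (trans) e g d m m1 m2 where "p1 a = 1" "c = Rn e d m" "p2 a = pr (Rn e g m1) (Rn g d m2)"
        "\<forall>j\<in>{..<N}. tm m j = min (tm m1 j) (tm m2 j)"
    | (KSuc) k e d g where "p1 a = 1" "c = Kn (Suc k) e d" "p2 a = pr (Rn e g d) (Kn k g d)"
    | (lim) e d m where "p1 a = 2" "c = Rn e d m" "p2 a = pr e d" "\<forall>j\<in>{..<N}. tm m j = tm d j"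
    using 1(1) unfolding th_def
    by (elim disjE conjE exE) ((rule that(1), assumption+) | (rule that(2), assumption+) | (rule that(3), assumption+)
      | (rule that(4), assumption+) | (rule that(5), assumption+))+
  then show ?case
  proof cases
    case prim
    then show ?thesis using ov_sound S unfolding sem_def prim_def by (auto intro: tcl.base)
  next
    case K0
    then show ?thesis by (simp add: sem_def)
  next
    case trans
    have "sem S x (Rn e g m1)" "sem S x (Rn g d m2)" using 1(3) trans by (auto simp: et_def)
    moreover have "tm m = vmin (tm m1) (tm m2)" using trans(4) by (subst tm_eq_iff) auto
    ultimately show ?thesis unfolding trans(2) sem_Rn
      using tcl.trans[of S "step x" "tm e" "tm g" "tm m1" "tm d" "tm m2"] by simp
  next
    case KSuc
    have "sem S x (Rn e g d)" "sem S x (Kn k g d)" using 1(3) KSuc by (auto simp: et_def)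
    then show ?thesis unfolding KSuc(2) sem_Rn sem_Kn by auto
  next
    case lim
    have "sem S x (Kn k e d)" for k using 1(3) lim by (auto simp: et_def Kn_def)
    then have "chain (\<lambda>e e'. tcl S (step x) e e' (tm d)) k (tm e)" for k by (simp add: sem_Kn)
    \<comment> \<open>All minima agree, so the infinite chain has a limit without overflow, whose
      configuration is this minimum.\<close>
    from chain_limit[OF this] obtain g where g: "g 0 = tm e" "\<And>i. tcl S (step x) (g i) (g (Suc i)) (tm d)" by blast
    have "tcl S (step x) (g 0) (\<lambda>j. limn (\<lambda>i. tm d j)) (\<lambda>j. Inf (range (\<lambda>i::nat. tm d j)))"
      by (rule tcl.lim) (use g in auto)
    moreover have "tm m = tm d" using lim(4) by (subst tm_eq_iff) auto
    ultimately show ?thesis unfolding lim(2) sem_Rn using g by simp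
  qed
qed

text \<open>A limit is regrouped. After an initial part up to \<open>k 0\<close>, the blocks either
  all have minimum \<open>d'\<close>, which gives chains of every length, or form an infinite path
  of \<open>ov_step\<close>.\<close>

lemma gm_complete:
  assumes S: "S \<subseteq> {..<N}"
  shows "tcl S (step x) c d M \<Longrightarrow> tm e = c \<Longrightarrow> tm d' = d \<Longrightarrow> tm m = M \<Longrightarrow> gm (th S x) et (Rn e d' m)"
proof (induction arbitrary: e d' m rule: tcl.induct)
  case (base c d M)
  then show ?case by (intro gm_prim) (simp add: prim_def)
next
  case (trans c d1 M1 d2 M2)
  have z: "\<And>j. N \<le> j \<Longrightarrow> c j = 0" using trans.prems(1) by auto
  have z1: "d1 j = 0" "M1 j = 0" if "N \<le> j" for j using tcl_zero[OF trans.hyps(1) z that] by auto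
  have z2: "M2 j = 0" if "N \<le> j" for j using tcl_zero[OF trans.hyps(2) z1(1) that] by auto
  obtain g where g: "tm g = d1" using tv_surj[of N d1] z1 by blast
  obtain m1 where m1: "tm m1 = M1" using tv_surj[of N M1] z1 by blast
  obtain m2 where m2: "tm m2 = M2" using tv_surj[of N M2] z2 by blast
  show ?case
    by (rule gm_trans[OF trans.IH(1)[OF trans.prems(1) g m1] trans.IH(2)[OF g trans.prems(2) m2]])
      (simp add: trans.prems m1 m2)
next
  case (lim g Ms)
  have gz: "\<forall>j. N \<le> j \<longrightarrow> g i j = 0" for i
  proof (induction i)
    case 0
    then show ?case using lim.prems(1) tm_zero by metis
  next
    case (Suc i)
    then show ?case using tcl_zero[OF lim.hyps(1)[of i]] by blast
  qed
  have Mz: "Ms i j = 0" if "N \<le> j" for i j using tcl_zero[OF lim.hyps(1)[of i] _ that] gz by blast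
  have "\<forall>i. \<exists>e. tm e = g i" using tv_surj gz by blast
  from choice[OF this] obtain G where G: "\<And>i. tm (G i) = g i" by blast
  have sz: "smin Ms a b j = 0" if "N \<le> j" "a < b" for a b j
    using smin_le_iff[OF that(2), of Ms j 0] Mz[OF that(1)] that(2) by auto
  have segT: "tcl S (step x) (g a) (g b) (smin Ms a b)" if "a < b" for a b
    using that
  proof (induction b)
    case (Suc b)
    show ?case
    proof (cases "a = b")
      case True
      then show ?thesis using lim.hyps(1)[of b] by (simp add: smin_single)
    next
      case False
      then have "a < b" using Suc.prems by simp
      then show ?thesis using tcl.trans[OF Suc.IH lim.hyps(1)[of b]] smin_append[of a b "Suc b" Ms] by (simp add: smin_single)
    qed
  qed simp
  have seg1: "gm (th S x) et (Rn (G i) (G (Suc i)) m)" if "tm m = Ms i" for i m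
    by (rule lim.IH[OF G G that])
  have seg: "gm (th S x) et (Rn (G a) (G b) m)" if "a < b" "tm m = smin Ms a b" for a b m
    using that
  proof (induction b arbitrary: m)
    case (Suc b)
    show ?case
    proof (cases "a = b")
      case True
      then show ?thesis using seg1 Suc.prems by (simp add: smin_single)
    next
      case False
      then have ab: "a < b" using Suc.prems by simp
      obtain m1 where m1: "tm m1 = smin Ms a b" using tv_surj[of N "smin Ms a b"] sz ab by blast
      obtain m2 where m2: "tm m2 = Ms b" using tv_surj[of N "Ms b"] Mz by blast
      show ?thesis
        by (rule gm_trans[OF Suc.IH[OF ab m1] seg1[OF m2]])
          (use smin_append[of a b "Suc b" Ms] ab Suc.prems m1 m2 in \<open>simp add: smin_single\<close>)
    qed
  qed simp
  let ?T = "{j. diverges (\<lambda>i. Ms i j)}"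
  let ?d = "\<lambda>j. limn (\<lambda>i. Ms i j)"
  obtain k where k: "1 \<le> k 0" "\<And>i. k i < k (Suc i)"
    "\<And>i j. j \<notin> ?T \<Longrightarrow> smin Ms (k i) (k (Suc i)) j = ?d j"
    "\<And>i j. j \<in> ?T \<Longrightarrow> i \<le> smin Ms (k i) (k (Suc i)) j"
    "\<And>l j. k 0 \<le> l \<Longrightarrow> smin Ms (k 0) (k 1) j \<le> Ms l j"
    "\<And>l j. j \<in> ?T \<Longrightarrow> k 0 \<le> l \<Longrightarrow> 1 \<le> Ms l j"
    using regroup[of N Ms, OF Mz] by blast
  have k01: "k 0 < k 1" using k(2)[of 0] by simp
  have k0: "k 0 \<le> k i" for i using k(2) lift_Suc_mono_le[of k 0 i] by (simp add: less_imp_le)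
  obtain m0 where m0: "tm m0 = smin Ms 0 (k 0)" using tv_surj[of N "smin Ms 0 (k 0)"] sz k(1) by (metis less_le_trans zero_less_one)
  obtain m1 where m1: "tm m1 = smin Ms (k 0) (k 1)" using tv_surj[of N "smin Ms (k 0) (k 1)"] sz k01 by blast
  have m: "tm m = vmin (tm m0) (tm m1)"
    unfolding lim.prems(3) m0 m1 using Inf_range_split[OF k(1) k01 k(5)] by (intro ext) simp
  \<comment> \<open>The first segment is treated separately because it must start in the given code
    \<open>e\<close>, which need not be the code \<open>G 0\<close> of the same vector.\<close>
  have first: "gm (th S x) et (Rn e (G (k 0)) m0)"
  proof -
    have e: "gm (th S x) et (Rn (G 0) (G (k 0)) m0)" by (rule seg[OF _ m0]) (use k(1) in simp)
    show ?thesis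
    proof (cases "k 0 = 1")
      case True
      have "tm m0 = Ms 0" using m0 smin_single[of Ms 0] True by simp
      then show ?thesis using lim.IH[OF lim.prems(1) G[of "Suc 0"]] True by simp
    next
      case False
      then have k1: "1 < k 0" using k(1) by simp
      obtain n1 where n1: "tm n1 = Ms 0" using tv_surj[of N "Ms 0"] Mz by blast
      obtain n2 where n2: "tm n2 = smin Ms 1 (k 0)" using tv_surj[of N "smin Ms 1 (k 0)"] sz k1 by blast
      show ?thesis
        by (rule gm_trans[OF lim.IH[OF lim.prems(1) G[of "Suc 0"] n1] seg[OF k1 n2, unfolded One_nat_def]])
          (use smin_append[of 0 1 "k 0" Ms] k1 m0 n1 n2 smin_single[of Ms 0] in simp)
    qed
  qed
  have "gm (th S x) et (Rn (G (k 0)) d' m1)"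
  proof (cases "?T = {}")
    case True
    have eq: "smin Ms (k i) (k (Suc i)) = tm d'" for i using k(3) True lim.prems(2) by auto
    have "gm (th S x) et (Kn n (G (k i)) d')" for n i
    proof (induction n arbitrary: i)
      case 0
      then show ?case by (rule gm_K0)
    next
      case (Suc n)
      show ?case by (rule gm_KSuc[OF seg[OF k(2)] Suc]) (simp add: eq)
    qed
    then show ?thesis by (rule gm_lim) (use eq[of 0] m1 in simp)
  next
    case False
    have TS: "?T \<subseteq> S" using lim.hyps by blast
    \<comment> \<open>Here the set of overflowing registers shrinks: from \<open>k 0\<close> on the
      registers in \<open>?T\<close> are positive.\<close>
    have "tcl (S - ?T) (step x) (g (k i)) (g (k (Suc i))) (smin Ms (k i) (k (Suc i)))" for i
    proof (rule tcl_shrink[OF segT[OF k(2)]])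
      fix j assume j: "j \<in> ?T"
      have "1 \<le> Ms (k (Suc i)) j" using k(6)[OF j k0] .
      then have "1 \<le> g (k (Suc i)) j" using tcl_le[OF lim.hyps(1)[of "k (Suc i)"], of j] by simp
      moreover have "1 \<le> smin Ms (k i) (k (Suc i)) j"
        unfolding le_smin_iff[OF k(2)] using k(6)[OF j] k0[of i] order_trans by blast
      ultimately show "1 \<le> smin Ms (k i) (k (Suc i)) j \<and> 1 \<le> g (k (Suc i)) j" by blast
    qed
    note seg' = this
    have "ov_step S ?T x d' m1 (pr (Suc i) (G (k (Suc i)))) (pr i (G (k i)))" for i
    proof -
      obtain n where n: "tm n = smin Ms (k i) (k (Suc i))" using tv_surj[of N "smin Ms (k i) (k (Suc i))"] sz k(2) by blast
      have "smin Ms (k 0) (k 1) j \<le> smin Ms (k i) (k (Suc i)) j" for j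
        unfolding le_smin_iff[OF k(2)] using k(5) k0[of i] order_trans by blast
      then have "tcl (S - ?T) (step x) (tm (G (k i))) (tm (G (k (Suc i)))) (tm n) \<and> (\<forall>j\<in>{..<N} - ?T. tm n j = tm d' j) \<and>
        (\<forall>j\<in>?T. i \<le> tm n j \<and> tm m1 j \<le> tm n j) \<and> (i = 0 \<longrightarrow> (\<forall>j\<in>{..<N}. tm n j = tm m1 j))"
        using seg'[of i] k(3)[of _ i] k(4)[of _ i] lim.prems(2) by (auto simp: n m1 G)
      then show ?thesis unfolding ov_step_def by auto
    qed
    then have "\<not> acc_part (ov_step S ?T x d' m1) (pr 0 (G (k 0)))"
      unfolding not_accp_iff by (intro exI[of _ "\<lambda>i. pr i (G (k i))"]) auto
    moreover have "\<forall>j\<in>?T. tm d' j = 0" using lim.prems(2) by (auto simp: limn_def)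
    ultimately have "ov S ?T x (G (k 0)) d' m1" by (simp add: ov_def)
    then show ?thesis using TS False by (intro gm_prim) (auto simp: prim_def)
  qed
  then show ?case by (rule gm_trans[OF first _ m])
qed

lemma tcl_iff_gm: "S \<subseteq> {..<N} \<Longrightarrow> tcl S (step x) (tm e) (tm d) (tm m) \<longleftrightarrow> gm (th S x) et (Rn e d m)"
  using gm_sound[of S x "Rn e d m"] gm_complete[of S x "tm e" "tm d" "tm m" e d m] by (auto simp: sem_Rn)

lemma fn_Rn: "fn a \<Longrightarrow> fn b \<Longrightarrow> fn c \<Longrightarrow> fn (\<lambda>w. Rn (a w) (b w) (c w))"
  unfolding Rn_def by (intro fn.intros)

lemma fn_Kn: "fn a \<Longrightarrow> fn b \<Longrightarrow> fn c \<Longrightarrow> fn (\<lambda>w. Kn (a w) (b w) (c w))"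
  unfolding Kn_def by (intro fn.intros)

text \<open>Induction on \<open>S\<close>: the overflow clause refers to runs for
  \<open>S - T\<close> with \<open>T\<close> nonempty, and the rest is one inductive definition over
  numbers.\<close>

lemma dfn_tcl:
  assumes "S \<subseteq> {..<N}"
  shows "\<And>a b c. fn a \<Longrightarrow> fn b \<Longrightarrow> fn c \<Longrightarrow> dfn (\<lambda>x w. tcl S (step x) (tm (a w)) (tm (b w)) (tm (c w)))"
proof -
  have fin: "finite S" using assms finite_subset by blast
  then show "\<And>a b c. fn a \<Longrightarrow> fn b \<Longrightarrow> fn c \<Longrightarrow> dfn (\<lambda>x w. tcl S (step x) (tm (a w)) (tm (b w)) (tm (c w)))"
    using assms
  proof (induction S rule: finite_psubset_induct)
    case (psubset S)
    note logic = dfn_logic dfn_fin_conj dfn_fin_disj dfn_le dfn_step fn_tv fn_Rn fn_Kn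
    have IH: "dfn (\<lambda>x w. tcl (S - T) (step x) (tm (a w)) (tm (b w)) (tm (c w)))"
      if "T \<in> Pow S - {{}}" "fn a" "fn b" "fn c" for T a b c
      using that psubset.IH[of "S - T"] psubset.prems by blast
    have ov: "dfn (\<lambda>x w. ov S T x (a w) (b w) (c w))" if T: "T \<in> Pow S - {{}}" and f: "fn a" "fn b" "fn c" for a b c T
    proof (rule dfn3[OF _ f])
      have [simp]: "finite T" using T psubset.hyps finite_subset by auto
      show "dfn (\<lambda>x w. ov S T x (p1 w) (p1 (p2 w)) (p2 (p2 w)))"
        unfolding ov_def ov_step_def
        by (intro logic dfn_accp IH[OF T]) auto
    qed
    have prim: "dfn (\<lambda>x w. prim S x (a w) (b w) (c w))" if f: "fn a" "fn b" "fn c" for a b c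
      unfolding prim_def by (intro dfn_disj dfn_fin_disj dfn_step ov f) (use psubset.hyps in auto)
    have "dfn (\<lambda>x w. gm (th S x) et (Rn (a w) (b w) (c w)))" if f: "fn a" "fn b" "fn c" for a b c
      unfolding th_def et_def min_def
      by (intro dfn_gm dfn_disj dfn_conj dfn_ex dfn_fin_conj dfn_eq_if dfn_eq dfn_le prim fn_tv fn_Rn fn_Kn fn.intros fn_const f) auto
    then show ?case using tcl_iff_gm[OF psubset.prems(4)] psubset.prems by simp
  qed
qed

theorem dfn_outputs:
  assumes "P \<noteq> []" "2 \<le> N"
  shows "dfn (\<lambda>x w. itrm_outputs P x ((\<lambda>_. 0)(0 := p1 w)) (p2 w))"
proof -
  have "itrm_outputs P x ((\<lambda>_. 0)(0 := i)) n \<longleftrightarrow> (\<exists>e d m. (\<forall>j\<in>{..<N}. tm e j = (if j = 1 then i else 0)) \<and>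
     tcl {..<N} (step x) (tm e) (tm d) (tm m) \<and> length P \<le> tm d 0 \<and> tm d 1 = n)" for x i n
  proof -
    let ?c = "vcons 0 ((\<lambda>_. 0)(0 := i))"
    have c: "?c j = (if j = 1 then i else 0)" for j by (cases j) auto
    have e: "tm e = ?c \<longleftrightarrow> (\<forall>j\<in>{..<N}. tm e j = (if j = 1 then i else 0))" for e
      by (subst tm_eq_iff) (use assms(2) in \<open>auto simp: c\<close>)
    \<comment> \<open>Coordinates from \<open>N\<close> on stay 0 and cannot overflow.\<close>
    have "tcl UNIV (step x) c d M \<Longrightarrow> (\<And>j. N \<le> j \<Longrightarrow> c j = 0) \<Longrightarrow> tcl {..<N} (step x) c d M" for c d M
    proof (induction rule: tcl.induct)
      case (base c d M)
      then show ?case by (blast intro: tcl.base)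
    next
      case (trans c d M e M')
      then show ?case using tcl_zero[OF trans.hyps(1)] by (blast intro: tcl.trans)
    next
      case (lim g Ms)
      have gz: "\<forall>j. N \<le> j \<longrightarrow> g i j = 0" for i
      proof (induction i)
        case (Suc i)
        then show ?case using tcl_zero[OF lim.hyps(1)[of i]] by blast
      qed (use lim.prems in blast)
      have "Ms i j = 0" if "N \<le> j" for i j using tcl_zero[OF lim.hyps(1)[of i] _ that] gz by blast
      then have "{j. diverges (\<lambda>i. Ms i j)} \<subseteq> {..<N}" by (auto simp: not_le[symmetric])
      then show ?case using lim.IH gz by (intro tcl.lim) auto
    qed
    then have tcl: "tcl UNIV (step x) ?c d M \<longleftrightarrow> tcl {..<N} (step x) ?c d M" for d M
      using tcl_mono_S[of "{..<N}" "step x" ?c d M UNIV] assms(2) by (auto simp: c)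
    obtain ec where ec: "tm ec = ?c" using tv_surj[of N ?c] assms(2) by (auto simp: c)
    have "(\<exists>d M. tcl {..<N} (step x) ?c d M \<and> length P \<le> d 0 \<and> d 1 = n) \<longleftrightarrow>
      (\<exists>e d m. tm e = ?c \<and> tcl {..<N} (step x) (tm e) (tm d) (tm m) \<and> length P \<le> tm d 0 \<and> tm d 1 = n)"
    proof
      assume "\<exists>d M. tcl {..<N} (step x) ?c d M \<and> length P \<le> d 0 \<and> d 1 = n"
      then obtain d M where dM: "tcl {..<N} (step x) ?c d M" "length P \<le> d 0" "d 1 = n" by blast
      have "d j = 0 \<and> M j = 0" if "N \<le> j" for j using tcl_zero[OF dM(1) _ that] assms(2) by (auto simp: c)
      then obtain d' m' where "tm d' = d" "tm m' = M" using tv_surj[of N d] tv_surj[of N M] by blast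
      then show "\<exists>e d m. tm e = ?c \<and> tcl {..<N} (step x) (tm e) (tm d) (tm m) \<and> length P \<le> tm d 0 \<and> tm d 1 = n"
        using dM ec by (intro exI[of _ ec] exI[of _ d'] exI[of _ m']) simp
    next
      assume "\<exists>e d m. tm e = ?c \<and> tcl {..<N} (step x) (tm e) (tm d) (tm m) \<and> length P \<le> tm d 0 \<and> tm d 1 = n"
      then obtain e d m where "tm e = ?c" "tcl {..<N} (step x) (tm e) (tm d) (tm m)" "length P \<le> tm d 0" "tm d 1 = n" by blast
      then show "\<exists>d M. tcl {..<N} (step x) ?c d M \<and> length P \<le> d 0 \<and> d 1 = n"
        by (intro exI[of _ "tm d"] exI[of _ "tm m"]) simp
    qed
    then show ?thesis unfolding itrm_outputs_iff_tcl[OF assms(1)] tcl e .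
  qed
  moreover have "dfn (\<lambda>x w. \<exists>e d m. (\<forall>j\<in>{..<N}. tm e j = (if j = 1 then p1 w else 0)) \<and>
     tcl {..<N} (step x) (tm e) (tm d) (tm m) \<and> length P \<le> tm d 0 \<and> tm d 1 = p2 w)"
    by (intro dfn_ex dfn_conj dfn_fin_conj dfn_eq_if dfn_const dfn_eq dfn_le dfn_tcl fn_tv fn.intros fn_const) auto
  ultimately show ?thesis by simp
qed

end

section \<open>Forcing and category\<close>

text \<open>A condition is a list of pairs \<open>pr i b\<close>, each of which says \<open>i \<notin> x\<close> if \<open>b = 0\<close> and \<open>i \<in> x\<close> otherwise.
  Inconsistent conditions force everything.\<close>

definition cyl :: "nat \<Rightarrow> nat set set" where
  "cyl s = {x. \<forall>i b. lmem (pr i b) s \<longrightarrow> (i \<in> x \<longleftrightarrow> b \<noteq> 0)}"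

definition ext :: "nat \<Rightarrow> nat \<Rightarrow> bool" where
  "ext t s \<longleftrightarrow> (\<forall>m. lmem m s \<longrightarrow> lmem m t)"

definition con :: "nat \<Rightarrow> bool" where
  "con s \<longleftrightarrow> \<not> (\<exists>i b. lmem (pr i 0) s \<and> lmem (pr i (Suc b)) s)"

lemma con_iff: "con s \<longleftrightarrow> cyl s \<noteq> {}"
proof
  assume c: "con s"
  have "{i. \<exists>b. lmem (pr i (Suc b)) s} \<in> cyl s"
    unfolding cyl_def
  proof (intro CollectI allI impI)
    fix i b assume "lmem (pr i b) s"
    then show "i \<in> {i. \<exists>b. lmem (pr i (Suc b)) s} \<longleftrightarrow> b \<noteq> 0" using c unfolding con_def by (cases b) auto
  qed
  then show "cyl s \<noteq> {}" by blast
next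
  assume "cyl s \<noteq> {}"
  then show "con s" unfolding cyl_def con_def by auto
qed

lemma ext_refl [simp]: "ext s s" by (simp add: ext_def)
lemma ext_trans: "ext u t \<Longrightarrow> ext t s \<Longrightarrow> ext u s" by (simp add: ext_def)
lemma ext_cyl: "ext t s \<Longrightarrow> cyl t \<subseteq> cyl s" by (auto simp: ext_def cyl_def)

lemma amalgam:
  obtains u where "ext u s" "ext u t" "cyl u = cyl s \<inter> cyl t"
proof
  let ?u = "list_encode (list_decode s @ list_decode t)"
  have "lmem m ?u \<longleftrightarrow> lmem m s \<or> lmem m t" for m by (simp add: lmem_def)
  then show "ext ?u s" "ext ?u t" "cyl ?u = cyl s \<inter> cyl t" by (auto simp: ext_def cyl_def)
qed

lemma cyl_0 [simp]: "cyl 0 = UNIV" by (simp add: cyl_def)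

definition dense :: "nat set \<Rightarrow> bool" where
  "dense D \<longleftrightarrow> (\<forall>t. con t \<longrightarrow> (\<exists>t'\<in>D. ext t' t \<and> con t'))"

definition meets :: "nat set \<Rightarrow> nat set \<Rightarrow> bool" where
  "meets x D \<longleftrightarrow> (\<exists>t\<in>D. x \<in> cyl t)"

text \<open>That is, \<open>A\<close> is comeager in \<open>cyl s\<close>.\<close>

definition forced :: "nat \<Rightarrow> nat set set \<Rightarrow> bool" where
  "forced s A \<longleftrightarrow> (\<exists>D :: nat \<Rightarrow> nat set. (\<forall>n. dense (D n)) \<and> (\<forall>x\<in>cyl s. (\<forall>n. meets x (D n)) \<longrightarrow> x \<in> A))"

lemma dense_UNIV: "dense UNIV" unfolding dense_def by (auto intro: ext_refl)

lemma forced_ext: "forced s A \<Longrightarrow> ext t s \<Longrightarrow> forced t A"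
  unfolding forced_def using ext_cyl by blast

lemma forced_all:
  assumes "cyl s \<subseteq> A"
  shows "forced s A"
  using assms dense_UNIV unfolding forced_def by (intro exI[of _ "\<lambda>_. UNIV"]) blast

text \<open>Countably many families of dense sets are interleaved into one. A generic real may thus
  use every listed statement that is forced by a condition it satisfies.\<close>

lemma forced_countable:
  fixes \<sigma> :: "nat \<Rightarrow> nat" and D :: "nat \<Rightarrow> nat set"
  assumes D: "\<And>n. dense (D n)" and f: "\<And>i. forced (\<sigma> i) (B i)"
    and A: "\<And>x. x \<in> cyl s \<Longrightarrow> (\<And>n. meets x (D n)) \<Longrightarrow> (\<And>i. x \<in> cyl (\<sigma> i) \<Longrightarrow> x \<in> B i) \<Longrightarrow> x \<in> A"
  shows "forced s A"
proof -
  have "\<forall>i. \<exists>D :: nat \<Rightarrow> nat set. (\<forall>n. dense (D n)) \<and> (\<forall>x\<in>cyl (\<sigma> i). (\<forall>n. meets x (D n)) \<longrightarrow> x \<in> B i)"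
    using f unfolding forced_def by blast
  from choice[OF this] obtain E :: "nat \<Rightarrow> nat \<Rightarrow> nat set" where E: "\<And>i n. dense (E i n)"
    "\<And>i x. x \<in> cyl (\<sigma> i) \<Longrightarrow> (\<And>n. meets x (E i n)) \<Longrightarrow> x \<in> B i" by blast
  define G where "G n = (if p1 n = 0 then D (p2 n) else E (p1 n - 1) (p2 n))" for n
  have "dense (G n)" for n using D E(1) by (simp add: G_def)
  moreover have "x \<in> A" if x: "x \<in> cyl s" "\<And>n. meets x (G n)" for x
  proof (rule A)
    show "x \<in> cyl s" by fact
    show "meets x (D n)" for n using x(2)[of "pr 0 n"] by (simp add: G_def)
    show "x \<in> B i" if "x \<in> cyl (\<sigma> i)" for i
    proof (rule E(2)[OF that])
      show "meets x (E i n)" for n using x(2)[of "pr (Suc i) n"] by (simp add: G_def)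
    qed
  qed
  ultimately show ?thesis unfolding forced_def by blast
qed

lemma forced_INT:
  assumes "\<And>n :: nat. forced s (A n)"
  shows "forced s (\<Inter>n. A n)"
  by (rule forced_countable[where D = "\<lambda>_. UNIV" and \<sigma> = "\<lambda>_. s" and B = A]) (use assms dense_UNIV in auto)

lemma forced_mono:
  assumes "forced s A" "\<And>x. x \<in> cyl s \<Longrightarrow> x \<in> A \<Longrightarrow> x \<in> B"
  shows "forced s B"
  using assms unfolding forced_def by blast

lemma forced_Int: "forced s (A \<inter> B) \<longleftrightarrow> forced s A \<and> forced s B"
proof
  assume "forced s A \<and> forced s B"
  then have "forced s (\<Inter>n :: nat. if n = 0 then A else B)" by (intro forced_INT) auto
  then show "forced s (A \<inter> B)" by (rule forced_mono) (auto split: if_splits)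
qed (auto elim: forced_mono)

text \<open>The Baire category theorem for Cantor space, by the Rasiowa-Sikorski construction;
  numbers that are never decided are left out of \<open>x\<close>.\<close>

lemma generic_exists:
  assumes "con s" "\<And>n :: nat. dense (D n)"
  obtains x where "x \<in> cyl s" "\<And>n. meets x (D n)"
proof -
  have nxt: "\<exists>t'. con t' \<and> ext t' t \<and> t' \<in> D n" if "con t" for t n
    using assms(2)[of n] that unfolding dense_def by blast
  obtain h where h: "h 0 = s" "\<And>n. con (h n)" "\<And>n. ext (h (Suc n)) (h n) \<and> h (Suc n) \<in> D n"
    by (rule dependent_choice_from[of "\<lambda>_. con" s "\<lambda>n t t'. ext t' t \<and> t' \<in> D n", OF assms(1) nxt]) (assumption, rule that)
  have mono: "ext (h k) (h n)" if "n \<le> k" for n k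
    using that
  proof (induction k)
    case (Suc k)
    have "ext (h (Suc k)) (h k)" using h by blast
    then show ?case using Suc ext_trans by (cases "n = Suc k") (simp, metis le_SucE)
  qed simp
  define x where "x = {i. \<exists>n b. lmem (pr i (Suc b)) (h n)}"
  have x: "x \<in> cyl (h n)" for n
    unfolding cyl_def
  proof (intro CollectI allI impI)
    fix i b assume m: "lmem (pr i b) (h n)"
    show "i \<in> x \<longleftrightarrow> b \<noteq> 0"
    proof (cases b)
      case 0
      have False if "lmem (pr i (Suc b')) (h k)" for k b'
      proof -
        have "lmem (pr i 0) (h (max n k))" "lmem (pr i (Suc b')) (h (max n k))"
          using mono[of n "max n k"] mono[of k "max n k"] m that 0 by (auto simp: ext_def)
        moreover have "con (h (max n k))" using h by blast
        ultimately show False unfolding con_def by blast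
      qed
      then show ?thesis using 0 by (auto simp: x_def)
    next
      case (Suc b')
      then show ?thesis using m by (auto simp: x_def)
    qed
  qed
  have "x \<in> cyl s" using x[of 0] h(1) by simp
  moreover have "meets x (D n)" for n using x[of "Suc n"] h unfolding meets_def by blast
  ultimately show ?thesis using that by blast
qed

lemma forced_consistent:
  assumes "con s" "forced s A" "forced s B"
  shows "A \<inter> B \<noteq> {}"
proof -
  have "forced s (A \<inter> B)" using assms by (simp add: forced_Int)
  then obtain D :: "nat \<Rightarrow> nat set" where D: "\<forall>n. dense (D n)" "\<forall>x\<in>cyl s. (\<forall>n. meets x (D n)) \<longrightarrow> x \<in> A \<inter> B"
    unfolding forced_def by blast
  obtain x where "x \<in> cyl s" "\<And>n. meets x (D n)" using generic_exists[OF assms(1), of D] D(1) by blast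
  then have "x \<in> A \<inter> B" using D(2) by blast
  then show ?thesis by blast
qed

lemma dense_below:
  assumes "\<And>t. ext t s \<Longrightarrow> con t \<Longrightarrow> \<exists>t'\<in>E. ext t' t \<and> con t'"
  shows "dense {t. cyl t \<inter> cyl s = {} \<or> t \<in> E}"
  unfolding dense_def
proof (intro allI impI)
  fix t assume t: "con t"
  show "\<exists>t'\<in>{t. cyl t \<inter> cyl s = {} \<or> t \<in> E}. ext t' t \<and> con t'"
  proof (cases "cyl t \<inter> cyl s = {}")
    case True
    then show ?thesis using t by auto
  next
    case False
    obtain u where u: "ext u t" "ext u s" "cyl u = cyl t \<inter> cyl s" using amalgam[of t s] by blast
    then have "con u" using False by (simp add: con_iff)
    then obtain t' where "t' \<in> E" "ext t' u" "con t'" using assms u(2) by blast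
    then show ?thesis using u(1) ext_trans by blast
  qed
qed

text \<open>Comeagerness is local: there are only countably many conditions, so one real can be
  generic for all that force \<open>A\<close>, and by density it satisfies one of them.\<close>

lemma forced_local:
  assumes "\<And>t. ext t s \<Longrightarrow> con t \<Longrightarrow> \<exists>t'. ext t' t \<and> con t' \<and> forced t' A"
  shows "forced s A"
proof (rule forced_countable[where D = "\<lambda>_. {t. cyl t \<inter> cyl s = {} \<or> t \<in> {t. forced t A}}"
      and \<sigma> = "\<lambda>i. i" and B = "\<lambda>i. if forced i A then A else UNIV"])
  show "dense {t. cyl t \<inter> cyl s = {} \<or> t \<in> {t. forced t A}}" for n :: nat
    by (rule dense_below) (use assms in blast)
  show "forced i (if forced i A then A else UNIV)" for i by (auto intro: forced_all)
  fix x assume x: "x \<in> cyl s" "\<And>n :: nat. meets x {t. cyl t \<inter> cyl s = {} \<or> t \<in> {t. forced t A}}"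
    "\<And>i. x \<in> cyl i \<Longrightarrow> x \<in> (if forced i A then A else UNIV)"
  then obtain t where "x \<in> cyl t" "forced t A" unfolding meets_def by blast
  then show "x \<in> A" using x(3)[of t] by simp
qed

text \<open>A form of the Baire property in which the deciding conditions are dense.\<close>

definition BP :: "nat set set \<Rightarrow> bool" where
  "BP A \<longleftrightarrow> (\<forall>s. con s \<longrightarrow> (\<exists>t. ext t s \<and> con t \<and> (forced t A \<or> forced t (- A))))"

lemma BP_Compl: "BP A \<Longrightarrow> BP (- A)" unfolding BP_def by auto

text \<open>The negation clause of forcing. From right to left, the Baire property supplies densely
  many deciding conditions, none of which decides for \<open>A\<close>.\<close>

lemma forced_Compl:
  assumes "BP A"
  shows "forced s (- A) \<longleftrightarrow> (\<forall>t. ext t s \<and> con t \<longrightarrow> \<not> forced t A)"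
proof
  assume "forced s (- A)"
  then show "\<forall>t. ext t s \<and> con t \<longrightarrow> \<not> forced t A" using forced_ext forced_consistent by (metis Compl_disjoint)
next
  assume n: "\<forall>t. ext t s \<and> con t \<longrightarrow> \<not> forced t A"
  show "forced s (- A)"
  proof (rule forced_local)
    fix t assume t: "ext t s" "con t"
    then obtain t' where "ext t' t" "con t'" "forced t' A \<or> forced t' (- A)" using assms unfolding BP_def by blast
    then show "\<exists>t'. ext t' t \<and> con t' \<and> forced t' (- A)" using n t ext_trans by blast
  qed
qed

lemma BP_Int:
  assumes "BP A" "BP B"
  shows "BP (A \<inter> B)"
  unfolding BP_def
proof (intro allI impI)
  fix s assume "con s"
  then obtain t where t: "ext t s" "con t" "forced t A \<or> forced t (- A)" using assms(1) unfolding BP_def by blast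
  obtain u where u: "ext u t" "con u" "forced u B \<or> forced u (- B)" using assms(2) t(2) unfolding BP_def by blast
  have "forced u A \<or> forced u (- A)" using t(3) u(1) forced_ext by blast
  moreover have "forced u (- (A \<inter> B))" if "forced u (- A)" using that by (rule forced_mono) auto
  moreover have "forced u (- (A \<inter> B))" if "forced u (- B)" using that by (rule forced_mono) auto
  ultimately have "forced u (A \<inter> B) \<or> forced u (- (A \<inter> B))" using u(3) unfolding forced_Int by blast
  then show "\<exists>t. ext t s \<and> con t \<and> (forced t (A \<inter> B) \<or> forced t (- (A \<inter> B)))" using t u ext_trans by blast
qed

section \<open>Forcing accessible parts\<close>

context
  fixes R :: "nat set \<Rightarrow> nat \<Rightarrow> nat \<Rightarrow> bool"
  assumes BP: "\<And>a b. BP {x. R x a b}"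
begin

text \<open>The pair of a condition and a number \<open>k\<close> is in the inductively defined set iff some stronger condition
  forces \<open>k\<close> into the accessible part.\<close>

definition acc_th :: "nat \<Rightarrow> nat \<Rightarrow> bool" where
  "acc_th c a \<longleftrightarrow> p2 a = p2 c \<and> ext (p1 a) (p1 c) \<and> con (p1 a)"

definition acc_et :: "nat \<Rightarrow> nat \<Rightarrow> bool" where
  "acc_et a b \<longleftrightarrow> ext (p1 b) (p1 a) \<and> con (p1 b) \<and> forced (p1 b) {x. R x (p2 b) (p2 a)}"

text \<open>For each \<open>k\<close>, densely many conditions below \<open>p1 a\<close> either
  exclude \<open>k\<close> as a predecessor of \<open>p2 c\<close> or force it to be one; then the
  induction hypothesis gives a stronger condition forcing \<open>k\<close> to be accessible.
  Intersecting over all \<open>k\<close> yields accessibility.\<close>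

lemma gm_imp_forced:
  "gm acc_th acc_et c \<Longrightarrow> \<exists>t. ext t (p1 c) \<and> con t \<and> forced t {x. acc_part (R x) (p2 c)}"
proof (induction rule: gm.induct)
  case (1 c a)
  have "forced (p1 a) {x. R x k (p2 c) \<longrightarrow> acc_part (R x) k}" for k
  proof (rule forced_local)
    fix u assume u: "ext u (p1 a)" "con u"
    then obtain v where v: "ext v u" "con v" "forced v {x. R x k (p2 c)} \<or> forced v (- {x. R x k (p2 c)})"
      using BP unfolding BP_def by blast
    show "\<exists>t'. ext t' u \<and> con t' \<and> forced t' {x. R x k (p2 c) \<longrightarrow> acc_part (R x) k}"
    proof (cases "forced v {x. R x k (p2 c)}")
      case True
      have "acc_et a (pr v k)" using True v u ext_trans 1(1) by (auto simp: acc_et_def acc_th_def)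
      then obtain t where t: "ext t v" "con t" "forced t {x. acc_part (R x) k}" using 1(3) by fastforce
      have "forced t {x. R x k (p2 c) \<longrightarrow> acc_part (R x) k}" using t(3) by (rule forced_mono) simp
      then show ?thesis using t v ext_trans by blast
    next
      case False
      then have "forced v (- {x. R x k (p2 c)})" using v by blast
      then have "forced v {x. R x k (p2 c) \<longrightarrow> acc_part (R x) k}" by (rule forced_mono) simp
      then show ?thesis using v by blast
    qed
  qed
  then have "forced (p1 a) (\<Inter>k. {x. R x k (p2 c) \<longrightarrow> acc_part (R x) k})" by (rule forced_INT)
  then have "forced (p1 a) {x. acc_part (R x) (p2 c)}"
    by (rule forced_mono) (auto intro: accp.intros)
  then show ?case using 1(1) by (auto simp: acc_th_def)
qed

text \<open>Outside the inductively defined set, every stronger condition has an extension that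
  forces some \<open>R x k v\<close> and stays outside together with \<open>k\<close>. A generic
  real meets such extensions again and again, so \<open>v\<close> is not accessible for it.\<close>

lemma not_gm_imp_forced:
  assumes ng: "\<not> gm acc_th acc_et (pr s v)"
  shows "forced s (- {x. acc_part (R x) v})"
proof -
  define K where "K s v \<longleftrightarrow> \<not> gm acc_th acc_et (pr s v)" for s v
  have K: "\<exists>t2 k. ext t2 t \<and> con t2 \<and> forced t2 {x. R x k v} \<and> K t2 k" if KK: "K s v" "ext t s" "con t" for s v t
  proof -
    have "acc_th (pr s v) (pr t v)" using KK by (simp add: acc_th_def)
    then obtain b where b: "acc_et (pr t v) b" "\<not> gm acc_th acc_et b"
      using KK(1) gm.intros[of acc_th "pr s v" "pr t v" acc_et] unfolding K_def by blast
    then show ?thesis by (intro exI[of _ "p1 b"] exI[of _ "p2 b"]) (auto simp: acc_et_def K_def)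
  qed
  define E where "E s v = {t2. ext t2 s \<and> (\<exists>k. forced t2 {x. R x k v} \<and> K t2 k)}" for s v
  \<comment> \<open>There is one dense set for every pair of a condition and a number, because the
    pairs reached in the descent depend on \<open>x\<close>.\<close>
  define D where "D n = (if K (p1 n) (p2 n) then {t. cyl t \<inter> cyl (p1 n) = {} \<or> t \<in> E (p1 n) (p2 n)} else UNIV)" for n
  define B where "B i = (if forced (p1 i) {x. R x (p1 (p2 i)) (p2 (p2 i))} then {x. R x (p1 (p2 i)) (p2 (p2 i))} else UNIV)" for i
  show ?thesis
  proof (rule forced_countable[where D = D and \<sigma> = p1 and B = B])
    show "dense (D n)" for n
    proof (cases "K (p1 n) (p2 n)")
      case True
      have "dense {t. cyl t \<inter> cyl (p1 n) = {} \<or> t \<in> E (p1 n) (p2 n)}"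
      proof (rule dense_below)
        fix t assume t: "ext t (p1 n)" "con t"
        show "\<exists>t'\<in>E (p1 n) (p2 n). ext t' t \<and> con t'"
          using K[OF True t] t ext_trans unfolding E_def by blast
      qed
      then show ?thesis using True by (simp add: D_def)
    qed (simp add: D_def dense_UNIV)
    show "forced (p1 i) (B i)" for i by (auto simp: B_def intro: forced_all)
    fix x assume x: "x \<in> cyl s" "\<And>n. meets x (D n)" "\<And>i. x \<in> cyl (p1 i) \<Longrightarrow> x \<in> B i"
    have step: "\<exists>t2 k. x \<in> cyl t2 \<and> K t2 k \<and> R x k v" if "K s v" "x \<in> cyl s" for s v
    proof -
      obtain t where t: "x \<in> cyl t" "t \<in> D (pr s v)" using x(2) unfolding meets_def by blast
      then have "t \<in> E s v" using that by (auto simp: D_def)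
      then obtain k where k: "forced t {x. R x k v}" "K t k" by (auto simp: E_def)
      have "R x k v" using x(3)[of "pr t (pr k v)"] t(1) k(1) by (simp add: B_def)
      then show ?thesis using t k by blast
    qed
    have "\<not> (\<exists>s. K s v \<and> x \<in> cyl s)" if "acc_part (R x) v" for v
      using that
    proof (induction rule: accp.induct)
      case (accI v)
      then show ?case using step by blast
    qed
    then show "x \<in> - {x. acc_part (R x) v}" using ng x(1) unfolding K_def by blast
  qed
qed

lemma BP_accp: "BP {x. acc_part (R x) v}"
  unfolding BP_def
proof (intro allI impI)
  fix s assume s: "con s"
  show "\<exists>t. ext t s \<and> con t \<and> (forced t {x. acc_part (R x) v} \<or> forced t (- {x. acc_part (R x) v}))"
  proof (cases "gm acc_th acc_et (pr s v)")
    case True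
    from gm_imp_forced[OF this] show ?thesis by auto
  next
    case False
    from not_gm_imp_forced[OF this] show ?thesis using s ext_refl by blast
  qed
qed

text \<open>Membership in the inductively defined set gives only some stronger forcing condition;
  demanding it of all consistent \<open>t\<close> below \<open>s\<close> makes such conditions dense
  below \<open>s\<close>.\<close>

lemma forced_accp:
  "forced s {x. acc_part (R x) v} \<longleftrightarrow> (\<forall>t. ext t s \<and> con t \<longrightarrow> gm acc_th acc_et (pr t v))"
proof
  assume f: "forced s {x. acc_part (R x) v}"
  show "\<forall>t. ext t s \<and> con t \<longrightarrow> gm acc_th acc_et (pr t v)"
  proof (intro allI impI)
    fix t assume t: "ext t s \<and> con t"
    show "gm acc_th acc_et (pr t v)"
    proof (rule ccontr)
      assume "\<not> gm acc_th acc_et (pr t v)"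
      from not_gm_imp_forced[OF this] forced_ext[OF f] t forced_consistent show False by (metis Compl_disjoint)
    qed
  qed
next
  assume g: "\<forall>t. ext t s \<and> con t \<longrightarrow> gm acc_th acc_et (pr t v)"
  show "forced s {x. acc_part (R x) v}"
  proof (rule forced_local)
    fix t assume "ext t s" "con t"
    then have "gm acc_th acc_et (pr t v)" using g by blast
    from gm_imp_forced[OF this] show "\<exists>t'. ext t' t \<and> con t' \<and> forced t' {x. acc_part (R x) v}" by simp
  qed
qed

end

section \<open>Definability of the forcing relation\<close>

lemma dfn_ext: "fn t \<Longrightarrow> fn u \<Longrightarrow> dfn (\<lambda>x w. ext (t w) (u w))"
proof (rule dfn2)
  show "dfn (\<lambda>x w. ext (p1 w) (p2 w))"
    unfolding ext_def by (intro dfn_logic dfn_lmem)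
qed

lemma dfn_con: "fn t \<Longrightarrow> dfn (\<lambda>x w. con (t w))"
proof (rule dfn_subst)
  show "dfn (\<lambda>x w. con w)"
    unfolding con_def by (intro dfn_logic dfn_lmem)
qed

lemma BP_const: "BP {x. P}"
proof -
  have "forced t {x. P} \<or> forced t (- {x. P})" for t by (cases P) (auto intro: forced_all)
  then show ?thesis unfolding BP_def using ext_refl by blast
qed

lemma forced_const: "forced s {x. P} \<longleftrightarrow> \<not> con s \<or> P"
proof (cases "con s \<and> \<not> P")
  case True
  then have "\<not> forced s {x. P}" using forced_consistent[of s "{x. P}" "{x. P}"] by auto
  then show ?thesis using True by simp
next
  case False
  then have "\<not> con s \<or> P" by blast
  then have "cyl s \<subseteq> {x. P}" by (auto simp: con_iff)
  then show ?thesis using \<open>\<not> con s \<or> P\<close> forced_all by blast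
qed

lemma lmem_lcons_con: "x \<in> cyl s \<Longrightarrow> x \<in> cyl (lcons (pr v (if v \<in> x then 1 else 0)) s)"
  by (auto simp: cyl_def)

lemma ext_lcons: "ext (lcons m s) s" by (simp add: ext_def)

lemma BP_mem: "BP {x. v \<in> x}"
  unfolding BP_def
proof (intro allI impI)
  fix s assume "con s"
  then obtain x where x: "x \<in> cyl s" by (auto simp: con_iff)
  let ?t = "lcons (pr v (if v \<in> x then 1 else 0)) s"
  have "con ?t" using lmem_lcons_con[OF x] con_iff by blast
  moreover have "forced ?t {x. v \<in> x} \<or> forced ?t (- {x. v \<in> x})"
  proof (cases "v \<in> x")
    case True
    then have "cyl ?t \<subseteq> {x. v \<in> x}" by (auto simp: cyl_def)
    then show ?thesis using forced_all by blast
  next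
    case False
    then have "cyl ?t \<subseteq> - {x. v \<in> x}" by (force simp: cyl_def)
    then show ?thesis using forced_all by blast
  qed
  ultimately show "\<exists>t. ext t s \<and> con t \<and> (forced t {x. v \<in> x} \<or> forced t (- {x. v \<in> x}))" using ext_lcons by blast
qed

text \<open>If a consistent \<open>s\<close> does not demand \<open>v\<close>, it stays consistent
  when the absence of \<open>v\<close> is added.\<close>

lemma forced_mem: "forced s {x. v \<in> x} \<longleftrightarrow> \<not> con s \<or> (\<exists>b. lmem (pr v (Suc b)) s)"
proof
  assume f: "forced s {x. v \<in> x}"
  show "\<not> con s \<or> (\<exists>b. lmem (pr v (Suc b)) s)"
  proof (rule ccontr)
    assume n: "\<not> (\<not> con s \<or> (\<exists>b. lmem (pr v (Suc b)) s))"
    then have "con (lcons (pr v 0) s)" unfolding con_def by auto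
    moreover have "forced (lcons (pr v 0) s) {x. v \<in> x}" using f ext_lcons forced_ext by blast
    moreover have "forced (lcons (pr v 0) s) (- {x. v \<in> x})" by (rule forced_all) (force simp: cyl_def)
    ultimately show False using forced_consistent by (metis Compl_disjoint)
  qed
next
  assume "\<not> con s \<or> (\<exists>b. lmem (pr v (Suc b)) s)"
  then have "cyl s \<subseteq> {x. v \<in> x}"
  proof
    assume "\<exists>b. lmem (pr v (Suc b)) s"
    then show ?thesis unfolding cyl_def by blast
  qed (simp add: con_iff)
  then show "forced s {x. v \<in> x}" by (rule forced_all)
qed

text \<open>The Baire property is carried along because the clauses for negation and accessible
  parts rest on it. The forcing relation does not mention the oracle, so it can be decided without
  one.\<close>

theorem dfn_forced:
  "dfn \<phi> \<Longrightarrow> (\<forall>w. BP {x. \<phi> x w}) \<and> dfn (\<lambda>_ w. forced (p1 w) {x. \<phi> x (p2 w)})"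
proof (induction rule: dfn.induct)
  case (dfn_mem t)
  have "dfn (\<lambda>_ w. forced (p1 w) {x. t (p2 w) \<in> x})"
    unfolding forced_mem by (intro dfn_logic dfn_con dfn_lmem fn_comp[OF dfn_mem])
  then show ?case using BP_mem by blast
next
  case (dfn_eq t u)
  have "dfn (\<lambda>_ w. forced (p1 w) {x. t (p2 w) = u (p2 w)})"
    unfolding forced_const by (intro dfn_logic dfn_con fn_comp[OF dfn_eq(1)] fn_comp[OF dfn_eq(2)])
  then show ?case using BP_const by blast
next
  case (dfn_not \<phi>)
  have *: "{x. \<not> \<phi> x w} = - {x. \<phi> x w}" for w by auto
  have f: "dfn (\<lambda>_ w. forced (s w) {x. \<phi> x (t w)})" if "fn s" "fn t" for s t
    using dfn_subst[OF conjunct2[OF dfn_not.IH], of "\<lambda>w. pr (s w) (t w)"] that by (simp add: fn_pr)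
  have "dfn (\<lambda>_ w. \<forall>t. ext t (p1 w) \<and> con t \<longrightarrow> \<not> forced t {x. \<phi> x (p2 w)})"
    by (intro dfn_logic dfn_con dfn_ext f)
  then have "dfn (\<lambda>_ w. forced (p1 w) (- {x. \<phi> x (p2 w)}))"
    using dfn_not.IH by (subst forced_Compl) auto
  then show ?case unfolding * using BP_Compl dfn_not.IH by blast
next
  case (dfn_conj \<phi> \<psi>)
  have *: "{x. \<phi> x w \<and> \<psi> x w} = {x. \<phi> x w} \<inter> {x. \<psi> x w}" for w by auto
  show ?case unfolding * forced_Int using BP_Int dfn_conj.IH dfn.dfn_conj by blast
next
  case (dfn_acc \<phi> t)
  let ?R = "\<lambda>w x a b. \<phi> x (pr w (pr a b))"
  have BP: "BP {x. ?R w x a b}" for w a b using dfn_acc.IH by blast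
  have f: "dfn (\<lambda>_ w. forced (s w) {x. \<phi> x (u w)})" if "fn s" "fn u" for s u
    using dfn_subst[OF conjunct2[OF dfn_acc.IH], of "\<lambda>w. pr (s w) (u w)"] that by (simp add: fn_pr)
  have "dfn (\<lambda>_ w. \<forall>s. ext s (p1 w) \<and> con s \<longrightarrow> gm acc_th (acc_et (?R (p2 w))) (pr s (t (p2 w))))"
    unfolding acc_th_def[OF BP, abs_def] acc_et_def[OF BP, abs_def]
    by (intro dfn_logic dfn_con dfn_ext dfn_gm f fn_comp[OF dfn_acc(2)])
  then have "dfn (\<lambda>_ w. forced (p1 w) {x. acc_part (?R (p2 w) x) (t (p2 w))})"
    using forced_accp[OF BP] by simp
  moreover have "BP {x. acc_part (?R w x) v}" for w v by (rule BP_accp) (rule BP)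
  ultimately show ?case by blast
qed

text \<open>A basic open set of the product restricts finitely many coordinates, and a condition can
  list them.\<close>

lemma openin_cantor_iff:
  "openin cantor_space V \<longleftrightarrow> (\<forall>x\<in>V. \<exists>t. x \<in> cyl t \<and> cyl t \<subseteq> V)"
proof
  let ?f = "\<lambda>x i. i \<in> (x :: nat set)"
  let ?T = "product_topology (\<lambda>_ :: nat. discrete_topology (UNIV :: bool set)) UNIV"
  assume "openin cantor_space V"
  then obtain W where W: "openin ?T W" "V = ?f -` W"
    by (auto simp: cantor_space_def openin_pullback_topology)
  show "\<forall>x\<in>V. \<exists>t. x \<in> cyl t \<and> cyl t \<subseteq> V"
  proof
    fix x assume "x \<in> V"
    then have "?f x \<in> W" using W by auto
    then obtain U where U: "finite {i. U i \<noteq> (UNIV :: bool set)}" "?f x \<in> Pi\<^sub>E UNIV U" "Pi\<^sub>E UNIV U \<subseteq> W"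
      using W(1) unfolding openin_product_topology_alt by auto
    obtain l where l: "set l = {i. U i \<noteq> UNIV}" using U(1) finite_list by blast
    let ?t = "list_encode (map (\<lambda>i. pr i (if i \<in> x then 1 else 0)) l)"
    have "x \<in> cyl ?t" by (auto simp: cyl_def lmem_def split: if_splits)
    moreover have "y \<in> V" if y: "y \<in> cyl ?t" for y
    proof -
      have "i \<in> y \<longleftrightarrow> i \<in> x" if "U i \<noteq> UNIV" for i
      proof -
        have "lmem (pr i (if i \<in> x then 1 else 0)) ?t" using that l by (auto simp: lmem_def)
        then show ?thesis using y unfolding cyl_def by (auto split: if_splits)
      qed
      then have "?f y i \<in> U i" for i using U(2) by (cases "U i = UNIV") (auto simp: PiE_iff)
      then show ?thesis using U(3) W(2) by (auto simp: PiE_iff)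
    qed
    ultimately show "\<exists>t. x \<in> cyl t \<and> cyl t \<subseteq> V" by blast
  qed
next
  let ?f = "\<lambda>x i. i \<in> (x :: nat set)"
  let ?T = "product_topology (\<lambda>_ :: nat. discrete_topology (UNIV :: bool set)) UNIV"
  assume V: "\<forall>x\<in>V. \<exists>t. x \<in> cyl t \<and> cyl t \<subseteq> V"
  have "openin ?T {h. {i. h i} \<in> V}"
    unfolding openin_product_topology_alt
  proof (intro ballI)
    fix h assume "h \<in> {h. {i. h i} \<in> V}"
    then obtain t where t: "{i. h i} \<in> cyl t" "cyl t \<subseteq> V" using V by blast
    let ?U = "\<lambda>i. if \<exists>b. lmem (pr i b) t then {h i} else UNIV"
    have "{i. \<exists>b. lmem (pr i b) t} \<subseteq> p1 ` set (list_decode t)"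
      by (auto simp: lmem_def) (metis image_eqI pr_simps(1))
    then have "finite {i. \<exists>b. lmem (pr i b) t}" by (rule finite_subset) simp
    then have "finite {i \<in> UNIV. ?U i \<noteq> topspace (discrete_topology UNIV)}"
      by (rule rev_finite_subset) auto
    moreover have "g \<in> {h. {i. h i} \<in> V}" if g: "g \<in> Pi\<^sub>E UNIV ?U" for g
    proof -
      have "g i = h i" if "lmem (pr i b) t" for i b
      proof -
        have "g i \<in> ?U i" using g by (auto simp: PiE_iff)
        then show ?thesis using that by (auto split: if_splits)
      qed
      then have "{i. g i} \<in> cyl t" using t(1) by (auto simp: cyl_def)
      then show ?thesis using t(2) by auto
    qed
    ultimately show "\<exists>U. finite {i \<in> UNIV. U i \<noteq> topspace (discrete_topology UNIV)} \<and>
        (\<forall>i\<in>UNIV. openin (discrete_topology UNIV) (U i)) \<and> h \<in> Pi\<^sub>E UNIV U \<and> Pi\<^sub>E UNIV U \<subseteq> {h. {i. h i} \<in> V}"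
      by (intro exI[of _ ?U]) (auto simp: PiE_iff)
  qed
  moreover have "V = ?f -` {h. {i. h i} \<in> V} \<inter> UNIV" by auto
  ultimately show "openin cantor_space V" unfolding cantor_space_def openin_pullback_topology by blast
qed

text \<open>The reals that meet a dense set of conditions form a dense open set, and each point of
  \<open>X\<close> misses one of countably many such sets.\<close>

lemma forced_Compl_imp_meager:
  assumes "forced 0 (- X)"
  shows "meager_in cantor_space X"
proof -
  obtain D :: "nat \<Rightarrow> nat set" where D0: "\<forall>n. dense (D n)" "\<forall>x. (\<forall>n. meets x (D n)) \<longrightarrow> x \<notin> X"
    using assms unfolding forced_def by auto
  have D: "\<And>n. dense (D n)" "\<And>x. (\<And>n. meets x (D n)) \<Longrightarrow> x \<notin> X" using D0 by blast+
  define U where "U n = {x. meets x (D n)}" for n :: nat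
  have top: "topspace cantor_space = UNIV"
    using openin_cantor_iff[of UNIV] openin_subset cyl_0 by blast
  have Uo: "openin cantor_space (U n)" for n
    unfolding openin_cantor_iff U_def meets_def by blast
  have "nowhere_dense_in cantor_space (X - U n)" for n
    unfolding nowhere_dense_in_def
  proof
    show "X - U n \<subseteq> topspace cantor_space" by (simp add: top)
    have "closedin cantor_space (- U n)" using Uo[of n] unfolding closedin_def top by (simp add: Compl_eq_Diff_UNIV[symmetric])
    then have cl: "cantor_space closure_of (X - U n) \<subseteq> - U n" by (intro closure_of_minimal) auto
    show "cantor_space interior_of (cantor_space closure_of (X - U n)) = {}"
    proof (rule ccontr)
      assume "cantor_space interior_of (cantor_space closure_of (X - U n)) \<noteq> {}"
      then obtain x where x: "x \<in> cantor_space interior_of (cantor_space closure_of (X - U n))" by blast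
      obtain t where t: "x \<in> cyl t" "cyl t \<subseteq> cantor_space interior_of (cantor_space closure_of (X - U n))"
        using bspec[OF openin_interior_of[of cantor_space "cantor_space closure_of (X - U n)", unfolded openin_cantor_iff] x] by blast
      have "cyl t \<subseteq> - U n" using t(2) interior_of_subset[of cantor_space "cantor_space closure_of (X - U n)"] cl by (rule subset_trans[OF subset_trans])
      moreover have "con t" using t con_iff by blast
      then obtain t' where "t' \<in> D n" "ext t' t" "con t'" using D(1)[of n] unfolding dense_def by blast
      then obtain y where "y \<in> cyl t'" "y \<in> cyl t" "y \<in> U n" using ext_cyl con_iff unfolding U_def meets_def by blast
      ultimately show False by blast
    qed
  qed
  moreover have "X = \<Union> (range (\<lambda>n. X - U n))" using D(2) unfolding U_def by auto
  ultimately show ?thesis unfolding meager_in_def by (intro exI[of _ "range (\<lambda>n. X - U n)"]) auto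
qed

section \<open>Computing from a nonmeager set of oracles\<close>

lemma itrm_outputs_Nil: "itrm_outputs [] A R n \<Longrightarrow> n = R 0"
proof -
  assume "itrm_outputs [] A R n"
  then obtain r :: "nat rel" and c t where run: "itrm_run r [] A R c" and t: "t \<in> Field r" "snd (c t) 0 = n"
    unfolding itrm_outputs_def itrm_halting_run_def by blast
  interpret wtime r using run by unfold_locales (simp add: itrm_run_def)
  obtain s where s: "is_start r s" "\<And>t. t \<in> Field r \<Longrightarrow> (s, t) \<in> r" using start_exists t by blast
  have "s = t"
  proof (rule ccontr)
    assume "s \<noteq> t"
    then have "s \<in> underS r t" using s t by (auto simp: underS_def)
    then obtain u where "is_next r s u" using ex_next by blast
    then show False using run by (auto simp: itrm_run_def)
  qed
  then show "n = R 0" using run s t by (auto simp: itrm_run_def)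
qed

text \<open>The empty program returns its input, and 2 is not an admissible output. This secures the
  hypothesis of \<open>itrm_outputs_iff_tcl\<close>.\<close>

lemma computes_not_Nil:
  assumes "\<And>i. itrm_outputs P y ((\<lambda>_. 0)(0 := i)) (if i \<in> z then 1 else 0)"
  shows "P \<noteq> []"
proof
  assume "P = []"
  then have "(if 2 \<in> z then 1 else 0) = (2 :: nat)"
    using itrm_outputs_Nil[of y "(\<lambda>_. 0)(0 := 2)" "if 2 \<in> z then 1 else 0"] assms[of 2] by simp
  then show False by (simp split: if_splits)
qed

lemma dfn_itrm_outputs:
  assumes "P \<noteq> []"
  shows "dfn (\<lambda>x w. itrm_outputs P x ((\<lambda>_. 0)(0 := p1 w)) (p2 w))"
proof -
  obtain N where N: "2 \<le> N" "\<forall>I\<in>set P. reg_bound N I" using ex_reg_bound by blast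
  interpret machine P N by unfold_locales (use N in blast)
  show ?thesis by (rule dfn_outputs[OF assms N(1)])
qed

lemma itrm_outputs_unique:
  assumes "P \<noteq> []" "itrm_outputs P A R m" "itrm_outputs P A R n"
  shows "m = n"
  using assms(2,3) halting_unique unfolding itrm_outputs_iff_tcl[OF assms(1)] by metis

lemma dfn_program:
  assumes "dfn \<phi>"
  obtains Q where "\<And>x R. itrm_outputs Q x R (if \<phi> x (R 0) then 1 else 0)"
proof -
  obtain c where c: "implD c \<phi>" using dfn_impl[OF assms] by blast
  have "itrm_outputs (compile 0 c) x R (if \<phi> x (R 0) then 1 else 0)" for x R
  proof -
    obtain R' M where "big x c R R' M" "R' 0 = (if \<phi> x (R 0) then 1 else 0)"
      using c unfolding implD_def ok_def by blast
    then show ?thesis using big_imp_itrm_outputs[of x c R R' M] by simp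
  qed
  then show ?thesis using that by blast
qed

theorem theorem10:
  fixes x y z :: "nat set"
  assumes "mutually_itrm_random x y"
    and "itrm_computable_from z x"
    and "itrm_computable_from z y"
  shows "itrm_computable z"
proof -
  obtain P where P: "\<And>i. itrm_outputs P x ((\<lambda>_. 0)(0 := i)) (if i \<in> z then 1 else 0)"
    using assms(2) unfolding itrm_computable_from_def by blast
  obtain Q where Q: "\<And>i. itrm_outputs Q y ((\<lambda>_. 0)(0 := i)) (if i \<in> z then 1 else 0)"
    using assms(3) unfolding itrm_computable_from_def by blast
  have PQ: "P \<noteq> []" "Q \<noteq> []" using computes_not_Nil[of P x z] computes_not_Nil[of Q y z] P Q by blast+
  define H where "H u i n \<longleftrightarrow> itrm_outputs P u ((\<lambda>_. 0)(0 := i)) n" for u i n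
  define G where "G u i n \<longleftrightarrow> itrm_outputs Q u ((\<lambda>_. 0)(0 := i)) n" for u i n
  have dH: "dfn (\<lambda>u w. H u (p1 w) (p2 w))" and dG: "dfn (\<lambda>u w. G u (p1 w) (p2 w))"
    unfolding H_def G_def using dfn_itrm_outputs PQ by blast+
  have Hu: "m = n" if "H u i m" "H u i n" for u i m n
    using itrm_outputs_unique[OF PQ(1)] that unfolding H_def by blast
  have Gz: "G y i 1 \<longleftrightarrow> i \<in> z" for i
    using Q[of i] itrm_outputs_unique[OF PQ(2) Q[of i], of 1] unfolding G_def by (auto split: if_splits)
  define X where "X = {u. \<forall>i. H u i (if i \<in> z then 1 else 0)}"
  have xX: "x \<in> X" using P by (simp add: X_def H_def)
  have "itrm_decidable_in X y"
  proof -
    have f: "fn (\<lambda>i. 2 * i)" "fn (\<lambda>i. Suc (2 * i))" by (intro fn.intros)+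
    \<comment> \<open>The odd half of the oracle tells through \<open>G\<close> whether
      \<open>i\<close> is in \<open>z\<close>; the even half is tested for giving the same answer
      through \<open>H\<close>.\<close>
    define \<psi> where "\<psi> u w \<longleftrightarrow> (\<forall>i. (G {i. Suc (2 * i) \<in> u} i 1 \<longrightarrow> H {i. 2 * i \<in> u} i 1) \<and>
       (\<not> G {i. Suc (2 * i) \<in> u} i 1 \<longrightarrow> H {i. 2 * i \<in> u} i 0))" for u and w :: nat
    have "dfn \<psi>"
      unfolding \<psi>_def
      by (intro dfn_logic dfn2[OF dfn_pullback[OF f(1) dH]] dfn2[OF dfn_pullback[OF f(2) dG]])
    then obtain R where R: "\<And>u S. itrm_outputs R u S (if \<psi> u (S 0) then 1 else 0)" using dfn_program by blast
    have "\<psi> (join u y) 0 \<longleftrightarrow> u \<in> X" for u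
    proof -
      have "{i. 2 * i \<in> join u y} = u" "{i. Suc (2 * i) \<in> join u y} = y"
        by (auto simp: join_def image_iff) presburger+
      then have "\<psi> (join u y) 0 \<longleftrightarrow> (\<forall>i. (i \<in> z \<longrightarrow> H u i 1) \<and> (i \<notin> z \<longrightarrow> H u i 0))"
        unfolding \<psi>_def by (simp only: Gz)
      then show ?thesis unfolding X_def by (simp split: if_split)
    qed
    then show ?thesis unfolding itrm_decidable_in_def using R[of "join _ y" "\<lambda>_. 0"] by (intro exI[of _ R]) simp
  qed
  then have nm: "\<not> meager_in cantor_space X"
    using assms(1) xX unfolding mutually_itrm_random_def itrm_random_relative_def by blast
  let ?A = "\<lambda>i n. {u. H u i n}"
  have dF: "(\<forall>w. BP {u. H u (p1 w) (p2 w)}) \<and> dfn (\<lambda>_ w. forced (p1 w) {u. H u (p1 (p2 w)) (p2 (p2 w))})"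
    using dfn_forced[OF dH] by simp
  have BP: "BP (?A i n)" for i n using spec[OF conjunct1[OF dF], of "pr i n"] by simp
  \<comment> \<open>Otherwise every consistent \<open>t\<close> fails to force the right answer on
    some \<open>i\<close>, and an extension forces that \<open>P\<close> does not give it; then
    \<open>X\<close> would be meager.\<close>
  have "\<exists>s. con s \<and> (\<forall>i. forced s (?A i (if i \<in> z then 1 else 0)))"
  proof (rule ccontr)
    assume n: "\<not> (\<exists>s. con s \<and> (\<forall>i. forced s (?A i (if i \<in> z then 1 else 0))))"
    have "forced 0 (- X)"
    proof (rule forced_local)
      fix t assume t: "ext t 0" "con t"
      then obtain i where i: "\<not> forced t (?A i (if i \<in> z then 1 else 0))" using n by blast
      then obtain t' where t': "ext t' t" "con t'" "forced t' (- ?A i (if i \<in> z then 1 else 0))"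
        using forced_Compl[OF BP_Compl[OF BP], of t i "if i \<in> z then 1 else 0"] by auto
      have "forced t' (- X)" using t'(3) by (rule forced_mono) (unfold X_def, blast)
      then show "\<exists>t'. ext t' t \<and> con t' \<and> forced t' (- X)" using t' by blast
    qed
    then show False using nm forced_Compl_imp_meager by blast
  qed
  then obtain s where s: "con s" "\<And>i. forced s (?A i (if i \<in> z then 1 else 0))" by blast
  have z: "i \<in> z \<longleftrightarrow> forced s (?A i 1)" for i
  proof
    assume "i \<in> z" then show "forced s (?A i 1)" using s(2)[of i] by simp
  next
    assume f: "forced s (?A i 1)"
    show "i \<in> z"
    proof (rule ccontr)
      \<comment> \<open>Both 0 and 1 would be forced as outputs on \<open>i\<close>, against the
        uniqueness of outputs.\<close>
      assume "i \<notin> z"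
      then have "forced s (?A i 0)" using s(2)[of i] by simp
      from forced_consistent[OF s(1) f this] Hu show False by fastforce
    qed
  qed
  have "dfn (\<lambda>_ i. forced s (?A i 1))"
    using dfn_subst[OF conjunct2[OF dF], of "\<lambda>i. pr s (pr i 1)"] by (simp add: fn_pr fn_const fn_id)
  then obtain R where R: "\<And>u S. itrm_outputs R u S (if forced s (?A (S 0) 1) then 1 else 0)" using dfn_program by blast
  have "itrm_outputs R {} ((\<lambda>_. 0)(0 := i)) (if i \<in> z then 1 else 0)" for i
    using R[of "{}" "(\<lambda>_. 0)(0 := i)"] z[of i] by simp
  then show ?thesis unfolding itrm_computable_def itrm_computable_from_def by blast
qed

end
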